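(* Let $(W_t)$ be a $d$-dimensional standard Brownian motion and $x_0\in\mathbb{R}^m$. Let $b:\mathbb{R}^m\to\mathbb{R}^m$ and $\sigma:\mathbb{R}^m\to\mathcal{M}_{m,d}(\mathbb{R})$ be locally Lipschitz (for each $N>0$ there is $K_N$ with $|b(x)-b(y)|\le K_N|x-y|$ and $\|\sigma(x)-\sigma(y)\|\le K_N|x-y|$ whenever $|x|,|y|\le N$) and of linear growth ($|b(x)|\le K_1(1+|x|)$, $\|\sigma(x)\|\le K_1(1+|x|)$). For each $h>0$ let $\eta^{(h)}:\mathbb{R}^m\times\mathbb{R}^d\to\mathbb{R}^m$ be measurable with $|\eta^{(h)}(x,y)|\le K_2(h^\alpha|x|+|y|)$ for some $\alpha\in(0,+\infty]$, $K_2$ and all $h,x,y$. Let $(X_t)$ solve $dX_t=b(X_t)dt+\sigma(X_t)dW_t$, $X_0=x_0$; let $X^h_0=x_0$, $X^h_{(n+1)h}=X^h_{nh}+\sigma(X^h_{nh})(W_{(n+1)h}-W_{nh})+hb(X^h_{nh})+h\eta^{(h)}(X^h_{nh},W_{(n+1)h}-W_{nh})$, and $X^h_t=X^h_{\lfloor t/h\rfloor h}+\frac{t-\lfloor t/h\rfloor h}{h}\{X^h_{(\lfloor t/h\rfloor+1)h}-X^h_{\lfloor t/h\rfloor h}\}$. Then for all $\tau>0$ and all $p>2$, \[\lim_{h\to0}\mathbb{E}\Big[\big(\sup_{t\in[0,\tau]}|X_t-X^h_t|\big)^p\Big]=0.\]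
   Context: $|\cdot|$ is the Euclidean norm; $\|\cdot\|$ is the Hilbert–Schmidt norm on $m\times d$ real matrices. When $\alpha=+\infty$, $h^\alpha$ is interpreted as $0$. *)

theory Defs
  imports "HOL-Probability.Probability"
begin

definition filtration_on :: "'a measure \<Rightarrow> (real \<Rightarrow> 'a measure) \<Rightarrow> bool" where
  "filtration_on M F \<longleftrightarrow>
     (\<forall>t\<ge>0. subalgebra M (F t)) \<and>
     (\<forall>s t. 0 \<le> s \<longrightarrow> s \<le> t \<longrightarrow> sets (F s) \<subseteq> sets (F t))"

definition brownian_motion ::
  "'a measure \<Rightarrow> (real \<Rightarrow> 'a measure) \<Rightarrow> (real \<Rightarrow> 'a \<Rightarrow> real ^ 'd) \<Rightarrow> bool" where
  "brownian_motion M F W \<longleftrightarrow>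
     filtration_on M F \<and>
     (\<forall>t\<ge>0. W t \<in> borel_measurable (F t)) \<and>
     (\<forall>\<omega>\<in>space M. W 0 \<omega> = 0) \<and>
     (\<forall>\<omega>\<in>space M. continuous_on {0..} (\<lambda>t. W t \<omega>)) \<and>
     (\<forall>s t. 0 \<le> s \<longrightarrow> s < t \<longrightarrow>
        distributed M lborel (\<lambda>\<omega>. W t \<omega> - W s \<omega>)
          (\<lambda>x. ennreal (\<Prod>i\<in>UNIV. normal_density 0 (sqrt (t - s)) (x $ i)))) \<and>
     (\<forall>s t. 0 \<le> s \<longrightarrow> s < t \<longrightarrow>
        (\<forall>A\<in>sets (F s). \<forall>B\<in>sets borel.
           measure M (A \<inter> ((\<lambda>\<omega>. W t \<omega> - W s \<omega>) -` B \<inter> space M)) =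
           measure M A * measure M ((\<lambda>\<omega>. W t \<omega> - W s \<omega>) -` B \<inter> space M)))"

text \<open>Strong solution of dX = b(X) dt + sigma(X) dW, X_0 = x0, on [0,\<infinity>).
  The Ito integral of the continuous adapted integrand sigma(X_s) is expressed as the
  limit in probability of left-point Riemann sums over uniform partitions of [0,t].\<close>
definition sde_solution ::
  "'a measure \<Rightarrow> (real \<Rightarrow> 'a measure) \<Rightarrow> (real \<Rightarrow> 'a \<Rightarrow> real ^ 'd)
   \<Rightarrow> (real ^ 'm \<Rightarrow> real ^ 'm) \<Rightarrow> (real ^ 'm \<Rightarrow> real ^ 'd ^ 'm) \<Rightarrow> real ^ 'm
   \<Rightarrow> (real \<Rightarrow> 'a \<Rightarrow> real ^ 'm) \<Rightarrow> bool" where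
  "sde_solution M F W b \<sigma> x0 X \<longleftrightarrow>
     (\<forall>t\<ge>0. X t \<in> borel_measurable (F t)) \<and>
     (\<forall>\<omega>\<in>space M. continuous_on {0..} (\<lambda>t. X t \<omega>)) \<and>
     (\<forall>t\<ge>0. \<forall>\<epsilon>>0.
        (\<lambda>n::nat. measure M {\<omega>\<in>space M.
            norm (X t \<omega> - x0 - integral {0..t} (\<lambda>s. b (X s \<omega>))
                  - (\<Sum>i<n. \<sigma> (X (real i * t / real n) \<omega>) *v
                        (W (real (Suc i) * t / real n) \<omega> - W (real i * t / real n) \<omega>)))
            > \<epsilon>}) \<longlonglongrightarrow> 0)"

text \<open>h to the power alpha, for alpha in (0,+\<infinity>]; h^(+\<infinity>) is interpreted as 0.\<close>
definition hpow :: "real \<Rightarrow> ereal \<Rightarrow> real" where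
  "hpow h \<alpha> = (case \<alpha> of ereal a \<Rightarrow> h powr a | _ \<Rightarrow> 0)"

primrec euler_grid ::
  "(real \<Rightarrow> 'a \<Rightarrow> real ^ 'd) \<Rightarrow> (real ^ 'm \<Rightarrow> real ^ 'm) \<Rightarrow> (real ^ 'm \<Rightarrow> real ^ 'd ^ 'm)
   \<Rightarrow> (real \<Rightarrow> real ^ 'm \<Rightarrow> real ^ 'd \<Rightarrow> real ^ 'm) \<Rightarrow> real ^ 'm \<Rightarrow> real \<Rightarrow> nat \<Rightarrow> 'a \<Rightarrow> real ^ 'm"
where
  "euler_grid W b \<sigma> \<eta> x0 h 0 \<omega> = x0"
| "euler_grid W b \<sigma> \<eta> x0 h (Suc n) \<omega> =
     (let Y = euler_grid W b \<sigma> \<eta> x0 h n \<omega>;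
          dW = W (real (Suc n) * h) \<omega> - W (real n * h) \<omega>
      in Y + \<sigma> Y *v dW + h *\<^sub>R b Y + h *\<^sub>R \<eta> h Y dW)"

definition euler_interp ::
  "(real \<Rightarrow> 'a \<Rightarrow> real ^ 'd) \<Rightarrow> (real ^ 'm \<Rightarrow> real ^ 'm) \<Rightarrow> (real ^ 'm \<Rightarrow> real ^ 'd ^ 'm)
   \<Rightarrow> (real \<Rightarrow> real ^ 'm \<Rightarrow> real ^ 'd \<Rightarrow> real ^ 'm) \<Rightarrow> real ^ 'm \<Rightarrow> real \<Rightarrow> real \<Rightarrow> 'a \<Rightarrow> real ^ 'm"
where
  "euler_interp W b \<sigma> \<eta> x0 h t \<omega> =
     (let n = nat \<lfloor>t / h\<rfloor>
      in euler_grid W b \<sigma> \<eta> x0 h n \<omega> +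
         ((t - real n * h) / h) *\<^sub>R
           (euler_grid W b \<sigma> \<eta> x0 h (Suc n) \<omega> - euler_grid W b \<sigma> \<eta> x0 h n \<omega>))"

end

theory Submission
  imports Defs
begin

text \<open>
  Three elementary ingredients replace stochastic calculus.

  For \<open>V x = (1 + |x|\<^sup>2)\<^sup>k\<close> one Euler step satisfies \<open>E[V(Y\<^sub>n\<^sub>+\<^sub>1) | F\<^sub>n] \<le> (1 + C h) V(Y\<^sub>n)\<close>, because the term
  linear in the Brownian increment has mean zero. The supermartingale maximal inequality then
  gives a tail of order \<open>c\<^sup>-\<^sup>2\<^sup>k\<close> for the maximum of the scheme, uniformly in \<open>h\<close>.

  The scheme converges to \<open>X\<close> in probability, uniformly on the grid. Stop at the first grid time
  at which \<open>X\<close> has left a ball of radius \<open>R\<close> or the error exceeds \<open>\<epsilon>\<close>. On a grid refined \<open>m\<close> times the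
  stopped error is, up to a residual that vanishes in probability as \<open>m \<rightarrow> \<infinity>\<close>, a sum whose second
  moment is controlled by orthogonality of the increments and the local Lipschitz bounds; a
  discrete Gronwall argument and Chebyshev's inequality at the stopping time finish this part.

  The solution inherits the uniform tail of the scheme, and convergence in probability together
  with tails of arbitrary polynomial order gives convergence in \<open>L\<^sup>p\<close>.
\<close>

section \<open>Preliminaries from analysis\<close>

lemma norm_matrix_vector_mult_le:
  fixes A :: "real^'d^'m" and x :: "real^'d"
  shows "norm (A *v x) \<le> norm A * norm x"
proof -
  have "norm (A *v x) = L2_set (\<lambda>i. \<bar>(A $ i) \<bullet> x\<bar>) UNIV"
    by (simp add: norm_vec_def matrix_vector_mult_def inner_vec_def)
  also have "\<dots> \<le> L2_set (\<lambda>i. norm (A $ i) * norm x) UNIV"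
    by (intro L2_set_mono) (auto intro: Cauchy_Schwarz_ineq2)
  also have "\<dots> = norm A * norm x"
    by (simp add: L2_set_left_distrib norm_vec_def[of A])
  finally show ?thesis .
qed

lemma inner_transpose_matrix_vector:
  fixes A :: "real^'d^'m"
  shows "(transpose A *v x) \<bullet> y = x \<bullet> (A *v y)"
  by (metis dot_lmul_matrix transpose_matrix_vector)

lemma norm_transpose_matrix_vector_le:
  fixes A :: "real^'d^'m"
  shows "norm (transpose A *v x) \<le> norm A * norm x"
proof -
  define u where "u = transpose A *v x"
  have "norm u * norm u = x \<bullet> (A *v u)"
    using inner_transpose_matrix_vector[of A x u] by (simp add: u_def dot_square_norm power2_eq_square)
  also have "\<dots> \<le> norm x * (norm A * norm u)"
    by (rule order_trans[OF norm_cauchy_schwarz mult_left_mono[OF norm_matrix_vector_mult_le]]) simp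
  finally have "norm u * norm u \<le> (norm A * norm x) * norm u"
    by (simp add: mult_ac)
  then show ?thesis
    unfolding u_def[symmetric] by (cases "u = 0") auto
qed

lemma bounded_bilinear_matrix_vector_mult:
  "bounded_bilinear ((*v) :: real^'d^'m \<Rightarrow> real^'d \<Rightarrow> real^'m)"
proof
  show "\<exists>K. \<forall>(a :: real^'d^'m) b. norm (a *v b) \<le> norm a * norm b * K"
    by (rule exI[of _ 1]) (simp add: norm_matrix_vector_mult_le)
qed (simp_all add: matrix_vector_mult_add_rdistrib matrix_vector_right_distrib
      scaleR_matrix_vector_assoc matrix_vector_mult_scaleR)

lemma borel_measurable_matrix_vector_mult [measurable (raw)]:
  fixes A :: "'a \<Rightarrow> real^'d^'m" and x :: "'a \<Rightarrow> real^'d"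
  assumes "A \<in> borel_measurable N" "x \<in> borel_measurable N"
  shows "(\<lambda>\<omega>. A \<omega> *v x \<omega>) \<in> borel_measurable N"
  by (rule borel_measurable_continuous_Pair[OF assms])
    (intro bounded_bilinear.continuous_on[OF bounded_bilinear_matrix_vector_mult] continuous_intros)

lemma borel_measurable_transpose [measurable]:
  "transpose \<in> borel_measurable (borel :: (real^'d^'m) measure)"
  unfolding transpose_def by (intro borel_measurable_continuous_onI continuous_intros)

lemma norm_add_square_le:
  fixes x y :: "'a::real_normed_vector"
  shows "(norm (x + y))\<^sup>2 \<le> 2 * (norm x)\<^sup>2 + 2 * (norm y)\<^sup>2"
proof -
  have "(norm (x + y))\<^sup>2 \<le> (norm x + norm y)\<^sup>2"
    by (intro power_mono norm_triangle_ineq) auto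
  also have "\<dots> \<le> 2 * (norm x)\<^sup>2 + 2 * (norm y)\<^sup>2"
    using sum_squares_bound[of "norm x" "norm y"] by (simp add: power2_sum)
  finally show ?thesis .
qed

lemma norm_sum_square_le:
  fixes f :: "'i \<Rightarrow> 'a::real_normed_vector"
  shows "(norm (\<Sum>i\<in>I. f i))\<^sup>2 \<le> real (card I) * (\<Sum>i\<in>I. (norm (f i))\<^sup>2)"
proof -
  have "(norm (\<Sum>i\<in>I. f i))\<^sup>2 \<le> (\<Sum>i\<in>I. norm (f i))\<^sup>2"
    by (intro power_mono norm_sum) auto
  also have "\<dots> \<le> real (card I) * (\<Sum>i\<in>I. (norm (f i))\<^sup>2)"
    using sum_squared_le_sum_of_squares[of "\<lambda>i. norm (f i)" I] by (simp add: mult.commute)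
  finally show ?thesis .
qed

lemma sum_power_le:
  fixes f :: "'i \<Rightarrow> real"
  assumes "finite I" "I \<noteq> {}" "\<And>i. i \<in> I \<Longrightarrow> 0 \<le> f i"
  shows "(\<Sum>i\<in>I. f i) ^ n \<le> real (card I) ^ n * (\<Sum>i\<in>I. f i ^ n)"
proof -
  obtain j where j_max: "j \<in> I" "\<And>i. i \<in> I \<Longrightarrow> f i \<le> f j"
    using Max_in[of "f ` I"] Max_ge[of "f ` I"] assms(1,2) by fastforce
  have "(\<Sum>i\<in>I. f i) ^ n \<le> (real (card I) * f j) ^ n"
    using j_max assms by (intro power_mono sum_bounded_above sum_nonneg)
  also have "\<dots> = real (card I) ^ n * f j ^ n"
    by (rule power_mult_distrib)
  also have "\<dots> \<le> real (card I) ^ n * (\<Sum>i\<in>I. f i ^ n)"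
    using j_max assms by (intro mult_left_mono member_le_sum) auto
  finally show ?thesis .
qed

lemma one_plus_power_le_exp:
  fixes c h T :: real
  assumes "c \<ge> 0" "h \<ge> 0" "real n * h \<le> T"
  shows "(1 + c * h) ^ n \<le> exp (c * T)"
proof -
  have "(1 + c * h) ^ n \<le> exp (c * h) ^ n"
    using assms by (intro power_mono) auto
  also have "\<dots> = exp (c * (real n * h))"
    by (simp add: exp_of_nat_mult[symmetric] mult_ac)
  also have "\<dots> \<le> exp (c * T)"
    using assms by (auto intro: mult_left_mono)
  finally show ?thesis .
qed

lemma discrete_gronwall:
  fixes e :: "nat \<Rightarrow> real"
  assumes c_nonneg: "c \<ge> 0" and recursion: "\<And>l. l < n \<Longrightarrow> e l \<le> a + c * (\<Sum>k<l. e k)"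
  shows "a + c * (\<Sum>k<n. e k) \<le> a * (1 + c) ^ n"
  using recursion
proof (induction n)
  case (Suc n)
  have "a + c * (\<Sum>k<Suc n. e k) = (a + c * (\<Sum>k<n. e k)) + c * e n"
    by (simp add: algebra_simps)
  also have "\<dots> \<le> (a + c * (\<Sum>k<n. e k)) + c * (a + c * (\<Sum>k<n. e k))"
    using c_nonneg Suc.prems[of n] by (intro add_left_mono mult_left_mono) auto
  also have "\<dots> = (1 + c) * (a + c * (\<Sum>k<n. e k))"
    by (simp add: algebra_simps)
  also have "\<dots> \<le> (1 + c) * (a * (1 + c) ^ n)"
    using Suc c_nonneg by (intro mult_left_mono) auto
  finally show ?case by (simp add: mult_ac)
qed simp

lemma le_if_le_add_tendsto_0:
  fixes a b :: real
  assumes "\<And>n. n > 0 \<Longrightarrow> a \<le> b + f n" "f \<longlonglongrightarrow> 0"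
  shows "a \<le> b"
proof (rule LIMSEQ_le_const)
  show "(\<lambda>n. b + f n) \<longlonglongrightarrow> b"
    using tendsto_add[OF tendsto_const assms(2), of b] by simp
  show "\<exists>N. \<forall>n\<ge>N. a \<le> b + f n"
    using assms(1) by (intro exI[of _ 1]) auto
qed

lemma continuous_on_UNIV_if_lipschitz_on_cball:
  fixes f :: "'a::real_normed_vector \<Rightarrow> 'b::metric_space"
  assumes "\<And>r. r > 0 \<Longrightarrow> \<exists>K. K-lipschitz_on (cball 0 r) f"
  shows "continuous_on UNIV f"
proof (rule continuous_at_imp_continuous_on, rule ballI)
  fix x :: 'a
  obtain K where "K-lipschitz_on (cball 0 (norm x + 1)) f"
    using assms[of "norm x + 1"] by (metis add_nonneg_pos norm_ge_zero zero_less_one)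
  then have "continuous_on (ball 0 (norm x + 1)) f"
    by (intro lipschitz_on_continuous_on[OF lipschitz_on_subset]) auto
  then show "isCont f x"
    by (simp add: continuous_on_eq_continuous_at)
qed

subsection \<open>Riemann sums\<close>

lemma norm_integral_minus_left_value_le:
  fixes f :: "real \<Rightarrow> 'b::euclidean_space"
  assumes a_le_b: "a \<le> b" and f_continuous: "continuous_on {a..b} f"
    and f_diff_le: "\<And>s. s \<in> {a..b} \<Longrightarrow> norm (f s - f a) \<le> e"
  shows "norm (integral {a..b} f - (b - a) *\<^sub>R f a) \<le> e * (b - a)"
proof -
  have "integral {a..b} (\<lambda>s. f s - f a) = integral {a..b} f - (b - a) *\<^sub>R f a"
    using a_le_b f_continuous
    by (subst Henstock_Kurzweil_Integration.integral_diff) (auto intro: integrable_continuous_real)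
  moreover have "norm (integral {a..b} (\<lambda>s. f s - f a)) \<le> e * (b - a)"
    using a_le_b f_continuous f_diff_le by (intro integral_bound continuous_intros)
  ultimately show ?thesis by simp
qed

lemma norm_integral_minus_riemann_sum_le:
  fixes f :: "real \<Rightarrow> 'b::euclidean_space"
  assumes \<delta>_nonneg: "\<delta> \<ge> 0" and f_continuous: "continuous_on {0..T} f" and grid_end_le: "real n * \<delta> \<le> T"
    and f_diff_le: "\<And>s t. \<lbrakk>s \<in> {0..T}; t \<in> {0..T}; \<bar>s - t\<bar> \<le> \<delta>\<rbrakk> \<Longrightarrow> norm (f s - f t) \<le> e"
  shows "norm (integral {0..real n * \<delta>} f - (\<Sum>i<n. \<delta> *\<^sub>R f (real i * \<delta>))) \<le> e * (real n * \<delta>)"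
  using grid_end_le
proof (induction n)
  case (Suc n)
  let ?a = "real n * \<delta>" and ?b = "real (Suc n) * \<delta>"
  have piece_bounds: "0 \<le> ?a" "?a \<le> ?b" "?b \<le> T" "?b - ?a = \<delta>"
    using \<delta>_nonneg Suc.prems by (auto simp: algebra_simps)
  have piece: "norm (integral {?a..?b} f - \<delta> *\<^sub>R f ?a) \<le> e * \<delta>"
  proof -
    have "norm (integral {?a..?b} f - (?b - ?a) *\<^sub>R f ?a) \<le> e * (?b - ?a)"
    proof (rule norm_integral_minus_left_value_le)
      show "continuous_on {?a..?b} f"
        by (rule continuous_on_subset[OF f_continuous]) (use piece_bounds in auto)
      show "norm (f s - f ?a) \<le> e" if "s \<in> {?a..?b}" for s
        using piece_bounds that by (intro f_diff_le; simp only: atLeastAtMost_iff; linarith)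
    qed (use piece_bounds in simp)
    then show ?thesis unfolding piece_bounds(4) .
  qed
  have "integral {0..?b} f = integral {0..?a} f + integral {?a..?b} f"
    using piece_bounds
    by (intro Henstock_Kurzweil_Integration.integral_combine[symmetric] integrable_continuous_real
        continuous_on_subset[OF f_continuous]) auto
  then have "integral {0..?b} f - (\<Sum>i<Suc n. \<delta> *\<^sub>R f (real i * \<delta>)) =
      (integral {0..?a} f - (\<Sum>i<n. \<delta> *\<^sub>R f (real i * \<delta>))) + (integral {?a..?b} f - \<delta> *\<^sub>R f ?a)"
    by simp
  also have "norm \<dots> \<le> e * ?a + e * \<delta>"
    using Suc.IH piece_bounds by (intro order_trans[OF norm_triangle_ineq add_mono[OF _ piece]]) auto
  finally show ?case by (simp add: algebra_simps)
qed simp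

lemma riemann_sum_tendsto:
  fixes f :: "real \<Rightarrow> 'b::euclidean_space"
  assumes t_nonneg: "t \<ge> 0" and f_continuous: "continuous_on {0..t} f"
  shows "(\<lambda>n. \<Sum>i<n. (t / real n) *\<^sub>R f (real i * (t / real n))) \<longlonglongrightarrow> integral {0..t} f"
proof (rule metric_LIMSEQ_I)
  fix e :: real assume e_pos: "e > 0"
  define e' where "e' = e / (t + 1)"
  have e'_bounds: "e' > 0" "e' * t < e"
    using e_pos t_nonneg by (auto simp: e'_def field_simps)
  have "uniformly_continuous_on {0..t} f"
    using f_continuous by (rule compact_uniformly_continuous) auto
  then obtain d where d_pos: "d > 0"
    and uniform: "\<And>s u. \<lbrakk>s \<in> {0..t}; u \<in> {0..t}; dist u s < d\<rbrakk> \<Longrightarrow> dist (f u) (f s) < e'"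
    using e'_bounds unfolding uniformly_continuous_on_def by metis
  have "(\<lambda>n. t / real n) \<longlonglongrightarrow> 0"
    by (rule lim_const_over_n)
  then have "eventually (\<lambda>n. t / real n < d \<and> n > 0) sequentially"
    using d_pos by (intro eventually_conj order_tendstoD(2) eventually_gt_at_top)
  then have "eventually (\<lambda>n. dist (\<Sum>i<n. (t / real n) *\<^sub>R f (real i * (t / real n))) (integral {0..t} f) < e)
      sequentially"
  proof eventually_elim
    case (elim n)
    have "norm (integral {0..real n * (t / real n)} f - (\<Sum>i<n. (t / real n) *\<^sub>R f (real i * (t / real n))))
        \<le> e' * (real n * (t / real n))"
    proof (rule norm_integral_minus_riemann_sum_le[OF _ f_continuous])
      fix s u assume "s \<in> {0..t}" "u \<in> {0..t}" "\<bar>s - u\<bar> \<le> t / real n"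
      then show "norm (f s - f u) \<le> e'"
        using uniform[of u s] elim by (force simp: dist_norm intro: less_imp_le)
    qed (use t_nonneg elim in auto)
    then show ?case
      using e'_bounds elim by (auto simp: dist_norm norm_minus_commute)
  qed
  then show "\<exists>m. \<forall>n\<ge>m. dist (\<Sum>i<n. (t / real n) *\<^sub>R f (real i * (t / real n))) (integral {0..t} f) < e"
    by (simp add: eventually_sequentially)
qed

subsection \<open>Linear interpolation on a grid\<close>

lemma nat_floor_grid:
  fixes t h :: real
  assumes "0 \<le> t" "0 < h"
  shows "real (nat \<lfloor>t / h\<rfloor>) * h \<le> t" "t < real (Suc (nat \<lfloor>t / h\<rfloor>)) * h"
proof -
  have floor_eq: "real (nat \<lfloor>t / h\<rfloor>) = of_int \<lfloor>t / h\<rfloor>"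
    using assms by simp
  show "real (nat \<lfloor>t / h\<rfloor>) * h \<le> t"
    unfolding floor_eq using assms of_int_floor_le[of "t / h"] by (simp only: pos_le_divide_eq)
  have "t / h < of_int \<lfloor>t / h\<rfloor> + 1"
    by linarith
  then show "t < real (Suc (nat \<lfloor>t / h\<rfloor>)) * h"
    unfolding of_nat_Suc floor_eq using assms by (simp only: pos_divide_less_eq add.commute)
qed

definition linear_interp :: "real \<Rightarrow> (nat \<Rightarrow> 'b::real_normed_vector) \<Rightarrow> real \<Rightarrow> 'b" where
  "linear_interp h y t =
     (let n = nat \<lfloor>t / h\<rfloor> in y n + ((t - real n * h) / h) *\<^sub>R (y (Suc n) - y n))"

lemma linear_interp_in_closed_segment:
  assumes "0 \<le> t" "0 < h"
  shows "linear_interp h y t \<in> closed_segment (y (nat \<lfloor>t / h\<rfloor>)) (y (Suc (nat \<lfloor>t / h\<rfloor>)))"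
proof -
  define n where "n = nat \<lfloor>t / h\<rfloor>"
  define u where "u = (t - real n * h) / h"
  have "0 \<le> u" "u \<le> 1"
    using nat_floor_grid[OF assms] assms by (auto simp: u_def n_def field_simps)
  moreover have "linear_interp h y t = (1 - u) *\<^sub>R y n + u *\<^sub>R y (Suc n)"
    by (simp add: linear_interp_def n_def u_def Let_def algebra_simps)
  ultimately show ?thesis
    unfolding n_def in_segment by blast
qed

text \<open>The clamped slopes below do not involve \<open>\<lfloor>t / h\<rfloor>\<close>, which makes the interpolation visibly
  continuous.\<close>

lemma linear_interp_eq_sum:
  assumes t_bounds: "0 \<le> t" "t < real N * h" and h_pos: "0 < h"
  shows "linear_interp h y t = y 0 + (\<Sum>k<N. max 0 (min 1 (t / h - real k)) *\<^sub>R (y (Suc k) - y k))"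
proof -
  define n where "n = nat \<lfloor>t / h\<rfloor>"
  define slope where "slope k = max 0 (min 1 (t / h - real k))" for k
  have node_bounds: "real n \<le> t / h" "t / h < real n + 1"
    using nat_floor_grid[OF t_bounds(1) h_pos] h_pos
    by (simp_all add: n_def pos_le_divide_eq pos_divide_less_eq add.commute)
  have "t / h < real N"
    using t_bounds(2) h_pos by (simp only: pos_divide_less_eq)
  with node_bounds(1) have "real n < real N"
    by (rule le_less_trans)
  then have Suc_n_le_N: "Suc n \<le> N"
    by simp
  have slope_gt: "slope k = 0" if "n < k" for k
    using that node_bounds(2) by (auto simp: slope_def)
  have slope_lt: "slope k = 1" if "k < n" for k
  proof -
    have "real k + 1 \<le> real n" using that by simp
    then show ?thesis using node_bounds(1) by (auto simp: slope_def)
  qed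
  have "(\<Sum>k<N. slope k *\<^sub>R (y (Suc k) - y k)) = (\<Sum>k<Suc n. slope k *\<^sub>R (y (Suc k) - y k))"
    using Suc_n_le_N slope_gt by (intro sum.mono_neutral_right) auto
  also have "\<dots> = (\<Sum>k<n. y (Suc k) - y k) + slope n *\<^sub>R (y (Suc n) - y n)"
    using slope_lt by simp
  also have "slope n = (t - real n * h) / h"
    using node_bounds h_pos by (simp add: slope_def diff_divide_distrib)
  finally show ?thesis
    by (simp add: linear_interp_def Let_def n_def[symmetric] slope_def[symmetric] sum_lessThan_telescope)
qed

lemma continuous_on_linear_interp:
  assumes "0 < h"
  shows "continuous_on {0..T} (linear_interp h y)"
proof -
  obtain N :: nat where "T / h < real N"
    using reals_Archimedean2 by blast
  then have "T < real N * h"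
    using assms by (simp add: pos_divide_less_eq)
  then have "linear_interp h y t = y 0 + (\<Sum>k<N. max 0 (min 1 (t / h - real k)) *\<^sub>R (y (Suc k) - y k))"
    if "t \<in> {0..T}" for t
    using that assms by (intro linear_interp_eq_sum) auto
  then show ?thesis
    by (rule continuous_on_cong[THEN iffD2, OF refl]) (use assms in \<open>auto intro!: continuous_intros\<close>)
qed

section \<open>Preliminaries from probability\<close>

subsection \<open>Mean squares\<close>

definition square_integrable :: "'a measure \<Rightarrow> ('a \<Rightarrow> 'b::real_normed_vector) \<Rightarrow> bool" where
  "square_integrable M f \<longleftrightarrow> f \<in> borel_measurable M \<and> integrable M (\<lambda>x. (norm (f x))\<^sup>2)"

definition mean_square :: "'a measure \<Rightarrow> ('a \<Rightarrow> 'b::real_normed_vector) \<Rightarrow> real" where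
  "mean_square M f = (\<integral>x. (norm (f x))\<^sup>2 \<partial>M)"

lemma square_integrable_measurable: "square_integrable M f \<Longrightarrow> f \<in> borel_measurable M"
  by (simp add: square_integrable_def)

lemma square_integrableD: "square_integrable M f \<Longrightarrow> integrable M (\<lambda>x. (norm (f x))\<^sup>2)"
  by (simp add: square_integrable_def)

lemma mean_square_nonneg [simp]: "mean_square M f \<ge> 0"
  by (simp add: mean_square_def)

lemma
  assumes f_measurable: "f \<in> borel_measurable M" and g_integrable: "integrable M g"
    and norm_square_le: "\<And>x. x \<in> space M \<Longrightarrow> (norm (f x))\<^sup>2 \<le> g x"
  shows square_integrable_boundI: "square_integrable M f"
    and mean_square_le_integral: "mean_square M f \<le> integral\<^sup>L M g"
proof -
  have "integrable M (\<lambda>x. (norm (f x))\<^sup>2)"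
  proof (rule Bochner_Integration.integrable_bound[OF g_integrable])
    show "AE x in M. norm ((norm (f x))\<^sup>2) \<le> norm (g x)"
      using norm_square_le by (intro AE_I2) (simp add: order_trans[OF _ abs_ge_self])
  qed (use f_measurable in measurable)
  then show "square_integrable M f" "mean_square M f \<le> integral\<^sup>L M g"
    unfolding square_integrable_def mean_square_def
    using f_measurable g_integrable norm_square_le
    by (auto intro: integral_mono)
qed

lemma square_integrable_zero [simp]: "square_integrable M (\<lambda>_. 0)"
  and mean_square_zero [simp]: "mean_square M (\<lambda>_. 0) = 0"
  by (simp_all add: square_integrable_def mean_square_def)

lemma square_integrable_scaleR:
  assumes "square_integrable M f"
  shows "square_integrable M (\<lambda>x. c *\<^sub>R f x)"
  using assms by (auto simp: square_integrable_def power_mult_distrib)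

lemma mean_square_scaleR: "mean_square M (\<lambda>x. c *\<^sub>R f x) = c\<^sup>2 * mean_square M f"
  by (simp add: mean_square_def power_mult_distrib)

lemma mean_square_uminus [simp]: "mean_square M (\<lambda>x. - f x) = mean_square M f"
  by (simp add: mean_square_def)

lemma
  fixes f g :: "'a \<Rightarrow> 'b::{real_normed_vector,second_countable_topology}"
  assumes f_square_integrable: "square_integrable M f" and g_square_integrable: "square_integrable M g"
  shows square_integrable_addI: "square_integrable M (\<lambda>x. f x + g x)"
    and mean_square_add_le: "mean_square M (\<lambda>x. f x + g x) \<le> 2 * mean_square M f + 2 * mean_square M g"
proof -
  have add_measurable: "(\<lambda>x. f x + g x) \<in> borel_measurable M"
    using f_square_integrable g_square_integrable
    by (intro borel_measurable_add square_integrable_measurable)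
  have bound_integrable: "integrable M (\<lambda>x. 2 * (norm (f x))\<^sup>2 + 2 * (norm (g x))\<^sup>2)"
    using square_integrableD[OF f_square_integrable] square_integrableD[OF g_square_integrable] by simp
  show "square_integrable M (\<lambda>x. f x + g x)"
    by (rule square_integrable_boundI[OF add_measurable bound_integrable norm_add_square_le])
  have "mean_square M (\<lambda>x. f x + g x) \<le> (\<integral>x. 2 * (norm (f x))\<^sup>2 + 2 * (norm (g x))\<^sup>2 \<partial>M)"
    by (rule mean_square_le_integral[OF add_measurable bound_integrable norm_add_square_le])
  then show "mean_square M (\<lambda>x. f x + g x) \<le> 2 * mean_square M f + 2 * mean_square M g"
    using square_integrableD[OF f_square_integrable] square_integrableD[OF g_square_integrable]
    by (simp add: mean_square_def)
qed

lemma
  fixes f g :: "'a \<Rightarrow> 'b::{real_normed_vector,second_countable_topology}"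
  assumes f_square_integrable: "square_integrable M f" and g_square_integrable: "square_integrable M g"
  shows square_integrable_diffI: "square_integrable M (\<lambda>x. f x - g x)"
    and mean_square_diff_le: "mean_square M (\<lambda>x. f x - g x) \<le> 2 * mean_square M f + 2 * mean_square M g"
  using square_integrable_addI[OF f_square_integrable square_integrable_scaleR[OF g_square_integrable, of "-1"]]
    mean_square_add_le[OF f_square_integrable square_integrable_scaleR[OF g_square_integrable, of "-1"]]
  by (simp_all add: mean_square_scaleR)

lemma
  fixes f :: "'i \<Rightarrow> 'a \<Rightarrow> 'b::{real_normed_vector,second_countable_topology}"
  assumes f_square_integrable: "\<And>i. i \<in> I \<Longrightarrow> square_integrable M (f i)"
  shows square_integrable_sumI: "square_integrable M (\<lambda>x. \<Sum>i\<in>I. f i x)"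
    and mean_square_sum_le:
      "mean_square M (\<lambda>x. \<Sum>i\<in>I. f i x) \<le> real (card I) * (\<Sum>i\<in>I. mean_square M (f i))"
proof -
  have sum_measurable: "(\<lambda>x. \<Sum>i\<in>I. f i x) \<in> borel_measurable M"
    using f_square_integrable by (intro borel_measurable_sum square_integrable_measurable)
  have bound_integrable: "integrable M (\<lambda>x. real (card I) * (\<Sum>i\<in>I. (norm (f i x))\<^sup>2))"
    using f_square_integrable
    by (intro integrable_mult_right Bochner_Integration.integrable_sum square_integrableD)
  show "square_integrable M (\<lambda>x. \<Sum>i\<in>I. f i x)"
    by (rule square_integrable_boundI[OF sum_measurable bound_integrable norm_sum_square_le])
  have "mean_square M (\<lambda>x. \<Sum>i\<in>I. f i x) \<le> (\<integral>x. real (card I) * (\<Sum>i\<in>I. (norm (f i x))\<^sup>2) \<partial>M)"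
    by (rule mean_square_le_integral[OF sum_measurable bound_integrable norm_sum_square_le])
  also have "\<dots> = real (card I) * (\<Sum>i\<in>I. mean_square M (f i))"
    using f_square_integrable
    by (simp add: mean_square_def Bochner_Integration.integral_sum square_integrableD)
  finally show "mean_square M (\<lambda>x. \<Sum>i\<in>I. f i x) \<le> real (card I) * (\<Sum>i\<in>I. mean_square M (f i))" .
qed

lemma mean_square_time_sum_le:
  fixes v :: "nat \<Rightarrow> 'a \<Rightarrow> 'b::{real_normed_vector,second_countable_topology}"
  assumes v_square_integrable: "\<And>i. i < n \<Longrightarrow> square_integrable M (v i)"
    and \<delta>_nonneg: "\<delta> \<ge> 0" and end_time_le: "real n * \<delta> \<le> T"
  shows "mean_square M (\<lambda>x. \<Sum>i<n. \<delta> *\<^sub>R v i x) \<le> T * (\<delta> * (\<Sum>i<n. mean_square M (v i)))"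
proof -
  have "mean_square M (\<lambda>x. \<Sum>i<n. \<delta> *\<^sub>R v i x) \<le> real n * (\<Sum>i<n. mean_square M (\<lambda>x. \<delta> *\<^sub>R v i x))"
    using mean_square_sum_le[of "{..<n}" M "\<lambda>i x. \<delta> *\<^sub>R v i x"] v_square_integrable
    by (simp add: square_integrable_scaleR)
  also have "\<dots> = (real n * \<delta>) * (\<delta> * (\<Sum>i<n. mean_square M (v i)))"
    by (simp add: mean_square_scaleR sum_distrib_left[symmetric] power2_eq_square mult_ac)
  also have "\<dots> \<le> T * (\<delta> * (\<Sum>i<n. mean_square M (v i)))"
    using \<delta>_nonneg end_time_le by (intro mult_right_mono mult_nonneg_nonneg sum_nonneg) auto
  finally show ?thesis .
qed

context prob_space
begin

lemma square_integrable_const_bound: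
  assumes "f \<in> borel_measurable M" "\<And>x. x \<in> space M \<Longrightarrow> norm (f x) \<le> B"
  shows "square_integrable M f"
proof (rule square_integrable_boundI[OF assms(1)])
  show "integrable M (\<lambda>_. B\<^sup>2)" by simp
  show "(norm (f x))\<^sup>2 \<le> B\<^sup>2" if "x \<in> space M" for x
    using assms(2)[OF that] by (intro power_mono) auto
qed

lemma square_integrable_imp_integrable_norm:
  fixes f :: "'a \<Rightarrow> 'b::{banach,second_countable_topology}"
  assumes f_square_integrable: "square_integrable M f"
  shows "integrable M f"
proof (rule integrable_norm_cancel)
  note [measurable] = square_integrable_measurable[OF f_square_integrable]
  show "integrable M (\<lambda>x. norm (f x))"
    by (rule square_integrable_imp_integrable[OF _ square_integrableD[OF f_square_integrable]]) measurable
  show "f \<in> borel_measurable M" by measurable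
qed

lemma prob_norm_ge_le_mean_square:
  fixes f :: "'a \<Rightarrow> 'b::{real_normed_vector,second_countable_topology}"
  assumes f_square_integrable: "square_integrable M f" and c_pos: "c > 0"
  shows "prob {x\<in>space M. c \<le> norm (f x)} \<le> mean_square M f / c\<^sup>2"
proof -
  have "{x\<in>space M. c \<le> norm (f x)} = {x\<in>space M. c\<^sup>2 \<le> (norm (f x))\<^sup>2}"
    using c_pos by (auto simp: power2_le_iff_abs_le)
  also have "prob \<dots> \<le> mean_square M f / c\<^sup>2"
    unfolding mean_square_def
    using square_integrableD[OF f_square_integrable] c_pos
    by (intro integral_Markov_inequality_measure[where A="{}"]) auto
  finally show ?thesis .
qed

lemma prob_subset_Un_le:
  assumes "A \<subseteq> B \<union> C" "B \<in> events" "C \<in> events"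
  shows "prob A \<le> prob B + prob C"
  using assms by (intro order_trans[OF finite_measure_mono measure_Un_le]) auto

lemma indep_varI:
  assumes X_measurable: "random_variable S X" and Y_measurable: "random_variable T Y"
    and prob_Int: "\<And>A B. A \<in> sets S \<Longrightarrow> B \<in> sets T \<Longrightarrow>
      prob ((X -` A \<inter> space M) \<inter> (Y -` B \<inter> space M)) = prob (X -` A \<inter> space M) * prob (Y -` B \<inter> space M)"
  shows "indep_var S X T Y"
  unfolding indep_var_distribution_eq
proof (intro conjI X_measurable Y_measurable pair_measure_eqI)
  interpret X: prob_space "distr M S X" by (rule prob_space_distr) (rule X_measurable)
  interpret Y: prob_space "distr M T Y" by (rule prob_space_distr) (rule Y_measurable)
  show "sigma_finite_measure (distr M S X)" "sigma_finite_measure (distr M T Y)"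
    by unfold_locales
  fix A B assume "A \<in> sets (distr M S X)" "B \<in> sets (distr M T Y)"
  then have AB_sets: "A \<in> sets S" "B \<in> sets T" by simp_all
  have "(\<lambda>x. (X x, Y x)) -` (A \<times> B) \<inter> space M = (X -` A \<inter> space M) \<inter> (Y -` B \<inter> space M)"
    by auto
  then show "emeasure (distr M S X) A * emeasure (distr M T Y) B =
      emeasure (distr M (S \<Otimes>\<^sub>M T) (\<lambda>x. (X x, Y x))) (A \<times> B)"
    using X_measurable Y_measurable AB_sets prob_Int[OF AB_sets]
    by (simp add: emeasure_distr emeasure_eq_measure ennreal_mult[symmetric])
qed auto

subsection \<open>Convergence to zero in probability\<close>

definition vanishes_in_prob :: "'h filter \<Rightarrow> ('h \<Rightarrow> 'a \<Rightarrow> real) \<Rightarrow> bool" where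
  "vanishes_in_prob G Z \<longleftrightarrow> (\<forall>\<^sub>F h in G. random_variable borel (Z h)) \<and>
     (\<forall>\<epsilon>>0. ((\<lambda>h. prob {\<omega>\<in>space M. \<epsilon> < Z h \<omega>}) \<longlongrightarrow> 0) G)"

lemma vanishes_in_probD: "vanishes_in_prob G Z \<Longrightarrow> \<epsilon> > 0 \<Longrightarrow> ((\<lambda>h. prob {\<omega>\<in>space M. \<epsilon> < Z h \<omega>}) \<longlongrightarrow> 0) G"
  by (simp add: vanishes_in_prob_def)

lemma vanishes_in_prob_measurable: "vanishes_in_prob G Z \<Longrightarrow> \<forall>\<^sub>F h in G. random_variable borel (Z h)"
  by (simp add: vanishes_in_prob_def)

lemma vanishes_in_prob_compose:
  assumes Z_vanishes: "vanishes_in_prob G Z" and f_filterlim: "filterlim f G H"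
  shows "vanishes_in_prob H (\<lambda>h. Z (f h))"
  unfolding vanishes_in_prob_def
  using eventually_compose_filterlim[OF vanishes_in_prob_measurable[OF Z_vanishes] f_filterlim]
    filterlim_compose[OF vanishes_in_probD[OF Z_vanishes] f_filterlim] by blast

lemma vanishes_in_prob_le_add:
  assumes U_vanishes: "vanishes_in_prob G U" and V_vanishes: "vanishes_in_prob G V"
    and Z_measurable: "\<forall>\<^sub>F h in G. random_variable borel (Z h)"
    and Z_le_add: "\<forall>\<^sub>F h in G. \<forall>\<omega>\<in>space M. Z h \<omega> \<le> U h \<omega> + V h \<omega>"
  shows "vanishes_in_prob G Z"
  unfolding vanishes_in_prob_def
proof (intro conjI allI impI Z_measurable)
  fix \<epsilon> :: real assume \<epsilon>_pos: "\<epsilon> > 0"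
  let ?p = "\<lambda>Z c h. prob {\<omega>\<in>space M. c < Z h \<omega>}"
  have sum_tendsto_0: "((\<lambda>h. ?p U (\<epsilon> / 2) h + ?p V (\<epsilon> / 2) h) \<longlongrightarrow> 0) G"
    using tendsto_add[OF vanishes_in_probD[OF U_vanishes, of "\<epsilon> / 2"]
      vanishes_in_probD[OF V_vanishes, of "\<epsilon> / 2"]] \<epsilon>_pos by simp
  show "(?p Z \<epsilon> \<longlongrightarrow> 0) G"
  proof (rule tendsto_sandwich[OF _ _ tendsto_const sum_tendsto_0])
    show "\<forall>\<^sub>F h in G. ?p Z \<epsilon> h \<le> ?p U (\<epsilon> / 2) h + ?p V (\<epsilon> / 2) h"
      using Z_le_add vanishes_in_prob_measurable[OF U_vanishes] vanishes_in_prob_measurable[OF V_vanishes]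
    proof eventually_elim
      case (elim h)
      note [measurable] = elim(2,3)
      have "\<epsilon> / 2 < U h \<omega> \<or> \<epsilon> / 2 < V h \<omega>" if "\<omega> \<in> space M" "\<epsilon> < Z h \<omega>" for \<omega>
        using elim(1) that by force
      then show ?case
        by (intro prob_subset_Un_le) auto
    qed
  qed auto
qed

lemma vanishes_in_prob_zero: "vanishes_in_prob G (\<lambda>_ _. 0)"
  by (simp add: vanishes_in_prob_def)

lemma vanishes_in_prob_sum:
  assumes "finite I" "\<And>i. i \<in> I \<Longrightarrow> vanishes_in_prob G (Z i)"
  shows "vanishes_in_prob G (\<lambda>h \<omega>. \<Sum>i\<in>I. Z i h \<omega>)"
  using assms
proof (induction I rule: finite_induct)
  case (insert i I)
  then have Z_vanishes: "vanishes_in_prob G (Z i)" and S_vanishes: "vanishes_in_prob G (\<lambda>h \<omega>. \<Sum>i\<in>I. Z i h \<omega>)"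
    by auto
  have "\<forall>\<^sub>F h in G. random_variable borel (\<lambda>\<omega>. \<Sum>i\<in>insert i I. Z i h \<omega>)"
    using vanishes_in_prob_measurable[OF Z_vanishes] vanishes_in_prob_measurable[OF S_vanishes]
    by eventually_elim (use insert.hyps in simp)
  then show ?case
    by (rule vanishes_in_prob_le_add[OF Z_vanishes S_vanishes]) (use insert.hyps in simp)
qed (simp add: vanishes_in_prob_zero)

lemma pointwise_imp_vanishes_in_prob:
  fixes Z :: "nat \<Rightarrow> 'a \<Rightarrow> real"
  assumes Z_measurable [measurable]: "\<And>n. random_variable borel (Z n)"
    and Z_tendsto_0: "\<And>\<omega>. \<omega> \<in> space M \<Longrightarrow> (\<lambda>n. Z n \<omega>) \<longlonglongrightarrow> 0"
  shows "vanishes_in_prob sequentially Z"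
  unfolding vanishes_in_prob_def
proof (intro conjI allI impI always_eventually Z_measurable)
  fix \<epsilon> :: real assume \<epsilon>_pos: "\<epsilon> > 0"
  let ?A = "\<lambda>n. {\<omega>\<in>space M. \<epsilon> < Z n \<omega>}"
  have "(\<lambda>n. expectation (indicator (?A n) :: 'a \<Rightarrow> real)) \<longlonglongrightarrow> expectation (\<lambda>_. 0 :: real)"
  proof (rule integral_dominated_convergence[where w="\<lambda>_. 1"])
    show "AE \<omega> in M. (\<lambda>n. indicator (?A n) \<omega> :: real) \<longlonglongrightarrow> 0"
    proof (rule AE_I2)
      fix \<omega> assume "\<omega> \<in> space M"
      from order_tendstoD(2)[OF Z_tendsto_0[OF this] \<epsilon>_pos]
      have "\<forall>\<^sub>F n in sequentially. indicator (?A n) \<omega> = (0::real)"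
        by eventually_elim auto
      then show "(\<lambda>n. indicator (?A n) \<omega> :: real) \<longlonglongrightarrow> 0" by (rule tendsto_eventually)
    qed
  qed auto
  then show "(\<lambda>n. prob (?A n)) \<longlonglongrightarrow> 0" by simp
qed

lemma pointwise_imp_vanishes_in_prob_at_right:
  fixes Z :: "real \<Rightarrow> 'a \<Rightarrow> real"
  assumes Z_measurable: "\<And>h. h > a \<Longrightarrow> random_variable borel (Z h)"
    and Z_tendsto_0: "\<And>\<omega>. \<omega> \<in> space M \<Longrightarrow> ((\<lambda>h. Z h \<omega>) \<longlongrightarrow> 0) (at_right a)"
  shows "vanishes_in_prob (at_right a) Z"
  unfolding vanishes_in_prob_def
proof (intro conjI allI impI)
  show "\<forall>\<^sub>F h in at_right a. random_variable borel (Z h)"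
    using eventually_at_right_less[of a] by eventually_elim (rule Z_measurable)
  fix \<epsilon> :: real assume \<epsilon>_pos: "\<epsilon> > 0"
  show "((\<lambda>h. prob {\<omega>\<in>space M. \<epsilon> < Z h \<omega>}) \<longlongrightarrow> 0) (at_right a)"
  proof (rule tendsto_at_right_sequentially[of a "a + 1"])
    fix S :: "nat \<Rightarrow> real" assume S_right: "\<And>n. a < S n" "S \<longlonglongrightarrow> a"
    then have "filterlim S (at_right a) sequentially"
      by (auto simp: filterlim_at intro: always_eventually)
    then have "vanishes_in_prob sequentially (\<lambda>n. Z (S n))"
      using S_right
      by (intro pointwise_imp_vanishes_in_prob Z_measurable filterlim_compose[OF Z_tendsto_0])
    then show "(\<lambda>n. prob {\<omega>\<in>space M. \<epsilon> < Z (S n) \<omega>}) \<longlonglongrightarrow> 0"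
      using \<epsilon>_pos by (rule vanishes_in_probD)
  qed simp
qed

lemma exists_prob_greater_less:
  assumes Z_measurable: "random_variable borel Z" and e_pos: "e > 0"
  obtains R :: real where "R \<ge> 0" "prob {\<omega>\<in>space M. R < Z \<omega>} < e"
proof -
  have "vanishes_in_prob sequentially (\<lambda>n \<omega>. Z \<omega> / real n)"
    by (rule pointwise_imp_vanishes_in_prob) (use Z_measurable in \<open>auto intro: lim_const_over_n\<close>)
  then have "(\<lambda>n. prob {\<omega>\<in>space M. 1 < Z \<omega> / real n}) \<longlonglongrightarrow> 0"
    by (rule vanishes_in_probD) simp
  then have "\<forall>\<^sub>F n in sequentially. prob {\<omega>\<in>space M. 1 < Z \<omega> / real n} < e \<and> n > 0"
    using e_pos by (intro eventually_conj order_tendstoD(2) eventually_gt_at_top)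
  then obtain n where "prob {\<omega>\<in>space M. 1 < Z \<omega> / real n} < e" "n > 0"
    by (auto simp: eventually_sequentially)
  then show ?thesis
    by (intro that[of "real n"]) (simp_all add: less_divide_eq)
qed

subsection \<open>A maximal inequality\<close>

context
  fixes V :: "nat \<Rightarrow> 'a \<Rightarrow> real" and \<Lambda> :: real
begin

definition below :: "nat \<Rightarrow> 'a set" where
  "below n = {\<omega>\<in>space M. \<forall>i\<le>n. V i \<omega> < \<Lambda>}"

text \<open>The process stopped on reaching \<open>\<Lambda>\<close>, without the overshoot: then a one-step estimate on the bounded
  part \<open>below n\<close> is all that the maximal inequality needs.\<close>

definition capped :: "nat \<Rightarrow> 'a \<Rightarrow> real" where
  "capped n \<omega> = indicator (below n) \<omega> * V n \<omega> + \<Lambda> * indicator (space M - below n) \<omega>"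

context
  assumes V_measurable [measurable]: "\<And>n. random_variable borel (V n)"
    and V_nonneg: "\<And>n \<omega>. V n \<omega> \<ge> 0" and \<Lambda>_pos: "\<Lambda> > 0"
begin

lemma below_event [measurable]: "below n \<in> events"
  unfolding below_def by measurable

lemma integrable_indicator_below: "integrable M (\<lambda>\<omega>. indicator (below n) \<omega> * V n \<omega>)"
  by (rule integrable_const_bound[of _ \<Lambda>])
    (use \<Lambda>_pos V_nonneg in \<open>auto intro!: AE_I2 less_imp_le simp: below_def indicator_def\<close>)

lemma integrable_indicator_not_below: "integrable M (\<lambda>\<omega>. \<Lambda> * indicator (space M - below n) \<omega>)"
  by (intro integrable_mult_right integrable_real_indicator) (auto simp: emeasure_eq_measure)

lemma integrable_capped: "integrable M (capped n)"
  unfolding capped_def[abs_def]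
  by (intro Bochner_Integration.integrable_add integrable_indicator_below integrable_indicator_not_below)

lemma expectation_capped_le:
  assumes c_nonneg: "c \<ge> 0" and integrable_V0: "integrable M (V 0)"
    and integrable_step: "\<And>n. integrable M (\<lambda>\<omega>. indicator (below n) \<omega> * V (Suc n) \<omega>)"
    and expectation_step: "\<And>n. expectation (\<lambda>\<omega>. indicator (below n) \<omega> * V (Suc n) \<omega>) \<le>
      (1 + c) * expectation (\<lambda>\<omega>. indicator (below n) \<omega> * V n \<omega>)"
  shows "expectation (capped n) \<le> (1 + c) ^ n * expectation (V 0)"
proof (induction n)
  case 0
  have "expectation (capped 0) \<le> expectation (V 0)"
    using V_nonneg
    by (intro integral_mono integrable_capped integrable_V0) (auto simp: capped_def below_def indicator_def)
  then show ?case by simp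
next
  case (Suc n)
  have "capped (Suc n) \<omega> \<le> indicator (below n) \<omega> * V (Suc n) \<omega> + \<Lambda> * indicator (space M - below n) \<omega>"
    if "\<omega> \<in> space M" for \<omega>
    using that V_nonneg[of "Suc n" \<omega>]
    by (auto simp: capped_def below_def indicator_def le_Suc_eq not_less)
  then have "expectation (capped (Suc n)) \<le>
      expectation (\<lambda>\<omega>. indicator (below n) \<omega> * V (Suc n) \<omega> + \<Lambda> * indicator (space M - below n) \<omega>)"
    by (intro integral_mono integrable_capped Bochner_Integration.integrable_add integrable_step
        integrable_indicator_not_below)
  also have "\<dots> \<le> (1 + c) * expectation (\<lambda>\<omega>. indicator (below n) \<omega> * V n \<omega>) +
      expectation (\<lambda>\<omega>. \<Lambda> * indicator (space M - below n) \<omega>)"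
    using expectation_step[of n] integrable_step[of n] integrable_indicator_not_below[of n] by simp
  also have "\<dots> \<le> (1 + c) * expectation (capped n)"
    using integrable_indicator_below[of n] integrable_indicator_not_below[of n] c_nonneg \<Lambda>_pos
    unfolding capped_def by (simp add: distrib_left distrib_right)
  also have "\<dots> \<le> (1 + c) * ((1 + c) ^ n * expectation (V 0))"
    using c_nonneg by (intro mult_left_mono Suc.IH) auto
  finally show ?case by (simp add: mult_ac)
qed

lemma maximal_inequality:
  assumes "c \<ge> 0" "integrable M (V 0)"
    and "\<And>n. integrable M (\<lambda>\<omega>. indicator (below n) \<omega> * V (Suc n) \<omega>)"
    and "\<And>n. expectation (\<lambda>\<omega>. indicator (below n) \<omega> * V (Suc n) \<omega>) \<le>
      (1 + c) * expectation (\<lambda>\<omega>. indicator (below n) \<omega> * V n \<omega>)"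
  shows "\<Lambda> * prob {\<omega>\<in>space M. \<exists>i\<le>n. \<Lambda> \<le> V i \<omega>} \<le> (1 + c) ^ n * expectation (V 0)"
proof -
  have "{\<omega>\<in>space M. \<exists>i\<le>n. \<Lambda> \<le> V i \<omega>} = space M - below n"
    by (auto simp: below_def not_less)
  then have "\<Lambda> * prob {\<omega>\<in>space M. \<exists>i\<le>n. \<Lambda> \<le> V i \<omega>} = expectation (\<lambda>\<omega>. \<Lambda> * indicator (space M - below n) \<omega>)"
    by simp
  also have "\<dots> \<le> expectation (capped n)"
    using V_nonneg
    by (intro integral_mono integrable_capped integrable_indicator_not_below) (auto simp: capped_def)
  also have "\<dots> \<le> (1 + c) ^ n * expectation (V 0)"
    using assms by (rule expectation_capped_le)
  finally show ?thesis .
qed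

end

end

end

subsection \<open>Moments from tails\<close>

lemma powr_le_dyadic_sum:
  fixes z \<epsilon> p :: real and P :: nat
  assumes z_nonneg: "0 \<le> z" and \<epsilon>_bounds: "0 < \<epsilon>" "\<epsilon> \<le> 1" and p_bounds: "0 \<le> p" "p \<le> real P"
  shows "ennreal (z powr p) \<le>
    ennreal (\<epsilon> powr p) + (\<Sum>n. ennreal (2 ^ (Suc n * P)) * indicator {2 ^ n * \<epsilon><..} z)"
proof (cases "z \<le> \<epsilon>")
  case True
  then have "ennreal (z powr p) \<le> ennreal (\<epsilon> powr p)"
    using z_nonneg p_bounds by (intro ennreal_leI powr_mono2) auto
  then show ?thesis by (simp add: add_increasing2)
next
  case False
  let ?f = "\<lambda>n. ennreal (2 ^ (Suc n * P)) * indicator {2 ^ n * \<epsilon><..} z"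
  obtain k :: nat where "z / \<epsilon> < 2 ^ k"
    using real_arch_pow[of 2 "z / \<epsilon>"] by auto
  then have "z \<le> 2 ^ k * \<epsilon>"
    using \<epsilon>_bounds by (simp add: field_simps)
  moreover have "\<not> z \<le> 2 ^ 0 * \<epsilon>"
    using False by simp
  ultimately obtain n where layer: "\<not> z \<le> 2 ^ n * \<epsilon>" "z \<le> 2 ^ Suc n * \<epsilon>"
    using ex_least_nat_less[of "\<lambda>n. z \<le> 2 ^ n * \<epsilon>" k] by auto
  have "z \<le> 2 ^ Suc n"
    using \<epsilon>_bounds by (intro order_trans[OF layer(2) mult_left_le]) auto
  then have "z powr p \<le> (2 ^ Suc n) powr p"
    using z_nonneg p_bounds by (intro powr_mono2) auto
  also have "\<dots> \<le> (2 ^ Suc n) powr (real P)"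
    using p_bounds by (intro powr_mono) (auto simp del: power_Suc)
  also have "\<dots> = 2 ^ (Suc n * P)"
    by (simp add: powr_realpow power_mult[symmetric] del: power_Suc)
  finally have "ennreal (z powr p) \<le> ?f n"
    using layer(1) by (simp add: ennreal_leI)
  also have "?f n \<le> (\<Sum>n. ?f n)"
  proof -
    have "f n \<le> suminf f" for f :: "nat \<Rightarrow> ennreal"
      using sum_le_suminf[of f "{n}"] by simp
    then show ?thesis .
  qed
  finally show ?thesis by (simp add: add_increasing)
qed

context prob_space
begin

text \<open>The probability of the dyadic layer above \<open>2 ^ n * \<epsilon>\<close> is at most
  \<open>sqrt (P(Z > \<epsilon>) * P(Z > 2 ^ n * \<epsilon>))\<close>: one factor carries the smallness, the other makes the
  series over \<open>n\<close> converge.\<close>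

lemma dyadic_layer_le:
  fixes Z :: "'a \<Rightarrow> real" and P :: nat and \<epsilon> D :: real
  assumes Z_measurable [measurable]: "random_variable borel Z" and \<epsilon>_pos: "0 < \<epsilon>"
    and tail: "\<And>c. c > 0 \<Longrightarrow> prob {\<omega>\<in>space M. c < Z \<omega>} \<le> D / c ^ (2 * Suc P)"
  shows "2 ^ (Suc n * P) * prob {\<omega>\<in>space M. 2 ^ n * \<epsilon> < Z \<omega>} \<le>
    2 ^ P * sqrt D / \<epsilon> ^ Suc P * sqrt (prob {\<omega>\<in>space M. \<epsilon> < Z \<omega>}) * (1 / 2) ^ n"
proof -
  define z where "z = 2 ^ n * \<epsilon>"
  define p where "p c = prob {\<omega>\<in>space M. c < Z \<omega>}" for c
  have z_pos: "z > 0" and "\<epsilon> \<le> z"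
    using \<epsilon>_pos by (simp_all add: z_def)
  then have "p z \<le> p \<epsilon>"
    unfolding p_def by (intro finite_measure_mono) auto
  then have "p z * p z \<le> p \<epsilon> * (D / z ^ (2 * Suc P))"
    using tail[OF z_pos] unfolding p_def by (intro mult_mono) auto
  then have "p z \<le> sqrt (p \<epsilon> * (D / z ^ (2 * Suc P)))"
    by (intro real_le_rsqrt) (simp add: power2_eq_square)
  also have "\<dots> = sqrt (p \<epsilon>) * (sqrt D / z ^ Suc P)"
  proof -
    have "sqrt (z ^ (2 * Suc P)) = z ^ Suc P"
      using z_pos by (subst mult.commute, subst power_mult) simp
    then show ?thesis by (simp only: real_sqrt_mult real_sqrt_divide)
  qed
  finally have "2 ^ (Suc n * P) * p z \<le> 2 ^ (Suc n * P) * (sqrt (p \<epsilon>) * (sqrt D / z ^ Suc P))"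
    by (intro mult_left_mono) auto
  also have "\<dots> = 2 ^ P * sqrt D / \<epsilon> ^ Suc P * sqrt (p \<epsilon>) * (1 / 2) ^ n"
    using \<epsilon>_pos
    by (simp add: z_def power_mult_distrib power_divide power_mult[symmetric] field_simps power_add[symmetric])
  finally show ?thesis
    by (simp add: z_def p_def)
qed

lemma powr_moment_le:
  fixes Z :: "'a \<Rightarrow> real" and P :: nat and p \<epsilon> D :: real
  assumes Z_measurable [measurable]: "random_variable borel Z" and Z_nonneg: "\<And>\<omega>. \<omega> \<in> space M \<Longrightarrow> Z \<omega> \<ge> 0"
    and \<epsilon>_bounds: "0 < \<epsilon>" "\<epsilon> \<le> 1" and p_bounds: "0 \<le> p" "p \<le> real P" and D_nonneg: "D \<ge> 0"
    and tail: "\<And>c. c > 0 \<Longrightarrow> prob {\<omega>\<in>space M. c < Z \<omega>} \<le> D / c ^ (2 * Suc P)"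
  shows "(\<integral>\<^sup>+ \<omega>. ennreal (Z \<omega> powr p) \<partial>M) \<le>
    ennreal (\<epsilon> powr p + 2 * (2 ^ P * sqrt D / \<epsilon> ^ Suc P * sqrt (prob {\<omega>\<in>space M. \<epsilon> < Z \<omega>})))"
proof -
  let ?w = "\<lambda>n. 2 ^ (Suc n * P) :: real"
  define c where "c = 2 ^ P * sqrt D / \<epsilon> ^ Suc P * sqrt (prob {\<omega>\<in>space M. \<epsilon> < Z \<omega>})"
  have c_nonneg: "c \<ge> 0"
    unfolding c_def using \<epsilon>_bounds D_nonneg by auto
  have layer: "(\<integral>\<^sup>+ \<omega>. ennreal (?w n) * indicator {2 ^ n * \<epsilon><..} (Z \<omega>) \<partial>M) \<le> ennreal (c * (1 / 2) ^ n)" for n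
  proof -
    have "(\<integral>\<^sup>+ \<omega>. ennreal (?w n) * indicator {2 ^ n * \<epsilon><..} (Z \<omega>) \<partial>M) =
        (\<integral>\<^sup>+ \<omega>. ennreal (?w n) * indicator {\<omega>\<in>space M. 2 ^ n * \<epsilon> < Z \<omega>} \<omega> \<partial>M)"
      by (intro nn_integral_cong) (auto simp: indicator_def)
    also have "\<dots> = ennreal (?w n * prob {\<omega>\<in>space M. 2 ^ n * \<epsilon> < Z \<omega>})"
      by (subst nn_integral_cmult_indicator) (auto simp: emeasure_eq_measure ennreal_mult)
    also have "\<dots> \<le> ennreal (c * (1 / 2) ^ n)"
      unfolding c_def by (intro ennreal_leI dyadic_layer_le Z_measurable \<epsilon>_bounds tail)
    finally show ?thesis .
  qed
  have "(\<integral>\<^sup>+ \<omega>. ennreal (Z \<omega> powr p) \<partial>M) \<le>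
      (\<integral>\<^sup>+ \<omega>. ennreal (\<epsilon> powr p) + (\<Sum>n. ennreal (?w n) * indicator {2 ^ n * \<epsilon><..} (Z \<omega>)) \<partial>M)"
    using Z_nonneg by (intro nn_integral_mono powr_le_dyadic_sum \<epsilon>_bounds p_bounds)
  also have "\<dots> = ennreal (\<epsilon> powr p) + (\<Sum>n. \<integral>\<^sup>+ \<omega>. ennreal (?w n) * indicator {2 ^ n * \<epsilon><..} (Z \<omega>) \<partial>M)"
    by (subst nn_integral_add) (auto simp: nn_integral_suminf emeasure_space_1 intro!: borel_measurable_suminf)
  also have "\<dots> \<le> ennreal (\<epsilon> powr p) + (\<Sum>n. ennreal (c * (1 / 2) ^ n))"
    by (intro add_left_mono suminf_le layer) auto
  also have "(\<Sum>n. ennreal (c * (1 / 2) ^ n)) = ennreal (\<Sum>n. c * (1 / 2) ^ n)"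
    using c_nonneg by (intro suminf_ennreal2 summable_mult summable_geometric) auto
  also have "(\<Sum>n. c * (1 / 2) ^ n) = 2 * c"
    using suminf_geometric[of "1 / 2 :: real"] by (subst suminf_mult) (auto intro: summable_geometric)
  also have "ennreal (\<epsilon> powr p) + ennreal (2 * c) = ennreal (\<epsilon> powr p + 2 * c)"
    using c_nonneg by (subst ennreal_plus) auto
  finally show ?thesis by (simp add: c_def)
qed

lemma powr_moment_tendsto_0:
  fixes Z :: "'h \<Rightarrow> 'a \<Rightarrow> real" and p D :: real and P :: nat
  assumes Z_vanishes: "vanishes_in_prob G Z" and p_bounds: "0 < p" "p \<le> real P" and D_nonneg: "D \<ge> 0"
    and nonneg: "\<forall>\<^sub>F h in G. \<forall>\<omega>\<in>space M. Z h \<omega> \<ge> 0"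
    and tail: "\<forall>\<^sub>F h in G. \<forall>c>0. prob {\<omega>\<in>space M. c < Z h \<omega>} \<le> D / c ^ (2 * Suc P)"
  shows "((\<lambda>h. \<integral>\<^sup>+ \<omega>. ennreal (Z h \<omega> powr p) \<partial>M) \<longlongrightarrow> 0) G"
proof (rule order_tendstoI)
  fix a :: ennreal assume "0 < a"
  then obtain r where r_bounds: "0 < r" "ennreal r \<le> a"
    by (cases a) (auto intro: that[of 1])
  define \<epsilon> where "\<epsilon> = min 1 ((r / 2) powr (1 / p))"
  have \<epsilon>_bounds: "0 < \<epsilon>" "\<epsilon> \<le> 1"
    using r_bounds by (auto simp: \<epsilon>_def)
  have "\<epsilon> powr p \<le> ((r / 2) powr (1 / p)) powr p"
    using \<epsilon>_bounds p_bounds by (intro powr_mono2) (auto simp: \<epsilon>_def)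
  also have "\<dots> = r / 2"
    using r_bounds p_bounds by (simp add: powr_powr)
  also have "\<dots> < r"
    using r_bounds by simp
  finally have \<epsilon>_powr_less: "\<epsilon> powr p < r" .
  define S where "S = 2 ^ P * sqrt D / \<epsilon> ^ Suc P"
  have "((\<lambda>h. \<epsilon> powr p + 2 * (S * sqrt (prob {\<omega>\<in>space M. \<epsilon> < Z h \<omega>}))) \<longlongrightarrow> \<epsilon> powr p + 2 * (S * sqrt 0)) G"
    by (intro tendsto_intros vanishes_in_probD[OF Z_vanishes \<epsilon>_bounds(1)])
  then have "\<forall>\<^sub>F h in G. \<epsilon> powr p + 2 * (S * sqrt (prob {\<omega>\<in>space M. \<epsilon> < Z h \<omega>})) < r"
    using \<epsilon>_powr_less by (intro order_tendstoD(2)) auto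
  then show "\<forall>\<^sub>F h in G. (\<integral>\<^sup>+ \<omega>. ennreal (Z h \<omega> powr p) \<partial>M) < a"
    using nonneg tail vanishes_in_prob_measurable[OF Z_vanishes]
  proof eventually_elim
    case (elim h)
    have "(\<integral>\<^sup>+ \<omega>. ennreal (Z h \<omega> powr p) \<partial>M) \<le>
        ennreal (\<epsilon> powr p + 2 * (S * sqrt (prob {\<omega>\<in>space M. \<epsilon> < Z h \<omega>})))"
      unfolding S_def using elim p_bounds by (intro powr_moment_le \<epsilon>_bounds D_nonneg) auto
    also have "\<dots> < ennreal r"
      using elim(1) r_bounds by (simp add: ennreal_lessI)
    finally show ?case using r_bounds(2) by (rule less_le_trans)
  qed
qed simp

end

subsection \<open>Continuous processes\<close>

lemma borel_measurable_SUP_continuous: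
  fixes g :: "'b::{second_countable_topology,metric_space} \<Rightarrow> 'a \<Rightarrow> real"
  assumes K_compact: "compact K" "K \<noteq> {}" and g_measurable: "\<And>s. s \<in> K \<Longrightarrow> g s \<in> borel_measurable N"
    and g_continuous: "\<And>\<omega>. \<omega> \<in> space N \<Longrightarrow> continuous_on K (\<lambda>s. g s \<omega>)"
  shows "(\<lambda>\<omega>. SUP s\<in>K. g s \<omega>) \<in> borel_measurable N"
proof -
  obtain D where D_dense: "countable D" "D \<subseteq> K" "K \<subseteq> closure D"
    by (rule separable)
  have closure_D: "closure D = K"
    using D_dense K_compact(1) by (simp add: closure_minimal compact_imp_closed subset_antisym)
  have "D \<noteq> {}"
    using D_dense K_compact(2) by auto
  have bdd_above_K: "bdd_above ((\<lambda>s. g s \<omega>) ` K)" if "\<omega> \<in> space N" for \<omega>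
    using compact_continuous_image[OF g_continuous[OF that] K_compact(1)]
    by (intro bounded_imp_bdd_above compact_imp_bounded)
  have SUP_eq: "(SUP s\<in>K. g s \<omega>) = (SUP s\<in>D. g s \<omega>)" if \<omega>_in_space: "\<omega> \<in> space N" for \<omega>
  proof (rule antisym)
    have "bdd_above ((\<lambda>s. g s \<omega>) ` D)"
      by (rule bdd_above_mono[OF bdd_above_K[OF \<omega>_in_space]]) (use D_dense in auto)
    then have le_SUP_D: "g s \<omega> \<le> (SUP s\<in>D. g s \<omega>)" if "s \<in> D" for s
      using that by (rule cSUP_upper[rotated])
    have "g s \<omega> \<le> (SUP s\<in>D. g s \<omega>)" if "s \<in> K" for s
      by (rule continuous_le_on_closure[of D "\<lambda>s. g s \<omega>", unfolded closure_D,
        OF g_continuous[OF \<omega>_in_space] that le_SUP_D])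
    then show "(SUP s\<in>K. g s \<omega>) \<le> (SUP s\<in>D. g s \<omega>)"
      by (rule cSUP_least[OF K_compact(2)])
    show "(SUP s\<in>D. g s \<omega>) \<le> (SUP s\<in>K. g s \<omega>)"
      using D_dense \<open>D \<noteq> {}\<close> bdd_above_K[OF \<omega>_in_space] by (intro cSUP_subset_mono) auto
  qed
  have "(\<lambda>\<omega>. SUP s\<in>D. g s \<omega>) \<in> borel_measurable N"
  proof (rule borel_measurable_cSUP[OF D_dense(1)])
    show "bdd_above ((\<lambda>s. g s \<omega>) ` D)" if "\<omega> \<in> space N" for \<omega>
      by (rule bdd_above_mono[OF bdd_above_K[OF that]]) (use D_dense in auto)
  qed (use D_dense g_measurable in auto)
  then show ?thesis
    by (subst measurable_cong[OF SUP_eq])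
qed

lemma continuous_on_le_SUP:
  fixes f :: "'b::topological_space \<Rightarrow> real"
  assumes "compact K" "continuous_on K f" "s \<in> K"
  shows "f s \<le> (SUP s\<in>K. f s)"
  using assms
  by (intro cSUP_upper bounded_imp_bdd_above compact_imp_bounded[OF compact_continuous_image])

locale continuous_process = prob_space +
  fixes X :: "real \<Rightarrow> 'a \<Rightarrow> 'b::{second_countable_topology,real_normed_vector}"
  assumes process_measurable: "t \<ge> 0 \<Longrightarrow> random_variable borel (X t)"
    and process_continuous: "\<omega> \<in> space M \<Longrightarrow> continuous_on {0..} (\<lambda>t. X t \<omega>)"
begin

definition running_max :: "real \<Rightarrow> 'a \<Rightarrow> real" where
  "running_max T \<omega> = (SUP s\<in>{0..T}. norm (X s \<omega>))"

definition oscillation :: "real \<Rightarrow> real \<Rightarrow> 'a \<Rightarrow> real" where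
  "oscillation T h \<omega> =
     (SUP (s, t)\<in>{(s, t). s \<in> {0..T} \<and> t \<in> {0..T} \<and> \<bar>s - t\<bar> \<le> h}. norm (X s \<omega> - X t \<omega>))"

lemma process_continuous_on: "\<omega> \<in> space M \<Longrightarrow> S \<subseteq> {0..} \<Longrightarrow> continuous_on S (\<lambda>t. X t \<omega>)"
  by (rule continuous_on_subset[OF process_continuous])

lemma norm_le_running_max:
  assumes "\<omega> \<in> space M" "s \<in> {0..T}"
  shows "norm (X s \<omega>) \<le> running_max T \<omega>"
  unfolding running_max_def
  using assms by (intro continuous_on_le_SUP continuous_intros process_continuous_on) auto

lemma running_max_le:
  assumes "T \<ge> 0" "\<And>s. s \<in> {0..T} \<Longrightarrow> norm (X s \<omega>) \<le> c"
  shows "running_max T \<omega> \<le> c"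
  unfolding running_max_def using assms by (intro cSUP_least) auto

lemma running_max_mono:
  assumes "\<omega> \<in> space M" "0 \<le> S" "S \<le> T"
  shows "running_max S \<omega> \<le> running_max T \<omega>"
  using assms by (intro running_max_le norm_le_running_max) auto

lemma borel_measurable_running_max:
  assumes "T \<ge> 0" "space N = space M" "\<And>s. s \<in> {0..T} \<Longrightarrow> X s \<in> borel_measurable N"
  shows "running_max T \<in> borel_measurable N"
  unfolding running_max_def
  using assms
  by (intro borel_measurable_SUP_continuous continuous_intros process_continuous_on borel_measurable_norm) auto

lemma random_variable_running_max: "T \<ge> 0 \<Longrightarrow> random_variable borel (running_max T)"
  by (intro borel_measurable_running_max process_measurable) auto

lemma oscillation_domain:
  fixes T h :: real
  defines "D \<equiv> {(s, t). s \<in> {0..T} \<and> t \<in> {0..T} \<and> \<bar>s - t\<bar> \<le> h}"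
  shows "compact D" "0 \<le> T \<Longrightarrow> 0 \<le> h \<Longrightarrow> (0, 0) \<in> D"
    and "\<omega> \<in> space M \<Longrightarrow> continuous_on D (\<lambda>(s, t). norm (X s \<omega> - X t \<omega>))"
proof -
  have "D = ({0..T} \<times> {0..T}) \<inter> {p. \<bar>fst p - snd p\<bar> \<le> h}"
    by (auto simp: D_def)
  then show "compact D"
    by (simp add: compact_Times closed_Collect_le continuous_intros compact_Int_closed)
  show "0 \<le> T \<Longrightarrow> 0 \<le> h \<Longrightarrow> (0, 0) \<in> D"
    by (simp add: D_def)
  show "continuous_on D (\<lambda>(s, t). norm (X s \<omega> - X t \<omega>))" if "\<omega> \<in> space M"
    unfolding case_prod_beta
    by (intro continuous_intros continuous_on_compose2[OF process_continuous[OF that]]) (auto simp: D_def)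
qed

lemma norm_diff_le_oscillation:
  assumes "\<omega> \<in> space M" "s \<in> {0..T}" "t \<in> {0..T}" "\<bar>s - t\<bar> \<le> h"
  shows "norm (X s \<omega> - X t \<omega>) \<le> oscillation T h \<omega>"
  using continuous_on_le_SUP[OF oscillation_domain(1,3), of \<omega> "(s, t)" T h] assms
  by (simp add: oscillation_def)

lemma oscillation_nonneg: "\<omega> \<in> space M \<Longrightarrow> 0 \<le> T \<Longrightarrow> 0 \<le> h \<Longrightarrow> 0 \<le> oscillation T h \<omega>"
  using norm_diff_le_oscillation[of \<omega> 0 T 0 h] by simp

lemma random_variable_oscillation:
  assumes "T \<ge> 0" "h \<ge> 0"
  shows "random_variable borel (oscillation T h)"
  unfolding oscillation_def
proof (rule borel_measurable_SUP_continuous[OF oscillation_domain(1)])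
  show "{(s, t). s \<in> {0..T} \<and> t \<in> {0..T} \<and> \<bar>s - t\<bar> \<le> h} \<noteq> {}"
    using oscillation_domain(2)[OF assms] by blast
  fix p :: "real \<times> real" assume "p \<in> {(s, t). s \<in> {0..T} \<and> t \<in> {0..T} \<and> \<bar>s - t\<bar> \<le> h}"
  then have [measurable]: "random_variable borel (X (fst p))" "random_variable borel (X (snd p))"
    by (auto intro!: process_measurable)
  show "random_variable borel (\<lambda>\<omega>. case p of (s, t) \<Rightarrow> norm (X s \<omega> - X t \<omega>))"
    unfolding case_prod_beta by measurable
next
  fix \<omega> assume "\<omega> \<in> space M"
  from oscillation_domain(3)[OF this]
  show "continuous_on {(s, t). s \<in> {0..T} \<and> t \<in> {0..T} \<and> \<bar>s - t\<bar> \<le> h}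
    (\<lambda>p. case p of (s, t) \<Rightarrow> norm (X s \<omega> - X t \<omega>))" .
qed

lemma oscillation_tendsto_0:
  assumes \<omega>_in_space: "\<omega> \<in> space M" and T_nonneg: "T \<ge> 0"
  shows "((\<lambda>h. oscillation T h \<omega>) \<longlongrightarrow> 0) (at_right 0)"
proof (rule tendstoI)
  fix e :: real assume e_pos: "e > 0"
  have "uniformly_continuous_on {0..T} (\<lambda>t. X t \<omega>)"
    by (intro compact_uniformly_continuous process_continuous_on[OF \<omega>_in_space]) auto
  then obtain d where d_pos: "d > 0"
    and uniform: "\<And>s t. \<lbrakk>s \<in> {0..T}; t \<in> {0..T}; dist t s < d\<rbrakk> \<Longrightarrow> dist (X t \<omega>) (X s \<omega>) < e / 2"
    using e_pos unfolding uniformly_continuous_on_def by (metis half_gt_zero)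
  have "\<forall>\<^sub>F h in at_right 0. h < d" "\<forall>\<^sub>F h::real in at_right 0. 0 < h"
    using d_pos by (auto simp: eventually_at_right_less eventually_at_right_field)
  then show "\<forall>\<^sub>F h in at_right 0. dist (oscillation T h \<omega>) 0 < e"
  proof eventually_elim
    case (elim h)
    have "oscillation T h \<omega> \<le> e / 2"
      unfolding oscillation_def
    proof (rule cSUP_least)
      fix p :: "real \<times> real" assume "p \<in> {(s, t). s \<in> {0..T} \<and> t \<in> {0..T} \<and> \<bar>s - t\<bar> \<le> h}"
      then show "(case p of (s, t) \<Rightarrow> norm (X s \<omega> - X t \<omega>)) \<le> e / 2"
        using uniform[of "snd p" "fst p"] elim by (auto simp: dist_norm dist_real_def)
    qed (use T_nonneg elim oscillation_domain(2) in fastforce)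
    then show ?case
      using oscillation_nonneg[OF \<omega>_in_space T_nonneg, of h] e_pos elim by simp
  qed
qed

lemma oscillation_vanishes_in_prob: "T \<ge> 0 \<Longrightarrow> vanishes_in_prob (at_right 0) (oscillation T)"
  by (intro pointwise_imp_vanishes_in_prob_at_right random_variable_oscillation oscillation_tendsto_0) auto

lemma truncated_oscillation_tendsto_0:
  assumes T_nonneg: "T \<ge> 0" and B_nonneg: "B \<ge> 0"
  shows "((\<lambda>h. mean_square M (\<lambda>\<omega>. min (oscillation T h \<omega>) B)) \<longlongrightarrow> 0) (at_right 0)"
proof (rule tendsto_at_right_sequentially[of 0 1])
  fix S :: "nat \<Rightarrow> real" assume S_right: "\<And>n. 0 < S n" "S \<longlonglongrightarrow> 0"
  then have S_at_right: "filterlim S (at_right 0) sequentially"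
    by (auto simp: filterlim_at intro!: always_eventually less_imp_neq[symmetric])
  note [measurable] = random_variable_oscillation[OF T_nonneg less_imp_le[OF S_right(1)]]
  have "(\<lambda>n. mean_square M (\<lambda>\<omega>. min (oscillation T (S n) \<omega>) B)) \<longlonglongrightarrow> (\<integral>\<omega>. 0 \<partial>M)"
    unfolding mean_square_def
  proof (rule integral_dominated_convergence[where w="\<lambda>_. B\<^sup>2"])
    show "AE \<omega> in M. (\<lambda>n. (norm (min (oscillation T (S n) \<omega>) B))\<^sup>2) \<longlonglongrightarrow> 0"
    proof (rule AE_I2)
      fix \<omega> assume "\<omega> \<in> space M"
      from filterlim_compose[OF oscillation_tendsto_0[OF this T_nonneg] S_at_right]
      have "(\<lambda>n. (norm (min (oscillation T (S n) \<omega>) B))\<^sup>2) \<longlonglongrightarrow> (norm (min 0 B))\<^sup>2"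
        by (intro tendsto_intros)
      then show "(\<lambda>n. (norm (min (oscillation T (S n) \<omega>) B))\<^sup>2) \<longlonglongrightarrow> 0" using B_nonneg by simp
    qed
    show "AE \<omega> in M. norm ((norm (min (oscillation T (S n) \<omega>) B))\<^sup>2) \<le> B\<^sup>2" for n
      using oscillation_nonneg[OF _ T_nonneg less_imp_le[OF S_right(1)]] B_nonneg
      by (intro AE_I2) (auto simp: abs_le_square_iff[symmetric] min_def)
  qed auto
  then show "(\<lambda>n. mean_square M (\<lambda>\<omega>. min (oscillation T (S n) \<omega>) B)) \<longlonglongrightarrow> 0" by simp
qed simp

end

section \<open>Brownian increments\<close>

lemma sum_Basis_vec_nth:
  fixes y :: "real^'n \<Rightarrow> real"
  shows "(\<Sum>b\<in>Basis. y b *\<^sub>R b) $ i = y (axis i 1)"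
proof -
  have "(\<Sum>b\<in>Basis. y b *\<^sub>R b) $ i = (\<Sum>b\<in>Basis. y b *\<^sub>R b) \<bullet> axis i 1"
    by (simp add: inner_axis)
  also have "\<dots> = y (axis i 1)"
    by (rule inner_sum_left_Basis) (auto simp: Basis_vec_def)
  finally show ?thesis .
qed

lemma
  fixes f :: "'n::finite \<Rightarrow> real \<Rightarrow> real"
  assumes f_integrable: "\<And>i. integrable lborel (f i)"
  shows integrable_lborel_vec_prod: "integrable lborel (\<lambda>x::real^'n. \<Prod>i\<in>UNIV. f i (x $ i))"
    and integral_lborel_vec_prod:
      "(\<integral>x. (\<Prod>i\<in>UNIV. f i (x $ i)) \<partial>(lborel :: (real^'n) measure)) = (\<Prod>i\<in>UNIV. integral\<^sup>L lborel (f i))"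
proof -
  interpret product_sigma_finite "\<lambda>_::real^'n. lborel :: real measure"
    by unfold_locales
  define g :: "real^'n \<Rightarrow> real \<Rightarrow> real" where "g b = f (THE i. b = axis i 1)" for b
  have g_axis: "g (axis i 1) = f i" for i
    unfolding g_def by (rule arg_cong[where f=f]) (auto simp: axis_eq_axis)
  have Basis_eq: "(Basis :: (real^'n) set) = (\<lambda>i. axis i 1) ` UNIV"
    by (auto simp: Basis_vec_def)
  have inj_axis: "inj (\<lambda>i::'n. axis i (1::real))"
    by (auto simp: inj_on_def axis_eq_axis)
  have f_measurable [measurable]: "f i \<in> borel_measurable borel" for i
    using borel_measurable_integrable[OF f_integrable[of i]] by simp
  have g_integrable: "integrable lborel (g b)" if "b \<in> Basis" for b
    using that f_integrable by (auto simp: Basis_eq g_axis)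
  have prod_eq: "(\<Prod>i\<in>UNIV. f i ((\<Sum>b\<in>Basis. y b *\<^sub>R b) $ i)) = (\<Prod>b\<in>Basis. g b (y b))" for y :: "real^'n \<Rightarrow> real"
    unfolding sum_Basis_vec_nth by (simp add: Basis_eq prod.reindex[OF inj_axis] g_axis)
  have prod_measurable: "(\<lambda>x::real^'n. \<Prod>i\<in>UNIV. f i (x $ i)) \<in> borel_measurable borel"
    by measurable
  have coords_measurable:
      "(\<lambda>y. \<Sum>b\<in>Basis. y b *\<^sub>R b) \<in> (\<Pi>\<^sub>M b\<in>(Basis::(real^'n) set). lborel) \<rightarrow>\<^sub>M (borel :: (real^'n) measure)"
    by measurable
  show "integrable lborel (\<lambda>x::real^'n. \<Prod>i\<in>UNIV. f i (x $ i))"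
    by (subst lborel_eq, subst integrable_distr_eq[OF coords_measurable prod_measurable], subst prod_eq)
      (rule product_integrable_prod[OF finite_Basis g_integrable])
  show "(\<integral>x. (\<Prod>i\<in>UNIV. f i (x $ i)) \<partial>(lborel :: (real^'n) measure)) = (\<Prod>i\<in>UNIV. integral\<^sup>L lborel (f i))"
    by (subst lborel_eq, subst integral_distr[OF coords_measurable prod_measurable], subst prod_eq,
        subst product_integral_prod[OF finite_Basis g_integrable])
      (simp_all add: Basis_eq prod.reindex[OF inj_axis] g_axis)
qed

lemma prod_fun_upd_nth:
  fixes f :: "'n::finite \<Rightarrow> real \<Rightarrow> real" and x :: "real^'n"
  shows "(\<Prod>k\<in>UNIV. (f(i := \<lambda>y. f i y * g y)) k (x $ k)) = (\<Prod>k\<in>UNIV. f k (x $ k)) * g (x $ i)"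
proof -
  have "(\<Prod>k\<in>UNIV. (f(i := \<lambda>y. f i y * g y)) k (x $ k)) =
      f i (x $ i) * g (x $ i) * (\<Prod>k\<in>UNIV - {i}. (f(i := \<lambda>y. f i y * g y)) k (x $ k))"
    by (subst prod.remove[of UNIV i]) simp_all
  also have "(\<Prod>k\<in>UNIV - {i}. (f(i := \<lambda>y. f i y * g y)) k (x $ k)) = (\<Prod>k\<in>UNIV - {i}. f k (x $ k))"
    by (rule prod.cong) auto
  finally show ?thesis
    by (subst (2) prod.remove[of UNIV i]) (simp_all add: mult_ac)
qed

lemma one_plus_norm_power_le:
  fixes x :: "real^'n"
  assumes c_nonneg: "c \<ge> 0"
  shows "(1 + c * norm x) ^ (2 * j) \<le>
    real (Suc CARD('n)) ^ (2 * j) * (1 + (\<Sum>i\<in>UNIV. (c * x $ i) ^ (2 * j)))"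
proof -
  define f :: "'n option \<Rightarrow> real" where "f = case_option 1 (\<lambda>i. c * \<bar>x $ i\<bar>)"
  have sum_f: "(\<Sum>a\<in>UNIV. g (f a)) = g 1 + (\<Sum>i\<in>UNIV. g (c * \<bar>x $ i\<bar>))" for g :: "real \<Rightarrow> real"
    by (simp add: UNIV_option_conv f_def sum.reindex)
  have "1 + c * norm x \<le> (\<Sum>a\<in>UNIV. f a)"
    using norm_le_l1_cart[of x] c_nonneg
    by (simp add: sum_f[of "\<lambda>y. y"] sum_distrib_left[symmetric] mult_left_mono)
  then have "(1 + c * norm x) ^ (2 * j) \<le> (\<Sum>a\<in>UNIV. f a) ^ (2 * j)"
    using c_nonneg by (intro power_mono) auto
  also have "\<dots> \<le> real (CARD('n option)) ^ (2 * j) * (\<Sum>a\<in>UNIV. f a ^ (2 * j))"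
    using c_nonneg by (intro sum_power_le) (auto simp: f_def split: option.split)
  also have "(\<Sum>a\<in>UNIV. f a ^ (2 * j)) = 1 + (\<Sum>i\<in>UNIV. (c * x $ i) ^ (2 * j))"
    using sum_f[of "\<lambda>y. y ^ (2 * j)"] by (simp add: power_mult_distrib power_mult)
  finally show ?thesis by simp
qed

locale filtered_prob_space = prob_space +
  fixes F :: "real \<Rightarrow> 'a measure"
  assumes filtration: "filtration_on M F"
begin

lemma subalgebra_F: "t \<ge> 0 \<Longrightarrow> subalgebra M (F t)"
  and sets_F_mono: "0 \<le> s \<Longrightarrow> s \<le> t \<Longrightarrow> sets (F s) \<subseteq> sets (F t)"
  using filtration unfolding filtration_on_def by blast+

lemma space_F [simp]: "t \<ge> 0 \<Longrightarrow> space (F t) = space M"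
  using subalgebra_F by (auto simp: subalgebra_def)

lemma sets_F_imp_events: "t \<ge> 0 \<Longrightarrow> A \<in> sets (F t) \<Longrightarrow> A \<in> events"
  using subalgebra_F by (auto simp: subalgebra_def)

lemma measurable_F_mono: "0 \<le> s \<Longrightarrow> s \<le> t \<Longrightarrow> f \<in> measurable (F s) N \<Longrightarrow> f \<in> measurable (F t) N"
  using sets_F_mono[of s t] by (auto simp: measurable_def)

lemma measurable_F_imp_measurable: "t \<ge> 0 \<Longrightarrow> f \<in> measurable (F t) N \<Longrightarrow> f \<in> measurable M N"
  using measurable_from_subalg subalgebra_F by blast

end

locale wiener = filtered_prob_space M F for M :: "'a measure" and F +
  fixes W :: "real \<Rightarrow> 'a \<Rightarrow> real ^ 'd"
  assumes brownian: "brownian_motion M F W"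
begin

definition increment :: "real \<Rightarrow> real \<Rightarrow> 'a \<Rightarrow> real ^ 'd" where
  "increment s h \<omega> = W (s + h) \<omega> - W s \<omega>"

abbreviation grid_increment :: "real \<Rightarrow> nat \<Rightarrow> 'a \<Rightarrow> real ^ 'd" where
  "grid_increment h n \<equiv> increment (real n * h) h"

lemma W_F: "t \<ge> 0 \<Longrightarrow> W t \<in> borel_measurable (F t)"
  using brownian unfolding brownian_motion_def by blast

lemma increment_F: "0 \<le> s \<Longrightarrow> 0 \<le> h \<Longrightarrow> increment s h \<in> borel_measurable (F (s + h))"
  unfolding increment_def[abs_def]
  by (rule borel_measurable_diff[OF W_F measurable_F_mono[OF _ _ W_F]]) auto

lemma random_variable_increment: "0 \<le> s \<Longrightarrow> 0 \<le> h \<Longrightarrow> random_variable borel (increment s h)"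
  by (rule measurable_F_imp_measurable[OF _ increment_F]) auto

lemma increment_distributed:
  assumes "0 \<le> s" "0 < h"
  shows "distributed M lborel (increment s h) (\<lambda>x. ennreal (\<Prod>i\<in>UNIV. normal_density 0 (sqrt h) (x $ i)))"
proof -
  have "distributed M lborel (\<lambda>\<omega>. W (s + h) \<omega> - W s \<omega>)
      (\<lambda>x. ennreal (\<Prod>i\<in>UNIV. normal_density 0 (sqrt (s + h - s)) (x $ i)))"
    using brownian assms unfolding brownian_motion_def by (simp only: less_add_same_cancel1)
  then show ?thesis by (simp add: increment_def[abs_def])
qed

lemma prob_Int_increment:
  assumes "0 \<le> s" "0 < h" "A \<in> sets (F s)" "B \<in> sets borel"
  shows "prob (A \<inter> (increment s h -` B \<inter> space M)) = prob A * prob (increment s h -` B \<inter> space M)"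
  using brownian assms unfolding brownian_motion_def increment_def[abs_def]
  by (simp only: less_add_same_cancel1)

lemma expectation_increment_component:
  fixes g :: "real \<Rightarrow> real"
  assumes "0 \<le> s" and h_pos: "0 < h" and g_measurable [measurable]: "g \<in> borel_measurable borel"
    and density_g_integrable: "integrable lborel (\<lambda>y. normal_density 0 (sqrt h) y * g y)"
  shows "integrable M (\<lambda>\<omega>. g (increment s h \<omega> $ i))"
    and "expectation (\<lambda>\<omega>. g (increment s h \<omega> $ i)) = (\<integral>y. normal_density 0 (sqrt h) y * g y \<partial>lborel)"
proof -
  note distr = increment_distributed[OF assms(1,2)]
  let ?n = "normal_density 0 (sqrt h)"
  define f where "f = (\<lambda>_::'d. ?n)(i := \<lambda>y. ?n y * g y)"
  have prod_f: "(\<Prod>k\<in>UNIV. ?n (x $ k)) * g (x $ i) = (\<Prod>k\<in>UNIV. f k (x $ k))" for x :: "real^'d"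
    using prod_fun_upd_nth[of "\<lambda>_. ?n" i g x] by (simp add: f_def)
  have f_integrable: "integrable lborel (f k)" for k
    using density_g_integrable h_pos by (auto simp: f_def)
  have nonneg: "0 \<le> (\<Prod>k\<in>UNIV. ?n (x $ k))" for x :: "real^'d"
    by (intro prod_nonneg) auto
  show "integrable M (\<lambda>\<omega>. g (increment s h \<omega> $ i))"
    using distributed_integrable[OF distr, of "\<lambda>x. g (x $ i)"] nonneg
      integrable_lborel_vec_prod[of f, OF f_integrable]
    by (simp add: prod_f)
  have "expectation (\<lambda>\<omega>. g (increment s h \<omega> $ i)) =
      (\<integral>x. (\<Prod>k\<in>UNIV. ?n (x $ k)) * g (x $ i) \<partial>lborel)"
    using distributed_integral[OF distr, of "\<lambda>x. g (x $ i)"] nonneg by simp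
  also have "\<dots> = (\<Prod>k\<in>UNIV. integral\<^sup>L lborel (f k))"
    unfolding prod_f by (rule integral_lborel_vec_prod[OF f_integrable])
  also have "\<dots> = integral\<^sup>L lborel (f i) * (\<Prod>k\<in>UNIV - {i}. integral\<^sup>L lborel (f k))"
    by (rule prod.remove) auto
  also have "(\<Prod>k\<in>UNIV - {i}. integral\<^sup>L lborel (f k)) = 1"
    using h_pos by (intro prod.neutral) (simp add: f_def)
  finally show "expectation (\<lambda>\<omega>. g (increment s h \<omega> $ i)) = (\<integral>y. ?n y * g y \<partial>lborel)"
    by (simp add: f_def)
qed

lemma
  assumes "0 \<le> s" "0 < h"
  shows square_integrable_increment: "square_integrable M (increment s h)"
    and mean_square_increment_eq: "mean_square M (increment s h) = real CARD('d) * h"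
proof -
  have second_moment_integrable: "integrable lborel (\<lambda>y. normal_density 0 (sqrt h) y * y\<^sup>2)"
    using integrable_normal_moment[of "sqrt h" 0 2] assms by simp
  have second_moment: "(\<integral>y. normal_density 0 (sqrt h) y * y\<^sup>2 \<partial>lborel) = h"
    using integral_normal_moment_even[of "sqrt h" 0 1] assms by simp
  note component = expectation_increment_component[OF assms _ second_moment_integrable,
    unfolded second_moment, simplified]
  have norm_eq: "(norm x)\<^sup>2 = (\<Sum>i\<in>UNIV. (x $ i)\<^sup>2)" for x :: "real^'d"
    unfolding power2_norm_eq_inner inner_vec_def by (simp add: power2_eq_square)
  show "square_integrable M (increment s h)"
    unfolding square_integrable_def norm_eq
    using component(1) assms by (auto intro: random_variable_increment)
  show "mean_square M (increment s h) = real CARD('d) * h"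
    unfolding mean_square_def norm_eq using component by simp
qed

definition moment_bound :: "nat \<Rightarrow> real" where
  "moment_bound j = real (Suc CARD('d)) ^ (2 * j) * (1 + real CARD('d) * (fact (2 * j) / (2 ^ j * fact j)))"

lemma moment_bound_nonneg: "moment_bound j \<ge> 0"
  by (simp add: moment_bound_def)

lemma
  assumes s_nonneg: "0 \<le> s" and h_pos: "0 < h"
  shows integrable_increment_moment: "integrable M (\<lambda>\<omega>. (1 + norm (increment s h \<omega>) / sqrt h) ^ (2 * j))"
    and expectation_increment_moment_le:
      "expectation (\<lambda>\<omega>. (1 + norm (increment s h \<omega>) / sqrt h) ^ (2 * j)) \<le> moment_bound j"
proof -
  let ?q = "\<lambda>x::real^'d. (1 + norm x / sqrt h) ^ (2 * j)"
  let ?g = "\<lambda>x::real^'d. real (Suc CARD('d)) ^ (2 * j) * (1 + (\<Sum>i\<in>UNIV. (x $ i / sqrt h) ^ (2 * j)))"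
  have moment: "(\<lambda>y. normal_density 0 (sqrt h) y * (y / sqrt h) ^ (2 * j)) =
      (\<lambda>y. (1 / h ^ j) * (normal_density 0 (sqrt h) y * (y - 0) ^ (2 * j)))"
    using h_pos by (auto simp: power_divide power_mult)
  have even_moment_integrable: "integrable lborel (\<lambda>y. normal_density 0 (sqrt h) y * (y / sqrt h) ^ (2 * j))"
    unfolding moment using h_pos by (intro integrable_mult_right integrable_normal_moment) simp
  have even_moment: "(\<integral>y. normal_density 0 (sqrt h) y * (y / sqrt h) ^ (2 * j) \<partial>lborel) =
    fact (2 * j) / (2 ^ j * fact j)"
    unfolding moment using h_pos integral_normal_moment_even[of "sqrt h" 0 j] by (simp add: power_divide)
  have g_measurable: "(\<lambda>y. (y / sqrt h) ^ (2 * j)) \<in> borel_measurable borel"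
    by measurable
  note component = expectation_increment_component[OF s_nonneg h_pos g_measurable even_moment_integrable,
    unfolded even_moment]
  have g_integrable: "integrable M (\<lambda>\<omega>. ?g (increment s h \<omega>))"
    using component(1) by simp
  have q_le_g: "?q x \<le> ?g x" for x
    using one_plus_norm_power_le[of "1 / sqrt h" x j] h_pos by simp
  have [measurable]: "random_variable borel (increment s h)"
    using s_nonneg h_pos by (intro random_variable_increment) auto
  show q_integrable: "integrable M (\<lambda>\<omega>. ?q (increment s h \<omega>))"
  proof (rule Bochner_Integration.integrable_bound[OF g_integrable])
    show "AE \<omega> in M. norm (?q (increment s h \<omega>)) \<le> norm (?g (increment s h \<omega>))"
      using q_le_g h_pos by (intro AE_I2) (simp add: order_trans[OF _ abs_ge_self] power_mult)
  qed measurable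
  have "expectation (\<lambda>\<omega>. ?q (increment s h \<omega>)) \<le> expectation (\<lambda>\<omega>. ?g (increment s h \<omega>))"
    using q_le_g by (intro integral_mono q_integrable g_integrable)
  also have "\<dots> = moment_bound j"
    using component by (simp add: moment_bound_def prob_space)
  finally show "expectation (\<lambda>\<omega>. ?q (increment s h \<omega>)) \<le> moment_bound j" .
qed

lemma expectation_increment_mult:
  fixes U :: "'a \<Rightarrow> real" and f :: "real^'d \<Rightarrow> real"
  assumes time_step: "0 \<le> s" "0 < h" and U_adapted: "U \<in> borel_measurable (F s)" "integrable M U"
    and f_measurable [measurable]: "f \<in> borel_measurable borel"
    and f_integrable: "integrable M (\<lambda>\<omega>. f (increment s h \<omega>))"
  shows "integrable M (\<lambda>\<omega>. U \<omega> * f (increment s h \<omega>))"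
    and "expectation (\<lambda>\<omega>. U \<omega> * f (increment s h \<omega>)) = expectation U * expectation (\<lambda>\<omega>. f (increment s h \<omega>))"
proof -
  have "indep_var borel U borel (\<lambda>\<omega>. f (increment s h \<omega>))"
  proof (rule indep_varI)
    show "random_variable borel U" "random_variable borel (\<lambda>\<omega>. f (increment s h \<omega>))"
      using U_adapted(2) f_integrable by auto
    fix A B :: "real set" assume A_borel: "A \<in> sets borel" and B_borel: "B \<in> sets borel"
    have "U -` A \<inter> space M \<in> sets (F s)"
      using measurable_sets[OF U_adapted(1) A_borel] time_step by simp
    moreover have "f -` B \<in> sets borel"
      using measurable_sets[OF f_measurable B_borel] by simp
    moreover have "(\<lambda>\<omega>. f (increment s h \<omega>)) -` B = increment s h -` (f -` B)"
      by auto
    ultimately show "prob ((U -` A \<inter> space M) \<inter> ((\<lambda>\<omega>. f (increment s h \<omega>)) -` B \<inter> space M)) =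
        prob (U -` A \<inter> space M) * prob ((\<lambda>\<omega>. f (increment s h \<omega>)) -` B \<inter> space M)"
      using prob_Int_increment[OF time_step] by simp
  qed
  then show "integrable M (\<lambda>\<omega>. U \<omega> * f (increment s h \<omega>))"
    "expectation (\<lambda>\<omega>. U \<omega> * f (increment s h \<omega>)) = expectation U * expectation (\<lambda>\<omega>. f (increment s h \<omega>))"
    using U_adapted(2) f_integrable by (rule indep_var_integrable, rule indep_var_lebesgue_integral)
qed

lemma expectation_increment_inner:
  fixes U :: "'a \<Rightarrow> real^'d"
  assumes time_step: "0 \<le> s" "0 < h" and U_adapted: "U \<in> borel_measurable (F s)" "integrable M U"
  shows "integrable M (\<lambda>\<omega>. U \<omega> \<bullet> increment s h \<omega>)"
    and "expectation (\<lambda>\<omega>. U \<omega> \<bullet> increment s h \<omega>) = 0"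
proof -
  have first_moment_integrable: "integrable lborel (\<lambda>y. normal_density 0 (sqrt h) y * y)"
    and first_moment: "(\<integral>y. normal_density 0 (sqrt h) y * y \<partial>lborel) = 0"
    using integrable_normal_moment_nz_1[of "sqrt h" 0]
      integral_normal_moment_nz_1[of "sqrt h" 0] time_step by simp_all
  note component = expectation_increment_component[OF time_step _ first_moment_integrable,
    unfolded first_moment, simplified]
  have U_integrable: "integrable M (\<lambda>\<omega>. U \<omega> $ i)" for i
    using integrable_inner_left[OF U_adapted(2), of "axis i 1"] by (simp add: inner_axis)
  have U_F: "(\<lambda>\<omega>. U \<omega> $ i) \<in> borel_measurable (F s)" for i
    by (rule borel_measurable_continuous_on[OF _ U_adapted(1)]) (intro continuous_intros)
  note prod = expectation_increment_mult[where f="\<lambda>x. x $ i" for i,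
    OF time_step U_F U_integrable _ component(1), unfolded component(2), simplified]
  show "integrable M (\<lambda>\<omega>. U \<omega> \<bullet> increment s h \<omega>)"
    unfolding inner_vec_def inner_real_def by (intro Bochner_Integration.integrable_sum prod(1))
  show "expectation (\<lambda>\<omega>. U \<omega> \<bullet> increment s h \<omega>) = 0"
    unfolding inner_vec_def inner_real_def using prod by (simp add: Bochner_Integration.integral_sum)
qed

subsection \<open>Discrete stochastic integrals\<close>

lemma
  fixes A :: "'a \<Rightarrow> real^'d^'m"
  assumes time_step: "0 \<le> s" "0 < h" and A_adapted: "A \<in> borel_measurable (F s)" "square_integrable M A"
  shows square_integrable_matrix_increment: "square_integrable M (\<lambda>\<omega>. A \<omega> *v increment s h \<omega>)"
    and mean_square_matrix_increment_le:
      "mean_square M (\<lambda>\<omega>. A \<omega> *v increment s h \<omega>) \<le> real CARD('d) * h * mean_square M A"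
proof -
  have [measurable]: "random_variable borel A" "random_variable borel (increment s h)"
    using A_adapted time_step by (auto intro: random_variable_increment simp: square_integrable_def)
  have A2_measurable: "(\<lambda>\<omega>. (norm (A \<omega>))\<^sup>2) \<in> borel_measurable (F s)"
    using A_adapted(1) by measurable
  have increment_square_integrable: "integrable M (\<lambda>\<omega>. (norm (increment s h \<omega>))\<^sup>2)"
    by (intro square_integrableD square_integrable_increment time_step)
  note prod = expectation_increment_mult[where f="\<lambda>x. (norm x)\<^sup>2",
    OF time_step A2_measurable square_integrableD[OF A_adapted(2)] _ increment_square_integrable, simplified]
  have norm_square_le: "(norm (A \<omega> *v increment s h \<omega>))\<^sup>2 \<le> (norm (A \<omega>))\<^sup>2 * (norm (increment s h \<omega>))\<^sup>2" for \<omega>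
    unfolding power_mult_distrib[symmetric] by (intro power_mono norm_matrix_vector_mult_le) auto
  have product_measurable: "random_variable borel (\<lambda>\<omega>. A \<omega> *v increment s h \<omega>)"
    by measurable
  show "square_integrable M (\<lambda>\<omega>. A \<omega> *v increment s h \<omega>)"
    by (rule square_integrable_boundI[OF product_measurable prod(1) norm_square_le])
  have "mean_square M (\<lambda>\<omega>. A \<omega> *v increment s h \<omega>) \<le> mean_square M A * mean_square M (increment s h)"
    using mean_square_le_integral[OF product_measurable prod(1) norm_square_le] prod(2)
    by (simp add: mean_square_def)
  then show "mean_square M (\<lambda>\<omega>. A \<omega> *v increment s h \<omega>) \<le> real CARD('d) * h * mean_square M A"
    by (simp add: mean_square_increment_eq time_step mult.commute)
qed

lemma expectation_inner_matrix_increment: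
  fixes A :: "'a \<Rightarrow> real^'d^'m"
  assumes time_step: "0 \<le> s" "0 < h" and A_measurable: "A \<in> borel_measurable (F s)"
    and A_bounded: "\<And>\<omega>. \<omega> \<in> space M \<Longrightarrow> norm (A \<omega>) \<le> B"
    and S_adapted: "S \<in> borel_measurable (F s)" "square_integrable M S"
  shows "integrable M (\<lambda>\<omega>. S \<omega> \<bullet> (A \<omega> *v increment s h \<omega>))"
    and "expectation (\<lambda>\<omega>. S \<omega> \<bullet> (A \<omega> *v increment s h \<omega>)) = 0"
proof -
  define U where "U \<omega> = transpose (A \<omega>) *v S \<omega>" for \<omega>
  note [measurable] = A_measurable S_adapted(1)
  have U_F: "U \<in> borel_measurable (F s)"
    unfolding U_def by measurable
  have U_integrable: "integrable M U"
  proof (rule Bochner_Integration.integrable_bound)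
    show "integrable M (\<lambda>\<omega>. B * norm (S \<omega>))"
      by (intro integrable_mult_right integrable_norm square_integrable_imp_integrable_norm S_adapted)
    have "norm (U \<omega>) \<le> B * norm (S \<omega>)" if "\<omega> \<in> space M" for \<omega>
      unfolding U_def
      by (rule order_trans[OF norm_transpose_matrix_vector_le mult_right_mono[OF A_bounded[OF that]]]) simp
    then show "AE \<omega> in M. norm (U \<omega>) \<le> norm (B * norm (S \<omega>))"
      by (intro AE_I2) (simp add: order_trans[OF _ abs_ge_self])
  qed (rule measurable_F_imp_measurable[OF time_step(1) U_F])
  have "S \<omega> \<bullet> (A \<omega> *v increment s h \<omega>) = U \<omega> \<bullet> increment s h \<omega>" for \<omega>
    unfolding U_def inner_transpose_matrix_vector ..
  then show "integrable M (\<lambda>\<omega>. S \<omega> \<bullet> (A \<omega> *v increment s h \<omega>))"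
    "expectation (\<lambda>\<omega>. S \<omega> \<bullet> (A \<omega> *v increment s h \<omega>)) = 0"
    using expectation_increment_inner[OF time_step U_F U_integrable] by simp_all
qed

lemma mean_square_add_matrix_increment_le:
  fixes A :: "'a \<Rightarrow> real^'d^'m"
  assumes time_step: "0 \<le> s" "0 < h" and A_measurable: "A \<in> borel_measurable (F s)"
    and A_bounded: "\<And>\<omega>. \<omega> \<in> space M \<Longrightarrow> norm (A \<omega>) \<le> B"
    and S_adapted: "S \<in> borel_measurable (F s)" "square_integrable M S"
  shows "mean_square M (\<lambda>\<omega>. S \<omega> + A \<omega> *v increment s h \<omega>) \<le>
    mean_square M S + real CARD('d) * h * mean_square M A"
proof -
  let ?AW = "\<lambda>\<omega>. A \<omega> *v increment s h \<omega>"
  have A_square_integrable: "square_integrable M A"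
    by (rule square_integrable_const_bound[OF measurable_F_imp_measurable[OF time_step(1) A_measurable]
      A_bounded])
  have "mean_square M (\<lambda>\<omega>. S \<omega> + ?AW \<omega>) =
      expectation (\<lambda>\<omega>. (norm (S \<omega>))\<^sup>2 + 2 * (S \<omega> \<bullet> ?AW \<omega>) + (norm (?AW \<omega>))\<^sup>2)"
    unfolding mean_square_def
    by (simp add: power2_norm_eq_inner inner_add_left inner_add_right inner_commute algebra_simps)
  also have "\<dots> = mean_square M S + mean_square M ?AW"
    using expectation_inner_matrix_increment[OF time_step A_measurable A_bounded S_adapted]
      square_integrableD[OF S_adapted(2)]
      square_integrableD[OF square_integrable_matrix_increment[OF time_step A_measurable A_square_integrable]]
    by (simp add: mean_square_def)
  also have "\<dots> \<le> mean_square M S + real CARD('d) * h * mean_square M A"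
    by (intro add_left_mono mean_square_matrix_increment_le time_step A_measurable A_square_integrable)
  finally show ?thesis .
qed

lemma
  fixes A :: "nat \<Rightarrow> 'a \<Rightarrow> real^'d^'m" and \<delta> :: real
  defines "S n \<omega> \<equiv> \<Sum>i<n. A i \<omega> *v grid_increment \<delta> i \<omega>"
  assumes \<delta>_pos: "\<delta> > 0" and A_measurable: "\<And>i. A i \<in> borel_measurable (F (real i * \<delta>))"
    and A_bounded: "\<And>i \<omega>. \<omega> \<in> space M \<Longrightarrow> norm (A i \<omega>) \<le> B"
  shows square_integrable_ito_sum: "square_integrable M (S n)"
    and mean_square_ito_sum_le: "mean_square M (S n) \<le> real CARD('d) * \<delta> * (\<Sum>i<n. mean_square M (A i))"
proof -
  have "S n \<in> borel_measurable (F (real n * \<delta>)) \<and> square_integrable M (S n) \<and>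
      mean_square M (S n) \<le> real CARD('d) * \<delta> * (\<Sum>i<n. mean_square M (A i))"
  proof (induction n)
    case (Suc n)
    let ?s = "real n * \<delta>"
    have s_nonneg: "0 \<le> ?s" and Suc_s: "real (Suc n) * \<delta> = ?s + \<delta>"
      using \<delta>_pos by (auto simp: algebra_simps)
    have S_Suc: "S (Suc n) = (\<lambda>\<omega>. S n \<omega> + A n \<omega> *v increment ?s \<delta> \<omega>)"
      by (simp add: S_def fun_eq_iff)
    have A_square_integrable: "square_integrable M (A n)"
      by (rule square_integrable_const_bound[OF measurable_F_imp_measurable[OF s_nonneg A_measurable]
        A_bounded])
    have [measurable]: "S n \<in> borel_measurable (F (?s + \<delta>))" "A n \<in> borel_measurable (F (?s + \<delta>))"
        "increment ?s \<delta> \<in> borel_measurable (F (?s + \<delta>))"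
      using Suc.IH A_measurable[of n] s_nonneg \<delta>_pos
      by (auto intro: measurable_F_mono[of ?s] increment_F)
    have "S (Suc n) \<in> borel_measurable (F (?s + \<delta>))"
      unfolding S_Suc by measurable
    moreover have "square_integrable M (S (Suc n))"
      unfolding S_Suc
      using Suc.IH s_nonneg \<delta>_pos A_measurable A_square_integrable
      by (intro square_integrable_addI square_integrable_matrix_increment) auto
    moreover have "mean_square M (S (Suc n)) \<le> mean_square M (S n) + real CARD('d) * \<delta> * mean_square M (A n)"
      unfolding S_Suc
      using Suc.IH
      by (intro mean_square_add_matrix_increment_le[OF s_nonneg \<delta>_pos A_measurable A_bounded]) auto
    ultimately show ?case
      using Suc.IH unfolding Suc_s by (simp add: algebra_simps)
  qed (simp add: S_def)
  then show "square_integrable M (S n)"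
    "mean_square M (S n) \<le> real CARD('d) * \<delta> * (\<Sum>i<n. mean_square M (A i))" by auto
qed

end

section \<open>Tail bound for the Euler scheme\<close>

subsection \<open>A Lyapunov function\<close>

definition lyapunov :: "nat \<Rightarrow> 'a::real_normed_vector \<Rightarrow> real" where
  "lyapunov k x = (1 + (norm x)\<^sup>2) ^ k"

definition lyapunov_rate :: "nat \<Rightarrow> real \<Rightarrow> real" where
  "lyapunov_rate k L = real k * L + (real k)\<^sup>2 * L\<^sup>2 * (1 + L) ^ k"

lemma lyapunov_nonneg [simp]: "lyapunov k x \<ge> 0"
  by (simp add: lyapunov_def)

lemma continuous_on_lyapunov: "continuous_on S (lyapunov k)"
  unfolding lyapunov_def by (intro continuous_intros)

lemma power_le_lyapunov:
  assumes "0 \<le> c" "c \<le> norm x"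
  shows "c ^ (2 * k) \<le> lyapunov k x"
proof -
  have "c\<^sup>2 \<le> 1 + (norm x)\<^sup>2"
    using power_mono[OF assms(2,1), of 2] by simp
  then show ?thesis
    unfolding lyapunov_def power_mult by (intro power_mono) auto
qed

lemma lyapunov_rate_nonneg: "L \<ge> 0 \<Longrightarrow> lyapunov_rate k L \<ge> 0"
  by (simp add: lyapunov_rate_def)

lemma abs_one_plus_power_minus_one_le:
  fixes z :: real
  shows "\<bar>(1 + z) ^ k - 1\<bar> \<le> real k * \<bar>z\<bar> * (1 + \<bar>z\<bar>) ^ k"
proof (induction k)
  case (Suc k)
  have "(1 + z) ^ Suc k - 1 = ((1 + z) ^ k - 1) + z * (1 + z) ^ k"
    by (simp add: algebra_simps)
  also have "\<bar>\<dots>\<bar> \<le> \<bar>(1 + z) ^ k - 1\<bar> + \<bar>z\<bar> * \<bar>1 + z\<bar> ^ k"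
    by (metis abs_mult abs_triangle_ineq power_abs)
  also have "\<dots> \<le> real k * \<bar>z\<bar> * (1 + \<bar>z\<bar>) ^ k + \<bar>z\<bar> * (1 + \<bar>z\<bar>) ^ k"
    using Suc by (intro add_mono mult_left_mono power_mono) auto
  also have "\<dots> = real (Suc k) * \<bar>z\<bar> * (1 + \<bar>z\<bar>) ^ k"
    by (simp add: algebra_simps)
  also have "\<dots> \<le> real (Suc k) * \<bar>z\<bar> * (1 + \<bar>z\<bar>) ^ Suc k"
    by (intro mult_left_mono power_increasing) auto
  finally show ?case .
qed simp

lemma one_plus_power_le_second_order:
  fixes z :: real
  shows "(1 + z) ^ k \<le> 1 + real k * z + (real k)\<^sup>2 * z\<^sup>2 * (1 + \<bar>z\<bar>) ^ k"
proof (induction k)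
  case (Suc k)
  have "z * ((1 + z) ^ k - 1) \<le> \<bar>z\<bar> * \<bar>(1 + z) ^ k - 1\<bar>"
    by (metis abs_ge_self abs_mult)
  also have "\<dots> \<le> \<bar>z\<bar> * (real k * \<bar>z\<bar> * (1 + \<bar>z\<bar>) ^ k)"
    by (intro mult_left_mono abs_one_plus_power_minus_one_le) auto
  also have "\<dots> = real k * z\<^sup>2 * (1 + \<bar>z\<bar>) ^ k"
    by (simp add: power2_eq_square)
  finally have remainder: "z * ((1 + z) ^ k - 1) \<le> real k * z\<^sup>2 * (1 + \<bar>z\<bar>) ^ k" .
  have "((real k)\<^sup>2 + real k) * z\<^sup>2 \<le> (real (Suc k))\<^sup>2 * z\<^sup>2"
    by (intro mult_right_mono) (auto simp: power2_eq_square algebra_simps)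
  then have "((real k)\<^sup>2 + real k) * z\<^sup>2 * (1 + \<bar>z\<bar>) ^ k \<le> (real (Suc k))\<^sup>2 * z\<^sup>2 * (1 + \<bar>z\<bar>) ^ Suc k"
    by (rule mult_mono) (auto intro: power_increasing simp del: power_Suc)
  moreover have "(1 + z) ^ Suc k = (1 + z) ^ k + z + z * ((1 + z) ^ k - 1)"
    by (simp add: algebra_simps)
  ultimately show ?case
    using Suc.IH remainder by (simp add: algebra_simps)
qed simp

text \<open>Here \<open>h\<close> is the step size, \<open>q\<close> controls the noise of one step, and \<open>a\<close> is the part of the relative
  change \<open>a + c\<close> that is linear in the noise. Only \<open>a\<close> is as large as \<open>sqrt h\<close>; it has mean zero.\<close>

lemma one_plus_power_increment_le:
  fixes a c h L q :: real
  assumes h_bounds: "0 < h" "h \<le> 1" and q_ge_1: "1 \<le> q" and L_nonneg: "0 \<le> L"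
    and abs_add_le: "\<bar>a + c\<bar> \<le> L * sqrt h * q\<^sup>2" and c_le: "c \<le> L * h * q\<^sup>2"
  shows "(1 + (a + c)) ^ k \<le> 1 + real k * a + h * lyapunov_rate k L * q ^ (2 * (k + 2))"
proof -
  have q_powers: "1 \<le> q\<^sup>2" "q\<^sup>2 \<le> q ^ (2 * (k + 2))"
    using q_ge_1 by (intro one_le_power power_increasing; simp)+
  have "(a + c)\<^sup>2 \<le> (L * sqrt h * q\<^sup>2)\<^sup>2"
    using power_mono[OF abs_add_le, of 2] by simp
  also have "\<dots> = L\<^sup>2 * h * q ^ 4"
    using h_bounds by (simp add: power_mult_distrib)
  finally have square: "(a + c)\<^sup>2 \<le> L\<^sup>2 * h * q ^ 4" .
  have "L * sqrt h * q\<^sup>2 \<le> L * 1 * q\<^sup>2"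
    using h_bounds L_nonneg by (intro mult_right_mono mult_left_mono) auto
  then have "1 + \<bar>a + c\<bar> \<le> (1 + L) * q\<^sup>2"
    using abs_add_le q_powers(1) by (simp add: algebra_simps)
  then have "(1 + \<bar>a + c\<bar>) ^ k \<le> ((1 + L) * q\<^sup>2) ^ k"
    by (intro power_mono) auto
  then have power: "(1 + \<bar>a + c\<bar>) ^ k \<le> (1 + L) ^ k * q ^ (2 * k)"
    by (simp add: power_mult_distrib power_mult)
  have "c \<le> L * h * q ^ (2 * (k + 2))"
    using c_le by (rule order_trans) (use L_nonneg h_bounds q_powers in \<open>intro mult_left_mono; simp\<close>)
  then have linear: "real k * c \<le> real k * (L * h * q ^ (2 * (k + 2)))"
    by (intro mult_left_mono) auto
  have "(1 + (a + c)) ^ k \<le> 1 + real k * (a + c) + (real k)\<^sup>2 * (a + c)\<^sup>2 * (1 + \<bar>a + c\<bar>) ^ k"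
    by (rule one_plus_power_le_second_order)
  also have "\<dots> \<le> 1 + real k * (a + c) + (real k)\<^sup>2 * (L\<^sup>2 * h * q ^ 4) * ((1 + L) ^ k * q ^ (2 * k))"
    using h_bounds by (intro add_left_mono mult_mono square power) auto
  also have "\<dots> \<le> 1 + real k * a + real k * (L * h * q ^ (2 * (k + 2))) +
      (real k)\<^sup>2 * (L\<^sup>2 * h * q ^ 4) * ((1 + L) ^ k * q ^ (2 * k))"
    using linear by (simp add: distrib_left)
  also have "\<dots> = 1 + real k * a + h * lyapunov_rate k L * q ^ (2 * (k + 2))"
  proof -
    have "q ^ (2 * (k + 2)) = q ^ 4 * q ^ (2 * k)"
      by (simp add: power4_eq_xxxx mult.assoc)
    then show ?thesis
      unfolding lyapunov_rate_def by (simp only: algebra_simps)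
  qed
  finally show ?thesis .
qed

text \<open>The relative change of \<open>1 + |x|\<^sup>2\<close> in the step from \<open>x\<close> to \<open>x + D + r\<close>, split into the part that is
  linear in the noise \<open>D\<close> and the rest.\<close>

definition noise_ratio :: "'a::real_inner \<Rightarrow> 'a \<Rightarrow> real" where
  "noise_ratio x D = 2 * (x \<bullet> D) / (1 + (norm x)\<^sup>2)"

definition drift_ratio :: "'a::real_inner \<Rightarrow> 'a \<Rightarrow> 'a \<Rightarrow> real" where
  "drift_ratio x D r = (2 * (x \<bullet> r) + (norm (D + r))\<^sup>2) / (1 + (norm x)\<^sup>2)"

lemma one_plus_norm_square_pos: "0 < 1 + (norm x)\<^sup>2"
  by (simp add: add_pos_nonneg)

lemma one_plus_norm_square_add:
  "1 + (norm (x + D + r))\<^sup>2 = (1 + (norm x)\<^sup>2) * (1 + (noise_ratio x D + drift_ratio x D r))"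
proof -
  have "1 + (norm x)\<^sup>2 \<noteq> 0"
    using one_plus_norm_square_pos[of x] by simp
  then have "(1 + (norm x)\<^sup>2) * noise_ratio x D = 2 * (x \<bullet> D)"
    "(1 + (norm x)\<^sup>2) * drift_ratio x D r = 2 * (x \<bullet> r) + (norm (D + r))\<^sup>2"
    by (simp_all add: noise_ratio_def drift_ratio_def)
  then have "(1 + (norm x)\<^sup>2) * (1 + (noise_ratio x D + drift_ratio x D r)) =
      1 + (norm x)\<^sup>2 + 2 * (x \<bullet> D) + (2 * (x \<bullet> r) + (norm (D + r))\<^sup>2)"
    by (simp only: distrib_left mult_1_right add.assoc)
  moreover have "(norm (x + (D + r)))\<^sup>2 = (norm x)\<^sup>2 + 2 * (x \<bullet> D) + (2 * (x \<bullet> r) + (norm (D + r))\<^sup>2)"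
    unfolding power2_norm_eq_inner by (simp add: inner_add_left inner_add_right inner_commute)
  ultimately show ?thesis
    by (simp add: add.assoc)
qed

lemma norm_mult_one_plus_norm_le: "norm x * (1 + norm x) \<le> 2 * (1 + (norm x)\<^sup>2)"
  and one_plus_norm_square_le: "(1 + norm x)\<^sup>2 \<le> 2 * (1 + (norm x)\<^sup>2)"
proof -
  have "0 \<le> (norm x - 1)\<^sup>2"
    by simp
  then show "norm x * (1 + norm x) \<le> 2 * (1 + (norm x)\<^sup>2)" "(1 + norm x)\<^sup>2 \<le> 2 * (1 + (norm x)\<^sup>2)"
    unfolding power2_diff power2_sum using norm_ge_zero[of x]
    by (simp_all add: distrib_left power2_eq_square del: norm_ge_zero)
qed

lemma abs_inner_le_one_plus_norm_square:
  assumes "0 \<le> K" "0 \<le> c" and y_le: "norm y \<le> K * (1 + norm x) * c"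
  shows "\<bar>x \<bullet> y\<bar> \<le> (1 + (norm x)\<^sup>2) * (2 * K * c)"
proof -
  have "\<bar>x \<bullet> y\<bar> \<le> norm x * norm y"
    by (rule Cauchy_Schwarz_ineq2)
  also have "\<dots> \<le> norm x * (K * (1 + norm x) * c)"
    by (intro mult_left_mono y_le) simp
  also have "\<dots> = (norm x * (1 + norm x)) * (K * c)"
    by simp
  also have "\<dots> \<le> 2 * (1 + (norm x)\<^sup>2) * (K * c)"
    using assms by (intro mult_right_mono norm_mult_one_plus_norm_le) auto
  finally show ?thesis by (simp add: mult_ac)
qed

context
  fixes x D r :: "'a::real_inner" and K h q :: real
  assumes h_pos: "0 < h" and h_le_1: "h \<le> 1" and q_ge_1: "1 \<le> q" and K_nonneg: "0 \<le> K"
    and D_le: "norm D \<le> K * (1 + norm x) * (sqrt h * q)" and r_le: "norm r \<le> K * (1 + norm x) * (h * q)"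
begin

lemma h_le_sqrt_h: "h \<le> sqrt h"
  using h_pos h_le_1 by (intro real_le_rsqrt) (simp add: power2_eq_square mult_left_le)

lemma q_le_q_square: "q \<le> q\<^sup>2"
  using q_ge_1 by (intro self_le_power) auto

lemma norm_square_noise_add_drift_le: "(norm (D + r))\<^sup>2 \<le> (1 + (norm x)\<^sup>2) * (8 * K\<^sup>2 * (h * q\<^sup>2))"
proof -
  have "norm r \<le> K * (1 + norm x) * (sqrt h * q)"
    using r_le
    by (rule order_trans) (use h_le_sqrt_h K_nonneg q_ge_1 in \<open>intro mult_left_mono mult_right_mono; simp\<close>)
  then have "norm (D + r) \<le> 2 * (K * (1 + norm x) * (sqrt h * q))"
    using D_le norm_triangle_ineq[of D r] by linarith
  then have "(norm (D + r))\<^sup>2 \<le> (2 * (K * (1 + norm x) * (sqrt h * q)))\<^sup>2"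
    by (intro power_mono) auto
  also have "\<dots> = (1 + norm x)\<^sup>2 * (4 * K\<^sup>2 * (h * q\<^sup>2))"
    using h_pos by (simp add: power_mult_distrib)
  also have "\<dots> \<le> (2 * (1 + (norm x)\<^sup>2)) * (4 * K\<^sup>2 * (h * q\<^sup>2))"
    using h_pos by (intro mult_right_mono one_plus_norm_square_le) auto
  finally show ?thesis by (simp add: algebra_simps)
qed

lemma abs_noise_ratio_le: "\<bar>noise_ratio x D\<bar> \<le> 4 * K * (sqrt h * q\<^sup>2)"
proof -
  have "norm D \<le> K * (1 + norm x) * (sqrt h * q\<^sup>2)"
    using D_le by (rule order_trans) (use K_nonneg h_pos q_le_q_square in \<open>intro mult_left_mono; simp\<close>)
  then have "\<bar>x \<bullet> D\<bar> \<le> (1 + (norm x)\<^sup>2) * (2 * K * (sqrt h * q\<^sup>2))"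
    using K_nonneg h_pos by (intro abs_inner_le_one_plus_norm_square) auto
  then show ?thesis
    using one_plus_norm_square_pos[of x]
    by (simp add: noise_ratio_def abs_divide abs_mult divide_le_eq mult_ac)
qed

lemma abs_drift_ratio_le: "\<bar>drift_ratio x D r\<bar> \<le> (4 * K + 8 * K\<^sup>2) * (h * q\<^sup>2)"
proof -
  have "norm r \<le> K * (1 + norm x) * (h * q\<^sup>2)"
    using r_le by (rule order_trans) (use K_nonneg h_pos q_le_q_square in \<open>intro mult_left_mono; simp\<close>)
  then have inner_r_le: "\<bar>x \<bullet> r\<bar> \<le> (1 + (norm x)\<^sup>2) * (2 * K * (h * q\<^sup>2))"
    using K_nonneg h_pos by (intro abs_inner_le_one_plus_norm_square) auto
  have "\<bar>2 * (x \<bullet> r) + (norm (D + r))\<^sup>2\<bar> \<le> 2 * \<bar>x \<bullet> r\<bar> + (norm (D + r))\<^sup>2"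
    by (rule order_trans[OF abs_triangle_ineq]) (simp add: abs_mult)
  also have "\<dots> \<le> 2 * ((1 + (norm x)\<^sup>2) * (2 * K * (h * q\<^sup>2))) + (1 + (norm x)\<^sup>2) * (8 * K\<^sup>2 * (h * q\<^sup>2))"
    using inner_r_le norm_square_noise_add_drift_le by linarith
  also have "\<dots> = (1 + (norm x)\<^sup>2) * ((4 * K + 8 * K\<^sup>2) * (h * q\<^sup>2))"
    by (simp add: algebra_simps)
  finally show ?thesis
    using one_plus_norm_square_pos[of x]
    by (simp add: drift_ratio_def abs_divide pos_divide_le_eq mult.commute)
qed

lemma lyapunov_increment_le:
  assumes k_ge_1: "1 \<le> k"
  shows "lyapunov k (x + D + r) \<le> lyapunov k x + (2 * real k * lyapunov (k - 1) x) * (x \<bullet> D) +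
      h * lyapunov_rate k (8 * K + 8 * K\<^sup>2) * (lyapunov k x * q ^ (2 * (k + 2)))"
proof -
  define A where "A = 1 + (norm x)\<^sup>2"
  define L where "L = 8 * K + 8 * K\<^sup>2"
  let ?a = "noise_ratio x D" and ?c = "drift_ratio x D r"
  have A_pos: "A > 0"
    unfolding A_def by (rule one_plus_norm_square_pos)
  have L_nonneg: "L \<ge> 0"
    using K_nonneg by (simp add: L_def)
  have "(4 * K + 8 * K\<^sup>2) * (h * q\<^sup>2) \<le> L * (h * q\<^sup>2)"
    unfolding L_def using K_nonneg h_pos by (intro mult_right_mono) auto
  then have drift: "?c \<le> L * h * q\<^sup>2"
    using abs_drift_ratio_le by (simp add: mult.assoc)
  have "(4 * K + 8 * K\<^sup>2) * (h * q\<^sup>2) \<le> (4 * K + 8 * K\<^sup>2) * (sqrt h * q\<^sup>2)"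
    using K_nonneg h_le_sqrt_h by (intro mult_left_mono mult_right_mono) auto
  then have total: "\<bar>?a + ?c\<bar> \<le> L * sqrt h * q\<^sup>2"
    using abs_noise_ratio_le abs_drift_ratio_le by (simp add: L_def algebra_simps)
  have "lyapunov k (x + D + r) = A ^ k * (1 + (?a + ?c)) ^ k"
    by (simp add: lyapunov_def A_def one_plus_norm_square_add power_mult_distrib)
  also have "\<dots> \<le> A ^ k * (1 + real k * ?a + h * lyapunov_rate k L * q ^ (2 * (k + 2)))"
    using A_pos
    by (intro mult_left_mono one_plus_power_increment_le h_pos h_le_1 q_ge_1 L_nonneg total drift) auto
  also have "\<dots> = A ^ k + real k * (A ^ k * ?a) + h * lyapunov_rate k L * (A ^ k * q ^ (2 * (k + 2)))"
    by (simp add: algebra_simps)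
  also have "A ^ k * ?a = 2 * A ^ (k - 1) * (x \<bullet> D)"
  proof -
    have "A ^ k = A * A ^ (k - 1)"
      using k_ge_1 by (cases k) auto
    then show ?thesis
      using A_pos by (simp add: noise_ratio_def A_def[symmetric])
  qed
  finally show ?thesis
    by (simp add: lyapunov_def A_def L_def mult_ac)
qed

end

lemma (in prob_space) integrable_indicator_continuous:
  fixes f :: "'b::euclidean_space \<Rightarrow> 'c::{banach,second_countable_topology}"
  assumes f_continuous: "continuous_on UNIV f" and Y_measurable [measurable]: "random_variable borel Y"
    and A_event [measurable]: "A \<in> events" and Y_bounded: "\<And>\<omega>. \<omega> \<in> A \<Longrightarrow> norm (Y \<omega>) \<le> B"
  shows "integrable M (\<lambda>\<omega>. indicator A \<omega> *\<^sub>R f (Y \<omega>))"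
proof -
  have [measurable]: "f \<in> borel_measurable borel"
    using f_continuous by (rule borel_measurable_continuous_onI)
  have "compact (f ` cball 0 B)"
    by (intro compact_continuous_image continuous_on_subset[OF f_continuous]) auto
  then obtain C where "\<And>y. y \<in> f ` cball 0 B \<Longrightarrow> norm y \<le> C"
    using compact_imp_bounded bounded_iff by metis
  then have "norm (indicator A \<omega> *\<^sub>R f (Y \<omega>)) \<le> max 0 C" for \<omega>
    using Y_bounded[of \<omega>] by (cases "\<omega> \<in> A") (auto simp: le_max_iff_disj)
  then show ?thesis
    by (intro integrable_const_bound[of _ "max 0 C"] AE_I2) auto
qed

lemma (in wiener) expectation_increment_growth_le:
  assumes time_step: "0 \<le> s" "0 < h" and U_adapted: "U \<in> borel_measurable (F s)" "integrable M U" "\<And>\<omega>. 0 \<le> U \<omega>"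
    and G_adapted: "G \<in> borel_measurable (F s)" "integrable M G"
    and V_measurable: "random_variable borel V" and V_nonneg: "\<And>\<omega>. 0 \<le> V \<omega>" and c_nonneg: "0 \<le> c"
    and V_le: "\<And>\<omega>. V \<omega> \<le> U \<omega> + G \<omega> \<bullet> increment s h \<omega> +
      c * (U \<omega> * (1 + norm (increment s h \<omega>) / sqrt h) ^ (2 * j))"
  shows "integrable M V" "expectation V \<le> (1 + c * moment_bound j) * expectation U"
proof -
  define q where "q x = (1 + norm x / sqrt h) ^ (2 * j)" for x :: "real^'d"
  have q_measurable: "q \<in> borel_measurable borel"
    unfolding q_def by measurable
  have q_integrable: "integrable M (\<lambda>\<omega>. q (increment s h \<omega>))"
    and moment_le: "expectation (\<lambda>\<omega>. q (increment s h \<omega>)) \<le> moment_bound j"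
    unfolding q_def by (intro integrable_increment_moment expectation_increment_moment_le time_step)+
  note noise = expectation_increment_mult[OF time_step U_adapted(1,2) q_measurable q_integrable]
  note linear = expectation_increment_inner[OF time_step G_adapted]
  let ?R = "\<lambda>\<omega>. U \<omega> + G \<omega> \<bullet> increment s h \<omega> + c * (U \<omega> * q (increment s h \<omega>))"
  have R_integrable: "integrable M ?R"
    using U_adapted(2) linear(1) noise(1) by simp
  have V_le_R: "V \<omega> \<le> ?R \<omega>" for \<omega>
    using V_le by (simp add: q_def)
  show V_integrable: "integrable M V"
    by (rule Bochner_Integration.integrable_bound[OF R_integrable V_measurable])
      (use V_nonneg V_le_R in \<open>auto intro!: AE_I2 intro: order_trans[OF _ abs_ge_self]\<close>)
  have "expectation V \<le> expectation ?R"
    by (rule integral_mono[OF V_integrable R_integrable V_le_R])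
  also have "\<dots> = expectation U + c * (expectation U * expectation (\<lambda>\<omega>. q (increment s h \<omega>)))"
    using U_adapted(2) linear noise by simp
  also have "\<dots> \<le> expectation U + c * (expectation U * moment_bound j)"
    using U_adapted(3) c_nonneg moment_le
    by (intro add_left_mono mult_left_mono integral_nonneg_AE AE_I2) auto
  finally show "expectation V \<le> (1 + c * moment_bound j) * expectation U"
    by (simp add: algebra_simps)
qed

subsection \<open>The Euler scheme\<close>

declare euler_grid.simps(2) [simp del]

lemma real_Suc_mult: "real (Suc n) * h = real n * h + h"
  by (simp add: algebra_simps)

locale euler_scheme = wiener M F W
  for M :: "'a measure" and F :: "real \<Rightarrow> 'a measure" and W :: "real \<Rightarrow> 'a \<Rightarrow> real ^ 'd" +
  fixes b :: "real ^ 'm \<Rightarrow> real ^ 'm" and \<sigma> :: "real ^ 'm \<Rightarrow> real ^ 'd ^ 'm"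
    and \<eta> :: "real \<Rightarrow> real ^ 'm \<Rightarrow> real ^ 'd \<Rightarrow> real ^ 'm"
    and x0 :: "real ^ 'm" and K1 K2 :: real and \<alpha> :: ereal
  assumes locally_lipschitz: "\<forall>N>0. \<exists>K. \<forall>x y. norm x \<le> N \<longrightarrow> norm y \<le> N \<longrightarrow>
               norm (b x - b y) \<le> K * norm (x - y) \<and> norm (\<sigma> x - \<sigma> y) \<le> K * norm (x - y)"
    and linear_growth: "\<forall>x. norm (b x) \<le> K1 * (1 + norm x) \<and> norm (\<sigma> x) \<le> K1 * (1 + norm x)"
    and \<eta>_jointly_measurable: "\<forall>h>0. (\<lambda>(x, y). \<eta> h x y) \<in> borel_measurable borel"
    and \<alpha>_pos: "\<alpha> > 0"
    and \<eta>_bound: "\<forall>h>0. \<forall>x y. norm (\<eta> h x y) \<le> K2 * (hpow h \<alpha> * norm x + norm y)"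
begin

abbreviation Y :: "real \<Rightarrow> nat \<Rightarrow> 'a \<Rightarrow> real ^ 'm" where
  "Y \<equiv> euler_grid W b \<sigma> \<eta> x0"

lemma lipschitz_on_cball:
  assumes "N > 0"
  obtains K where "K-lipschitz_on (cball 0 N) b" "K-lipschitz_on (cball 0 N) \<sigma>"
proof -
  obtain K where local_lipschitz: "\<And>x y. norm x \<le> N \<Longrightarrow> norm y \<le> N \<Longrightarrow>
      norm (b x - b y) \<le> K * norm (x - y) \<and> norm (\<sigma> x - \<sigma> y) \<le> K * norm (x - y)"
    using locally_lipschitz assms by meson
  have abs_le: "K * norm (x - y) \<le> \<bar>K\<bar> * norm (x - y)" for x y :: "real^'m"
    by (intro mult_right_mono) auto
  have "norm (b x - b y) \<le> \<bar>K\<bar> * norm (x - y)" "norm (\<sigma> x - \<sigma> y) \<le> \<bar>K\<bar> * norm (x - y)"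
    if "norm x \<le> N" "norm y \<le> N" for x y
    using local_lipschitz[OF that] abs_le[of x y] by linarith+
  then have "\<bar>K\<bar>-lipschitz_on (cball 0 N) b" "\<bar>K\<bar>-lipschitz_on (cball 0 N) \<sigma>"
    by (auto intro!: lipschitz_onI simp: dist_norm)
  then show ?thesis by (rule that)
qed

lemma continuous_b: "continuous_on UNIV b"
  and continuous_\<sigma>: "continuous_on UNIV \<sigma>"
  by (rule continuous_on_UNIV_if_lipschitz_on_cball, metis lipschitz_on_cball)+

lemma b_measurable [measurable]: "b \<in> borel_measurable borel"
  and \<sigma>_measurable [measurable]: "\<sigma> \<in> borel_measurable borel"
  using continuous_b continuous_\<sigma> by (auto intro: borel_measurable_continuous_onI)

lemma K1_nonneg: "K1 \<ge> 0"
proof -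
  have "norm (b 0) \<le> K1 * (1 + norm (0 :: real^'m))"
    using linear_growth by blast
  then show ?thesis using norm_ge_zero[of "b 0"] by (simp del: norm_ge_zero)
qed

lemma K2_nonneg: "K2 \<ge> 0"
proof -
  let ?y = "axis undefined 1 :: real^'d"
  have "norm (\<eta> 1 0 ?y) \<le> K2 * (hpow 1 \<alpha> * norm (0 :: real^'m) + norm ?y)"
    using \<eta>_bound by (metis zero_less_one)
  then show ?thesis using norm_ge_zero[of "\<eta> 1 0 ?y"] by (simp del: norm_ge_zero)
qed

lemma \<eta>_measurable:
  assumes "h > 0" "f \<in> borel_measurable N" "g \<in> borel_measurable N"
  shows "(\<lambda>\<omega>. \<eta> h (f \<omega>) (g \<omega>)) \<in> borel_measurable N"
proof -
  have "(\<lambda>\<omega>. (\<lambda>(x, y). \<eta> h x y) (f \<omega>, g \<omega>)) \<in> borel_measurable N"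
    using \<eta>_jointly_measurable assms by (intro measurable_compose[OF borel_measurable_Pair]) auto
  then show ?thesis by simp
qed

lemma hpow_nonneg: "hpow h \<alpha> \<ge> 0"
  by (cases \<alpha>) (auto simp: hpow_def)

lemma hpow_le_1: "0 < h \<Longrightarrow> h \<le> 1 \<Longrightarrow> hpow h \<alpha> \<le> 1"
  using \<alpha>_pos by (cases \<alpha>) (auto simp: hpow_def powr_le1)

lemma hpow_tendsto_0: "((\<lambda>h. hpow h \<alpha>) \<longlongrightarrow> 0) (at_right 0)"
proof (cases \<alpha>)
  case (real r)
  have "((\<lambda>h::real. h powr r) \<longlongrightarrow> 0) (at_right 0)"
    using \<alpha>_pos real eventually_at_right_less[of "0::real"]
    by (intro tendsto_zero_powrI[where b=r] tendsto_intros) (auto elim: eventually_mono)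
  then show ?thesis using real by (simp add: hpow_def)
qed (use \<alpha>_pos in \<open>auto simp: hpow_def\<close>)

lemma Y_Suc: "Y h (Suc n) \<omega> = Y h n \<omega> + \<sigma> (Y h n \<omega>) *v grid_increment h n \<omega>
    + h *\<^sub>R b (Y h n \<omega>) + h *\<^sub>R \<eta> h (Y h n \<omega>) (grid_increment h n \<omega>)"
  by (simp only: Let_def euler_grid.simps(2) increment_def real_Suc_mult)

lemma Y_F:
  assumes h_pos: "h > 0"
  shows "Y h n \<in> borel_measurable (F (real n * h))"
proof (induction n)
  case (Suc n)
  have [measurable]: "Y h n \<in> borel_measurable (F (real n * h + h))"
      "grid_increment h n \<in> borel_measurable (F (real n * h + h))"
    using h_pos Suc.IH by (auto intro: measurable_F_mono[of "real n * h"] increment_F)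
  then have [measurable]: "(\<lambda>\<omega>. \<eta> h (Y h n \<omega>) (grid_increment h n \<omega>)) \<in> borel_measurable (F (real n * h + h))"
    by (rule \<eta>_measurable[OF h_pos])
  show ?case
    unfolding Y_Suc[abs_def] real_Suc_mult by measurable
qed simp

lemma random_variable_Y: "h > 0 \<Longrightarrow> random_variable borel (Y h n)"
  using measurable_F_imp_measurable[OF _ Y_F] by simp

lemma norm_drift_le:
  assumes h_bounds: "0 < h" "h \<le> 1"
  shows "norm (h *\<^sub>R b x + h *\<^sub>R \<eta> h x y) \<le> (K1 + K2) * (1 + norm x) * (h * (1 + norm y / sqrt h))"
proof -
  define q where "q = 1 + norm y / sqrt h"
  have "norm y \<le> norm y / sqrt h"
    using h_bounds by (simp add: pos_le_divide_eq mult_left_le)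
  then have le_q: "1 + norm y \<le> q"
    by (simp add: q_def)
  have "norm (b x) \<le> K1 * (1 + norm x) * 1"
    using linear_growth by simp
  also have "\<dots> \<le> K1 * (1 + norm x) * q"
    using K1_nonneg le_q norm_ge_zero[of x] norm_ge_zero[of y]
    by (intro mult_left_mono mult_nonneg_nonneg) linarith+
  finally have norm_b_le: "norm (b x) \<le> K1 * (1 + norm x) * q" .
  have "hpow h \<alpha> * norm x \<le> 1 * norm x"
    using h_bounds by (intro mult_right_mono hpow_le_1) auto
  then have "hpow h \<alpha> * norm x + norm y \<le> norm x + norm y"
    by simp
  also have "\<dots> \<le> (1 + norm x) * (1 + norm y)"
    by (simp add: algebra_simps)
  also have "\<dots> \<le> (1 + norm x) * q"
    using le_q by (intro mult_left_mono) auto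
  finally have "K2 * (hpow h \<alpha> * norm x + norm y) \<le> K2 * ((1 + norm x) * q)"
    using K2_nonneg by (rule mult_left_mono)
  moreover have "norm (\<eta> h x y) \<le> K2 * (hpow h \<alpha> * norm x + norm y)"
    using \<eta>_bound h_bounds by blast
  ultimately have norm_\<eta>_le: "norm (\<eta> h x y) \<le> K2 * (1 + norm x) * q"
    by (simp add: mult.assoc)
  have "norm (h *\<^sub>R b x + h *\<^sub>R \<eta> h x y) \<le> h * norm (b x) + h * norm (\<eta> h x y)"
    using h_bounds norm_triangle_ineq[of "h *\<^sub>R b x" "h *\<^sub>R \<eta> h x y"] by simp
  also have "\<dots> \<le> h * (K1 * (1 + norm x) * q) + h * (K2 * (1 + norm x) * q)"
    using h_bounds by (intro add_mono mult_left_mono norm_b_le norm_\<eta>_le) auto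
  finally show ?thesis
    by (simp add: q_def[symmetric] algebra_simps)
qed

definition growth_rate :: "nat \<Rightarrow> real" where
  "growth_rate k = lyapunov_rate k (8 * (K1 + K2) + 8 * (K1 + K2)\<^sup>2)"

definition lyapunov_gradient :: "nat \<Rightarrow> real ^ 'm \<Rightarrow> real ^ 'd" where
  "lyapunov_gradient k x = (2 * real k * lyapunov (k - 1) x) *\<^sub>R (transpose (\<sigma> x) *v x)"

lemma growth_rate_nonneg: "growth_rate k \<ge> 0"
  using K1_nonneg K2_nonneg by (simp add: growth_rate_def lyapunov_rate_nonneg)

lemma continuous_lyapunov_gradient: "continuous_on UNIV (lyapunov_gradient k)"
  unfolding lyapunov_gradient_def transpose_def
  by (intro continuous_intros continuous_on_lyapunov continuous_\<sigma>
      bounded_bilinear.continuous_on[OF bounded_bilinear_matrix_vector_mult])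

lemma lyapunov_Y_Suc_le:
  assumes h_bounds: "0 < h" "h \<le> 1" and k_ge_1: "1 \<le> k"
  shows "lyapunov k (Y h (Suc n) \<omega>) \<le> lyapunov k (Y h n \<omega>) +
    lyapunov_gradient k (Y h n \<omega>) \<bullet> grid_increment h n \<omega> +
    h * growth_rate k * (lyapunov k (Y h n \<omega>) * (1 + norm (grid_increment h n \<omega>) / sqrt h) ^ (2 * (k + 2)))"
proof -
  define x where "x = Y h n \<omega>"
  define y where "y = grid_increment h n \<omega>"
  have K_nonneg: "0 \<le> K1 + K2"
    using K1_nonneg K2_nonneg by simp
  have "norm (\<sigma> x) \<le> K1 * (1 + norm x)"
    using linear_growth by simp
  also have "\<dots> \<le> (K1 + K2) * (1 + norm x)"
    using K2_nonneg by (intro mult_right_mono) auto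
  finally have norm_\<sigma>_le: "norm (\<sigma> x) \<le> (K1 + K2) * (1 + norm x)" .
  have "norm y \<le> sqrt h * (1 + norm y / sqrt h)"
    using h_bounds by (simp add: distrib_left)
  then have noise_le: "norm (\<sigma> x *v y) \<le> (K1 + K2) * (1 + norm x) * (sqrt h * (1 + norm y / sqrt h))"
    using K_nonneg by (intro order_trans[OF norm_matrix_vector_mult_le] mult_mono[OF norm_\<sigma>_le]) auto
  have q_ge_1: "1 \<le> 1 + norm y / sqrt h"
    using h_bounds by simp
  have "lyapunov k (x + \<sigma> x *v y + (h *\<^sub>R b x + h *\<^sub>R \<eta> h x y)) \<le>
      lyapunov k x + (2 * real k * lyapunov (k - 1) x) * (x \<bullet> (\<sigma> x *v y)) +
      h * growth_rate k * (lyapunov k x * (1 + norm y / sqrt h) ^ (2 * (k + 2)))"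
    unfolding growth_rate_def
    by (rule lyapunov_increment_le[OF h_bounds q_ge_1 K_nonneg noise_le norm_drift_le[OF h_bounds] k_ge_1])
  then show ?thesis
    unfolding Y_Suc lyapunov_gradient_def inner_scaleR_left inner_transpose_matrix_vector
      x_def y_def by (simp add: add.assoc)
qed

lemma lyapunov_supermartingale:
  assumes h_bounds: "0 < h" "h \<le> 1" and k_ge_1: "1 \<le> k" and A_F: "A \<in> sets (F (real n * h))"
    and Y_bounded: "\<And>\<omega>. \<omega> \<in> A \<Longrightarrow> norm (Y h n \<omega>) \<le> B"
  shows "integrable M (\<lambda>\<omega>. indicator A \<omega> * lyapunov k (Y h (Suc n) \<omega>))"
    and "expectation (\<lambda>\<omega>. indicator A \<omega> * lyapunov k (Y h (Suc n) \<omega>)) \<le>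
      (1 + growth_rate k * moment_bound (k + 2) * h) * expectation (\<lambda>\<omega>. indicator A \<omega> * lyapunov k (Y h n \<omega>))"
proof -
  let ?s = "real n * h"
  let ?U = "\<lambda>\<omega>. indicator A \<omega> * lyapunov k (Y h n \<omega>)" and ?V = "\<lambda>\<omega>. indicator A \<omega> * lyapunov k (Y h (Suc n) \<omega>)"
    and ?G = "\<lambda>\<omega>. indicator A \<omega> *\<^sub>R lyapunov_gradient k (Y h n \<omega>)"
  have s_nonneg: "0 \<le> ?s"
    using h_bounds by simp
  have A_event: "A \<in> events"
    by (rule sets_F_imp_events[OF s_nonneg A_F])
  note Y_rv = random_variable_Y[OF h_bounds(1)]
  have [measurable]: "lyapunov k \<in> borel_measurable (borel :: (real^'m) measure)"
      "lyapunov_gradient k \<in> borel_measurable borel"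
    by (intro borel_measurable_continuous_onI continuous_on_lyapunov continuous_lyapunov_gradient)+
  note [measurable] = A_F Y_F[OF h_bounds(1)]
  have U_F: "?U \<in> borel_measurable (F ?s)" and G_F: "?G \<in> borel_measurable (F ?s)"
    by measurable
  have U_integrable: "integrable M ?U"
    using integrable_indicator_continuous[OF continuous_on_lyapunov Y_rv A_event Y_bounded] by simp
  have G_integrable: "integrable M ?G"
    by (rule integrable_indicator_continuous[OF continuous_lyapunov_gradient Y_rv A_event Y_bounded])
  have V_measurable: "random_variable borel ?V"
    using Y_rv[of "Suc n"] A_event by measurable
  have step_le: "?V \<omega> \<le> ?U \<omega> + ?G \<omega> \<bullet> increment ?s h \<omega> +
      h * growth_rate k * (?U \<omega> * (1 + norm (increment ?s h \<omega>) / sqrt h) ^ (2 * (k + 2)))" for \<omega>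
    using lyapunov_Y_Suc_le[OF h_bounds k_ge_1, of n \<omega>] by (cases "\<omega> \<in> A") simp_all
  have "0 \<le> h * growth_rate k"
    using h_bounds growth_rate_nonneg by simp
  note growth = expectation_increment_growth_le[OF s_nonneg h_bounds(1) U_F U_integrable _ G_F G_integrable
    V_measurable _ this step_le]
  show "integrable M ?V"
    by (rule growth(1)) simp_all
  show "expectation ?V \<le> (1 + growth_rate k * moment_bound (k + 2) * h) * expectation ?U"
    using growth(2) by (simp add: mult_ac)
qed

lemma below_lyapunov_Y_F:
  assumes h_pos: "0 < h"
  shows "below (\<lambda>i \<omega>. lyapunov k (Y h i \<omega>)) \<Lambda> n \<in> sets (F (real n * h))" (is "?below \<in> sets ?N")
proof -
  have [measurable]: "lyapunov k \<in> borel_measurable (borel :: (real^'m) measure)"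
    by (intro borel_measurable_continuous_onI continuous_on_lyapunov)
  have "?below = {\<omega>\<in>space ?N. \<forall>i\<in>{..n}. lyapunov k (Y h i \<omega>) < \<Lambda>}"
    using h_pos by (auto simp: below_def)
  also have "\<dots> \<in> sets ?N"
  proof (rule sets.sets_Collect_finite_All')
    fix i assume "i \<in> {..n}"
    then have [measurable]: "Y h i \<in> borel_measurable ?N"
      using h_pos by (intro measurable_F_mono[OF _ _ Y_F]) (auto intro: mult_right_mono)
    show "{\<omega>\<in>space ?N. lyapunov k (Y h i \<omega>) < \<Lambda>} \<in> sets ?N"
      by measurable
  qed auto
  finally show ?thesis .
qed

lemma prob_norm_Y_exceeds_le:
  assumes h_bounds: "0 < h" "h \<le> 1" and k_ge_1: "1 \<le> k" and c_pos: "c > 0"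
  shows "prob {\<omega>\<in>space M. \<exists>i\<le>n. c < norm (Y h i \<omega>)} \<le>
    (1 + growth_rate k * moment_bound (k + 2) * h) ^ n * lyapunov k x0 / c ^ (2 * k)"
proof -
  let ?V = "\<lambda>i \<omega>. lyapunov k (Y h i \<omega>)" and ?\<Lambda> = "c ^ (2 * k)" and ?r = "growth_rate k * moment_bound (k + 2)"
  have [measurable]: "lyapunov k \<in> borel_measurable (borel :: (real^'m) measure)"
    by (intro borel_measurable_continuous_onI continuous_on_lyapunov)
  have V_measurable [measurable]: "random_variable borel (?V i)" for i
    using random_variable_Y[OF h_bounds(1)] by measurable
  have rate_nonneg: "?r * h \<ge> 0"
    using h_bounds by (intro mult_nonneg_nonneg growth_rate_nonneg moment_bound_nonneg) simp
  have exceeds: "?\<Lambda> \<le> ?V i \<omega>" if "c \<le> norm (Y h i \<omega>)" for i \<omega>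
    using that c_pos by (intro power_le_lyapunov) auto
  then have Y_bounded: "norm (Y h n \<omega>) \<le> c" if "\<omega> \<in> below ?V ?\<Lambda> n" for n \<omega>
    using that by (force simp: below_def not_less[symmetric])
  note step = lyapunov_supermartingale[OF h_bounds k_ge_1 below_lyapunov_Y_F[OF h_bounds(1)] Y_bounded]
  have "?\<Lambda> * prob {\<omega>\<in>space M. \<exists>i\<le>n. ?\<Lambda> \<le> ?V i \<omega>} \<le> (1 + ?r * h) ^ n * expectation (?V 0)"
    by (rule maximal_inequality[OF V_measurable _ _ rate_nonneg _ step]) (use c_pos in simp_all)
  then have "prob {\<omega>\<in>space M. \<exists>i\<le>n. ?\<Lambda> \<le> ?V i \<omega>} \<le> (1 + ?r * h) ^ n * lyapunov k x0 / ?\<Lambda>"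
    using c_pos by (simp add: prob_space pos_le_divide_eq mult.commute)
  moreover have "prob {\<omega>\<in>space M. \<exists>i\<le>n. c < norm (Y h i \<omega>)} \<le> prob {\<omega>\<in>space M. \<exists>i\<le>n. ?\<Lambda> \<le> ?V i \<omega>}"
  proof (rule finite_measure_mono)
    show "{\<omega>\<in>space M. \<exists>i\<le>n. c < norm (Y h i \<omega>)} \<subseteq> {\<omega>\<in>space M. \<exists>i\<le>n. ?\<Lambda> \<le> ?V i \<omega>}"
      using exceeds by (blast intro: less_imp_le)
  qed measurable
  ultimately show ?thesis by linarith
qed

lemma grid_tail:
  assumes k_ge_1: "1 \<le> k"
  obtains C where "C \<ge> 0" "\<And>h n c. \<lbrakk>0 < h; h \<le> 1; real n * h \<le> T; c > 0\<rbrakk> \<Longrightarrow>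
      prob {\<omega>\<in>space M. \<exists>i\<le>n. c < norm (Y h i \<omega>)} \<le> C / c ^ (2 * k)"
proof (rule that)
  let ?r = "growth_rate k * moment_bound (k + 2)"
  have "?r \<ge> 0"
    by (intro mult_nonneg_nonneg growth_rate_nonneg moment_bound_nonneg)
  then have "(1 + ?r * h) ^ n * lyapunov k x0 / c ^ (2 * k) \<le> exp (?r * T) * lyapunov k x0 / c ^ (2 * k)"
    if "0 < h" "real n * h \<le> T" "c > 0" for h n c
    using that by (intro divide_right_mono mult_right_mono one_plus_power_le_exp) auto
  then show "prob {\<omega>\<in>space M. \<exists>i\<le>n. c < norm (Y h i \<omega>)} \<le> exp (?r * T) * lyapunov k x0 / c ^ (2 * k)"
    if "0 < h" "h \<le> 1" "real n * h \<le> T" "c > 0" for h n c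
    using that by (intro order_trans[OF prob_norm_Y_exceeds_le[OF _ _ k_ge_1]]) auto
qed simp

end

section \<open>Convergence in probability on the grid\<close>

subsection \<open>Refining the grid\<close>

lemma div_eq_if_in_block: "i \<in> {k * m..<k * m + m} \<Longrightarrow> i div m = k" for i k m :: nat
  by (intro div_nat_eqI) (auto simp: mult.commute)

lemma sum_div_const:
  fixes a :: "nat \<Rightarrow> real"
  shows "(\<Sum>i<l * m. a (i div m)) = real m * (\<Sum>k<l. a k)"
proof -
  have "(\<Sum>i<l * m. a (i div m)) = (\<Sum>k<l. \<Sum>i=k * m..<k * m + m. a (i div m))"
    by (rule sum.nat_group[symmetric])
  also have "\<dots> = (\<Sum>k<l. real m * a k)"
    by (intro sum.cong) (simp_all add: div_eq_if_in_block)
  finally show ?thesis by (simp add: sum_distrib_left)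
qed

lemma coarse_grid_le_fine_grid:
  assumes "h > 0" "m > 0"
  shows "real (i div m) * h \<le> real i * (h / real m)"
    and "real i * (h / real m) \<le> real (i div m) * h + h"
proof -
  have "i div m * m \<le> i" "i \<le> i div m * m + m"
    using div_mult_mod_eq[of i m] mod_less_divisor[of m i] assms(2) by linarith+
  then have "real (i div m) * real m \<le> real i" "real i \<le> real (i div m) * real m + real m"
    by (simp_all only: of_nat_mult[symmetric] of_nat_add[symmetric] of_nat_le_iff)
  from mult_right_mono[OF this(1), of "h / real m"] mult_right_mono[OF this(2), of "h / real m"]
  show "real (i div m) * h \<le> real i * (h / real m)" "real i * (h / real m) \<le> real (i div m) * h + h"
    using assms by (simp_all add: distrib_right add_divide_distrib)
qed

lemma (in wiener) sum_increment_refine: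
  assumes "m > 0"
  shows "(\<Sum>i=k * m..<k * m + m. grid_increment (h / real m) i \<omega>) = grid_increment h k \<omega>"
proof -
  let ?w = "\<lambda>i. W (real i * (h / real m)) \<omega>"
  have "(\<Sum>i=k * m..<k * m + m. grid_increment (h / real m) i \<omega>) =
      (\<Sum>i=k * m..<k * m + m. ?w (Suc i) - ?w i)"
    by (simp only: increment_def real_Suc_mult)
  also have "\<dots> = ?w (k * m + m) - ?w (k * m)"
    by (rule sum_Suc_diff') simp
  also have "real (k * m + m) * (h / real m) = real k * h + h"
    using assms by (simp add: field_simps)
  also have "real (k * m) * (h / real m) = real k * h"
    using assms by simp
  finally show ?thesis by (simp only: increment_def)
qed

lemma (in euler_scheme) Y_refine:
  assumes m_pos: "m > 0"
  shows "Y h l \<omega> = x0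
     + (\<Sum>i<l * m. \<sigma> (Y h (i div m) \<omega>) *v grid_increment (h / real m) i \<omega>)
     + (\<Sum>i<l * m. (h / real m) *\<^sub>R b (Y h (i div m) \<omega>))
     + (\<Sum>k<l. h *\<^sub>R \<eta> h (Y h k \<omega>) (grid_increment h k \<omega>))"
proof -
  let ?dW = "\<lambda>i. grid_increment (h / real m) i \<omega>"
  have "(\<Sum>i<l * m. \<sigma> (Y h (i div m) \<omega>) *v ?dW i) =
      (\<Sum>k<l. \<Sum>i=k * m..<k * m + m. \<sigma> (Y h (i div m) \<omega>) *v ?dW i)"
    by (rule sum.nat_group[symmetric])
  also have "\<dots> = (\<Sum>k<l. \<sigma> (Y h k \<omega>) *v (\<Sum>i=k * m..<k * m + m. ?dW i))"
    by (intro sum.cong) (simp_all add: div_eq_if_in_block linear_sum[OF matrix_vector_mul_linear])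
  finally have noise: "(\<Sum>i<l * m. \<sigma> (Y h (i div m) \<omega>) *v ?dW i) =
      (\<Sum>k<l. \<sigma> (Y h k \<omega>) *v grid_increment h k \<omega>)"
    unfolding sum_increment_refine[OF m_pos] .
  have "(\<Sum>i<l * m. (h / real m) *\<^sub>R b (Y h (i div m) \<omega>)) =
      (\<Sum>k<l. \<Sum>i=k * m..<k * m + m. (h / real m) *\<^sub>R b (Y h (i div m) \<omega>))"
    by (rule sum.nat_group[symmetric])
  also have "\<dots> = (\<Sum>k<l. h *\<^sub>R b (Y h k \<omega>))"
    using m_pos
    by (intro sum.cong) (simp_all add: div_eq_if_in_block sum_constant_scaleR del: sum_constant)
  finally have drift: "(\<Sum>i<l * m. (h / real m) *\<^sub>R b (Y h (i div m) \<omega>)) = (\<Sum>k<l. h *\<^sub>R b (Y h k \<omega>))" .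
  have "Y h l \<omega> - x0 = (\<Sum>k<l. Y h (Suc k) \<omega> - Y h k \<omega>)"
    using sum_lessThan_telescope[of "\<lambda>k. Y h k \<omega>" l] by simp
  then show ?thesis
    unfolding noise drift by (simp add: Y_Suc sum.distrib algebra_simps)
qed

subsection \<open>The residual of the solution\<close>

locale sde_euler = euler_scheme M F W b \<sigma> \<eta> x0 K1 K2 \<alpha>
  for M :: "'a measure" and F :: "real \<Rightarrow> 'a measure" and W :: "real \<Rightarrow> 'a \<Rightarrow> real ^ 'd"
    and b :: "real ^ 'm \<Rightarrow> real ^ 'm" and \<sigma> :: "real ^ 'm \<Rightarrow> real ^ 'd ^ 'm"
    and \<eta> :: "real \<Rightarrow> real ^ 'm \<Rightarrow> real ^ 'd \<Rightarrow> real ^ 'm"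
    and x0 :: "real ^ 'm" and K1 K2 :: real and \<alpha> :: ereal +
  fixes X :: "real \<Rightarrow> 'a \<Rightarrow> real ^ 'm"
  assumes solution: "sde_solution M F W b \<sigma> x0 X"
begin

abbreviation X_grid :: "real \<Rightarrow> nat \<Rightarrow> 'a \<Rightarrow> real ^ 'm" where
  "X_grid h n \<equiv> X (real n * h)"

lemma X_F: "t \<ge> 0 \<Longrightarrow> X t \<in> borel_measurable (F t)"
  using solution unfolding sde_solution_def by blast

sublocale continuous_process M X
  using solution measurable_F_imp_measurable[OF _ X_F]
  by unfold_locales (auto simp: sde_solution_def)

lemma random_variable_X: "t \<ge> 0 \<Longrightarrow> random_variable borel (X t)"
  by (rule process_measurable)

lemma continuous_on_b_X: "\<omega> \<in> space M \<Longrightarrow> continuous_on {0..t} (\<lambda>s. b (X s \<omega>))"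
  by (rule continuous_on_compose2[OF continuous_b process_continuous_on]) auto

lemma random_variable_integral_b_X:
  assumes t_nonneg: "t \<ge> 0"
  shows "random_variable borel (\<lambda>\<omega>. integral {0..t} (\<lambda>s. b (X s \<omega>)))"
proof (rule borel_measurable_LIMSEQ_metric)
  have [measurable]: "random_variable borel (X_grid (t / real n) i)" for i n
    using t_nonneg by (intro random_variable_X) auto
  show "random_variable borel (\<lambda>\<omega>. \<Sum>i<n. (t / real n) *\<^sub>R b (X_grid (t / real n) i \<omega>))" for n
    by measurable
  show "(\<lambda>n. \<Sum>i<n. (t / real n) *\<^sub>R b (X_grid (t / real n) i \<omega>)) \<longlonglongrightarrow> integral {0..t} (\<lambda>s. b (X s \<omega>))"
    if "\<omega> \<in> space M" for \<omega>
    by (rule riemann_sum_tendsto[OF t_nonneg continuous_on_b_X[OF that]])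
qed

definition drift_error :: "real \<Rightarrow> nat \<Rightarrow> 'a \<Rightarrow> real ^ 'm" where
  "drift_error t n \<omega> = integral {0..t} (\<lambda>s. b (X s \<omega>)) - (\<Sum>i<n. (t / real n) *\<^sub>R b (X_grid (t / real n) i \<omega>))"

definition ito_error :: "real \<Rightarrow> nat \<Rightarrow> 'a \<Rightarrow> real ^ 'm" where
  "ito_error t n \<omega> = X t \<omega> - x0 - integral {0..t} (\<lambda>s. b (X s \<omega>))
     - (\<Sum>i<n. \<sigma> (X_grid (t / real n) i \<omega>) *v grid_increment (t / real n) i \<omega>)"

lemma drift_error_vanishes:
  assumes t_nonneg: "t \<ge> 0"
  shows "vanishes_in_prob sequentially (\<lambda>n \<omega>. norm (drift_error t n \<omega>))"
proof (rule pointwise_imp_vanishes_in_prob)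
  have [measurable]: "random_variable borel (X_grid (t / real n) i)" for i n
    using t_nonneg by (intro random_variable_X) auto
  note [measurable] = random_variable_integral_b_X[OF t_nonneg]
  show "random_variable borel (\<lambda>\<omega>. norm (drift_error t n \<omega>))" for n
    unfolding drift_error_def by measurable
  fix \<omega> assume "\<omega> \<in> space M"
  from tendsto_diff[OF tendsto_const riemann_sum_tendsto[OF t_nonneg continuous_on_b_X[OF this]],
      of "integral {0..t} (\<lambda>s. b (X s \<omega>))"]
  show "(\<lambda>n. norm (drift_error t n \<omega>)) \<longlonglongrightarrow> 0"
    unfolding drift_error_def by (intro tendsto_norm_zero) simp
qed

text \<open>Without measurability the defining property of a solution would be void, because \<open>measure\<close> is
  \<open>0\<close> on sets that are not measurable.\<close>

lemma ito_error_vanishes: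
  assumes t_nonneg: "t \<ge> 0"
  shows "vanishes_in_prob sequentially (\<lambda>n \<omega>. norm (ito_error t n \<omega>))"
  unfolding vanishes_in_prob_def
proof (intro conjI allI impI always_eventually)
  have [measurable]: "random_variable borel (X_grid (t / real n) i)"
      "random_variable borel (grid_increment (t / real n) i)" for i n
    using t_nonneg by (auto intro: random_variable_X random_variable_increment)
  note [measurable] = random_variable_integral_b_X[OF t_nonneg] random_variable_X[OF t_nonneg]
  show "random_variable borel (\<lambda>\<omega>. norm (ito_error t n \<omega>))" for n
    unfolding ito_error_def by measurable
  have "norm (ito_error t n \<omega>) = norm (X t \<omega> - x0 - integral {0..t} (\<lambda>s. b (X s \<omega>))
      - (\<Sum>i<n. \<sigma> (X (real i * t / real n) \<omega>)
        *v (W (real (Suc i) * t / real n) \<omega> - W (real i * t / real n) \<omega>)))"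
    for n \<omega>
    by (simp only: ito_error_def increment_def real_Suc_mult[symmetric], simp only: times_divide_eq_right)
  then show "(\<lambda>n. prob {\<omega>\<in>space M. \<epsilon> < norm (ito_error t n \<omega>)}) \<longlonglongrightarrow> 0" if "\<epsilon> > 0" for \<epsilon>
    using solution t_nonneg that unfolding sde_solution_def by simp
qed

text \<open>Partitioning \<open>[0, l * h]\<close> into \<open>l * m\<close> pieces gives the mesh \<open>h / m\<close> whatever \<open>l\<close> is, so the
  Riemann sums that define the solution at the different grid points are partial sums of each
  other.\<close>

definition residual :: "real \<Rightarrow> nat \<Rightarrow> nat \<Rightarrow> 'a \<Rightarrow> real ^ 'm" where
  "residual h l m \<omega> = X_grid h l \<omega> - x0
     - (\<Sum>i<l * m. \<sigma> (X_grid (h / real m) i \<omega>) *v grid_increment (h / real m) i \<omega>)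
     - (\<Sum>i<l * m. (h / real m) *\<^sub>R b (X_grid (h / real m) i \<omega>))"

lemma random_variable_residual:
  assumes "h > 0"
  shows "random_variable borel (residual h l m)"
proof -
  have [measurable]: "random_variable borel (X_grid (h / real m) i)" "random_variable borel (X_grid h l)"
      "random_variable borel (grid_increment (h / real m) i)" for i
    using assms by (auto intro: random_variable_X random_variable_increment)
  show ?thesis
    unfolding residual_def[abs_def] by measurable
qed

lemma residual_vanishes:
  assumes h_pos: "h > 0"
  shows "vanishes_in_prob sequentially (\<lambda>m \<omega>. norm (residual h l m \<omega>))"
proof (cases "l = 0")
  case True
  have "residual h 0 m \<omega> = ito_error 0 m \<omega>" for m \<omega>
    by (simp add: residual_def ito_error_def increment_def)
  then show ?thesis
    using ito_error_vanishes[of 0] True by simp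
next
  case False
  let ?t = "real l * h"
  have mesh_eq: "?t / real (l * m) = h / real m" for m
    using False by simp
  have residual_eq: "residual h l m \<omega> = ito_error ?t (l * m) \<omega> + drift_error ?t (l * m) \<omega>" for m \<omega>
    unfolding residual_def ito_error_def drift_error_def mesh_eq by simp
  have refine: "filterlim (\<lambda>m. l * m) sequentially sequentially"
    using False by (intro filterlim_subseq) (simp add: strict_mono_def)
  have t_nonneg: "?t \<ge> 0"
    using h_pos by simp
  show ?thesis
  proof (rule vanishes_in_prob_le_add)
    show "vanishes_in_prob sequentially (\<lambda>m \<omega>. norm (ito_error ?t (l * m) \<omega>))"
      by (rule vanishes_in_prob_compose[OF ito_error_vanishes[OF t_nonneg] refine])
    show "vanishes_in_prob sequentially (\<lambda>m \<omega>. norm (drift_error ?t (l * m) \<omega>))"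
      by (rule vanishes_in_prob_compose[OF drift_error_vanishes[OF t_nonneg] refine])
    show "\<forall>\<^sub>F m in sequentially. random_variable borel (\<lambda>\<omega>. norm (residual h l m \<omega>))"
      using random_variable_residual[OF h_pos] by (intro always_eventually allI) measurable
  qed (simp add: residual_eq norm_triangle_ineq)
qed

subsection \<open>The grid error\<close>

definition grid_error :: "real \<Rightarrow> real \<Rightarrow> 'a \<Rightarrow> real" where
  "grid_error T h \<omega> = (MAX k\<in>{..nat \<lfloor>T / h\<rfloor>}. norm (X_grid h k \<omega> - Y h k \<omega>))"

lemma random_variable_grid_error:
  assumes "h > 0"
  shows "random_variable borel (grid_error T h)"
proof -
  have [measurable]: "random_variable borel (X_grid h k)" "random_variable borel (Y h k)" for k
    using assms by (auto intro: random_variable_X random_variable_Y)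
  show ?thesis
    unfolding grid_error_def[abs_def] by measurable
qed

lemma less_grid_error_iff: "c < grid_error T h \<omega> \<longleftrightarrow> (\<exists>k\<le>nat \<lfloor>T / h\<rfloor>. c < norm (X_grid h k \<omega> - Y h k \<omega>))"
  unfolding grid_error_def by (subst Max_gr_iff) auto

lemma norm_le_grid_error: "k \<le> nat \<lfloor>T / h\<rfloor> \<Longrightarrow> norm (X_grid h k \<omega> - Y h k \<omega>) \<le> grid_error T h \<omega>"
  unfolding grid_error_def by (rule Max_ge) auto

text \<open>\<open>error_bound\<close> below controls the probability that the grid error exceeds a threshold while \<open>X\<close>
  stays in the ball of radius \<open>R\<close>, on which \<open>K\<close> is a Lipschitz constant of the coefficients.\<close>

definition modulus :: "real \<Rightarrow> real \<Rightarrow> real \<Rightarrow> real" where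
  "modulus T R h = mean_square M (\<lambda>\<omega>. min (oscillation T h \<omega>) (2 * (R + 1)))"

definition perturbation_bound :: "real \<Rightarrow> real \<Rightarrow> real" where
  "perturbation_bound R h = 2 * K2\<^sup>2 * ((hpow h \<alpha> * (R + 1))\<^sup>2 + real CARD('d) * h)"

definition gronwall_rate :: "real \<Rightarrow> real \<Rightarrow> real" where
  "gronwall_rate T K = 16 * K\<^sup>2 * (real CARD('d) + T)"

definition error_bound :: "real \<Rightarrow> real \<Rightarrow> real \<Rightarrow> real \<Rightarrow> real" where
  "error_bound T R K h = (gronwall_rate T K * T * modulus T R h + 4 * T\<^sup>2 * perturbation_bound R h)
     * exp (gronwall_rate T K * T)"

lemma modulus_nonneg: "modulus T R h \<ge> 0"
  by (simp add: modulus_def)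

lemma perturbation_bound_nonneg: "h \<ge> 0 \<Longrightarrow> perturbation_bound R h \<ge> 0"
  by (simp add: perturbation_bound_def)

lemma error_bound_tendsto_0:
  assumes T_nonneg: "T \<ge> 0" and R_nonneg: "R \<ge> 0"
  shows "(error_bound T R K \<longlongrightarrow> 0) (at_right 0)"
proof -
  have "(modulus T R \<longlongrightarrow> 0) (at_right 0)"
    unfolding modulus_def[abs_def] using R_nonneg
    by (intro truncated_oscillation_tendsto_0 T_nonneg) simp
  moreover have "(perturbation_bound R \<longlongrightarrow> 2 * K2\<^sup>2 * ((0 * (R + 1))\<^sup>2 + real CARD('d) * 0)) (at_right 0)"
    unfolding perturbation_bound_def[abs_def] by (intro tendsto_intros hpow_tendsto_0)
  ultimately have "(error_bound T R K \<longlongrightarrow>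
      (gronwall_rate T K * T * 0 + 4 * T\<^sup>2 * (2 * K2\<^sup>2 * ((0 * (R + 1))\<^sup>2 + real CARD('d) * 0)))
        * exp (gronwall_rate T K * T)) (at_right 0)"
    unfolding error_bound_def[abs_def] by (intro tendsto_intros)
  then show ?thesis by simp
qed

end

subsection \<open>Stopping when the paths separate\<close>

locale coupling = sde_euler M F W b \<sigma> \<eta> x0 K1 K2 \<alpha> X
  for M :: "'a measure" and F :: "real \<Rightarrow> 'a measure" and W :: "real \<Rightarrow> 'a \<Rightarrow> real ^ 'd"
    and b :: "real ^ 'm \<Rightarrow> real ^ 'm" and \<sigma> :: "real ^ 'm \<Rightarrow> real ^ 'd ^ 'm"
    and \<eta> :: "real \<Rightarrow> real ^ 'm \<Rightarrow> real ^ 'd \<Rightarrow> real ^ 'm"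
    and x0 :: "real ^ 'm" and K1 K2 :: real and \<alpha> :: ereal
    and X :: "real \<Rightarrow> 'a \<Rightarrow> real ^ 'm" +
  fixes h T R \<epsilon> K :: real
  assumes h_pos: "0 < h" and T_nonneg: "0 \<le> T" and R_nonneg: "0 \<le> R" and \<epsilon>_pos: "0 < \<epsilon>" and \<epsilon>_le_1: "\<epsilon> \<le> 1"
    and lipschitz_b: "K-lipschitz_on (cball 0 (R + 1)) b"
    and lipschitz_\<sigma>: "K-lipschitz_on (cball 0 (R + 1)) \<sigma>"
begin

definition deviation :: "nat \<Rightarrow> 'a \<Rightarrow> real ^ 'm" where
  "deviation k \<omega> = X_grid h k \<omega> - Y h k \<omega>"

definition close :: "nat \<Rightarrow> 'a set" where
  "close k = {\<omega>\<in>space M. running_max (real k * h) \<omega> \<le> R \<and> (\<forall>j\<le>k. norm (deviation j \<omega>) \<le> \<epsilon>)}"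

definition stopped_deviation :: "nat \<Rightarrow> 'a \<Rightarrow> real ^ 'm" where
  "stopped_deviation k \<omega> = indicator (close k) \<omega> *\<^sub>R deviation k \<omega>"

definition proj :: "real ^ 'm \<Rightarrow> real ^ 'm" where
  "proj = closest_point (cball 0 (R + 1))"

text \<open>The coefficients are truncated because a path in \<open>close k\<close> is not under control between the grid
  times \<open>k * h\<close> and \<open>(k + 1) * h\<close>.\<close>

definition coeff_diff :: "(real ^ 'm \<Rightarrow> 'v::real_normed_vector) \<Rightarrow> nat \<Rightarrow> nat \<Rightarrow> 'a \<Rightarrow> 'v" where
  "coeff_diff f m i \<omega> = indicator (close (i div m)) \<omega> *\<^sub>R
     (f (proj (X_grid (h / real m) i \<omega>)) - f (proj (Y h (i div m) \<omega>)))"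

definition perturbation :: "nat \<Rightarrow> 'a \<Rightarrow> real ^ 'm" where
  "perturbation k \<omega> = indicator (close k) \<omega> *\<^sub>R \<eta> h (Y h k \<omega>) (grid_increment h k \<omega>)"

definition stopped_noise :: "nat \<Rightarrow> nat \<Rightarrow> 'a \<Rightarrow> real ^ 'm" where
  "stopped_noise m l \<omega> = (\<Sum>i<l * m. coeff_diff \<sigma> m i \<omega> *v grid_increment (h / real m) i \<omega>)"

definition stopped_drift :: "nat \<Rightarrow> nat \<Rightarrow> 'a \<Rightarrow> real ^ 'm" where
  "stopped_drift m l \<omega> = (\<Sum>i<l * m. (h / real m) *\<^sub>R coeff_diff b m i \<omega>)"

definition stopped_perturbation :: "nat \<Rightarrow> 'a \<Rightarrow> real ^ 'm" where
  "stopped_perturbation l \<omega> = (\<Sum>k<l. h *\<^sub>R perturbation k \<omega>)"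

definition stopped_error :: "nat \<Rightarrow> nat \<Rightarrow> 'a \<Rightarrow> real ^ 'm" where
  "stopped_error m l \<omega> = stopped_noise m l \<omega> + stopped_drift m l \<omega> - stopped_perturbation l \<omega>"

text \<open>\<open>coeff_energy\<close> bounds the time integral of the mean squares of \<open>coeff_diff\<close>, up to the factor
  \<open>2 * K\<^sup>2\<close>.\<close>

definition coeff_energy :: "nat \<Rightarrow> real" where
  "coeff_energy l = T * modulus T R h + h * (\<Sum>k<l. mean_square M (stopped_deviation k))"

lemma K_nonneg: "K \<ge> 0"
  using lipschitz_b by (rule lipschitz_on_nonneg)

lemma grid_times_le: "l \<le> N \<Longrightarrow> real N * h \<le> T \<Longrightarrow> real l * h \<le> T"
  using h_pos by (meson mult_right_mono of_nat_le_iff order_trans less_imp_le)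

lemma random_variable_deviation: "random_variable borel (deviation k)"
  unfolding deviation_def[abs_def]
  using h_pos by (intro borel_measurable_diff random_variable_X random_variable_Y) auto

lemma close_F: "close k \<in> sets (F (real k * h))"
proof -
  let ?N = "F (real k * h)"
  have time_nonneg: "0 \<le> real k * h"
    using h_pos by simp
  have "running_max (real k * h) \<in> borel_measurable ?N"
    using time_nonneg by (intro borel_measurable_running_max) (auto intro: measurable_F_mono[OF _ _ X_F])
  then have "{\<omega>\<in>space ?N. running_max (real k * h) \<omega> \<le> R} \<in> sets ?N"
    by measurable
  moreover have "{\<omega>\<in>space ?N. \<forall>j\<in>{..k}. norm (deviation j \<omega>) \<le> \<epsilon>} \<in> sets ?N"
  proof (rule sets.sets_Collect_finite_All')
    fix j assume "j \<in> {..k}"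
    then have time_order: "0 \<le> real j * h" "real j * h \<le> real k * h"
      using h_pos by (auto intro: mult_right_mono)
    have [measurable]: "X_grid h j \<in> borel_measurable ?N" "Y h j \<in> borel_measurable ?N"
      by (rule measurable_F_mono[OF time_order X_F[OF time_order(1)]],
        rule measurable_F_mono[OF time_order Y_F[OF h_pos]])
    show "{\<omega>\<in>space ?N. norm (deviation j \<omega>) \<le> \<epsilon>} \<in> sets ?N"
      unfolding deviation_def by measurable
  qed auto
  moreover have "close k = {\<omega>\<in>space ?N. running_max (real k * h) \<omega> \<le> R} \<inter>
      {\<omega>\<in>space ?N. \<forall>j\<in>{..k}. norm (deviation j \<omega>) \<le> \<epsilon>}"
    using time_nonneg by (auto simp: close_def)
  ultimately show ?thesis
    by (simp only: sets.Int)
qed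

lemma close_event [measurable]: "close k \<in> events"
  using sets_F_imp_events[OF _ close_F] h_pos by simp

lemma close_antimono:
  assumes "j \<le> k"
  shows "close k \<subseteq> close j"
proof -
  have "0 \<le> real j * h" "real j * h \<le> real k * h"
    using assms h_pos by (auto intro: mult_right_mono)
  then show ?thesis
    using assms running_max_mono unfolding close_def by (blast intro: order_trans)
qed

lemma norm_deviation_le: "\<omega> \<in> close k \<Longrightarrow> norm (deviation k \<omega>) \<le> \<epsilon>"
  by (simp add: close_def)

lemma norm_X_le_if_close: "\<omega> \<in> close k \<Longrightarrow> norm (X_grid h k \<omega>) \<le> R"
  using norm_le_running_max[of \<omega> "real k * h" "real k * h"] h_pos by (auto simp: close_def)

lemma norm_Y_le_if_close:
  assumes "\<omega> \<in> close k"
  shows "norm (Y h k \<omega>) \<le> R + 1"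
  using norm_triangle_ineq4[of "X_grid h k \<omega>" "deviation k \<omega>"]
    norm_X_le_if_close[OF assms] norm_deviation_le[OF assms] \<epsilon>_le_1
  by (simp add: deviation_def)

lemma norm_stopped_deviation_le: "norm (stopped_deviation k \<omega>) \<le> 1"
  using norm_deviation_le[of \<omega> k] \<epsilon>_le_1 by (cases "\<omega> \<in> close k") (auto simp: stopped_deviation_def)

lemma square_integrable_stopped_deviation: "square_integrable M (stopped_deviation k)"
proof (rule square_integrable_const_bound[OF _ norm_stopped_deviation_le])
  note [measurable] = random_variable_deviation
  show "random_variable borel (stopped_deviation k)"
    unfolding stopped_deviation_def[abs_def] by measurable
qed

subsection \<open>Mean-square bounds for the stopped error\<close>

lemma norm_proj_le: "norm (proj x) \<le> R + 1"
  using closest_point_in_set[of "cball 0 (R + 1)" x] R_nonneg by (simp add: proj_def)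

lemma proj_id: "norm x \<le> R + 1 \<Longrightarrow> proj x = x"
  unfolding proj_def by (rule closest_point_self) simp

lemma norm_proj_diff_le: "norm (proj x - proj y) \<le> norm (x - y)"
  using closest_point_lipschitz[of "cball 0 (R + 1)" x y] R_nonneg by (simp add: proj_def dist_norm)

lemma borel_measurable_proj [measurable]: "proj \<in> borel_measurable borel"
  unfolding proj_def using R_nonneg
  by (intro borel_measurable_continuous_onI continuous_on_closest_point) auto

context
  fixes f :: "real ^ 'm \<Rightarrow> 'v::{real_normed_vector,second_countable_topology}" and m :: nat
  assumes f_lipschitz: "K-lipschitz_on (cball 0 (R + 1)) f"
    and f_measurable [measurable]: "f \<in> borel_measurable borel" and m_pos: "m > 0"
begin

lemma coeff_diff_F: "coeff_diff f m i \<in> borel_measurable (F (real i * (h / real m)))"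
proof -
  let ?N = "F (real i * (h / real m))"
  note fine = coarse_grid_le_fine_grid(1)[OF h_pos m_pos, of i]
  have nonneg: "0 \<le> real (i div m) * h" "0 \<le> real i * (h / real m)"
    using h_pos by auto
  have [measurable]: "X_grid (h / real m) i \<in> borel_measurable ?N"
    by (rule X_F[OF nonneg(2)])
  have [measurable]: "Y h (i div m) \<in> borel_measurable ?N"
    by (rule measurable_F_mono[OF nonneg(1) fine Y_F[OF h_pos]])
  have [measurable]: "close (i div m) \<in> sets ?N"
    using sets_F_mono[OF nonneg(1) fine] close_F by blast
  show ?thesis
    unfolding coeff_diff_def[abs_def] by measurable
qed

lemma norm_coeff_diff_le:
  shows "norm (coeff_diff f m i \<omega>) \<le>
    K * norm (indicator (close (i div m)) \<omega> *\<^sub>R (proj (X_grid (h / real m) i \<omega>) - proj (Y h (i div m) \<omega>)))"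
proof -
  have "norm (f (proj x) - f (proj y)) \<le> K * norm (proj x - proj y)" for x y
    using lipschitz_onD[OF f_lipschitz, of "proj x" "proj y"] norm_proj_le by (simp add: dist_norm)
  then show ?thesis
    by (cases "\<omega> \<in> close (i div m)") (simp_all add: coeff_diff_def)
qed

lemma norm_coeff_diff_le_const: "norm (coeff_diff f m i \<omega>) \<le> K * (2 * (R + 1))"
proof -
  have "norm (proj x - proj y) \<le> 2 * (R + 1)" for x y
    using norm_triangle_ineq4[of "proj x" "proj y"] norm_proj_le[of x] norm_proj_le[of y] by simp
  then have "norm (indicator A \<omega> *\<^sub>R (proj x - proj y)) \<le> 2 * (R + 1)" for A and x y :: "real ^ 'm"
    using R_nonneg by (auto simp: indicator_def)
  then show ?thesis
    by (rule order_trans[OF norm_coeff_diff_le mult_left_mono[OF _ K_nonneg]])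
qed

lemma square_integrable_coeff_diff: "square_integrable M (coeff_diff f m i)"
  using h_pos
  by (intro square_integrable_const_bound[OF measurable_F_imp_measurable[OF _ coeff_diff_F]
    norm_coeff_diff_le_const]) simp

lemma norm_coeff_diff_square_le:
  assumes \<omega>_in_space: "\<omega> \<in> space M" and fine_time_le: "real i * (h / real m) \<le> T"
  shows "(norm (coeff_diff f m i \<omega>))\<^sup>2 \<le> 2 * K\<^sup>2 *
    ((norm (min (oscillation T h \<omega>) (2 * (R + 1))))\<^sup>2 + (norm (stopped_deviation (i div m) \<omega>))\<^sup>2)"
proof -
  define s where "s = real i * (h / real m)"
  define k where "k = i div m"
  define osc where "osc = min (oscillation T h \<omega>) (2 * (R + 1))"
  have times: "real k * h \<in> {0..T}" "s \<in> {0..T}" "\<bar>s - real k * h\<bar> \<le> h"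
    using coarse_grid_le_fine_grid[OF h_pos m_pos, of i] fine_time_le h_pos by (auto simp: s_def k_def)
  have "norm (X s \<omega> - X_grid h k \<omega>) \<le> oscillation T h \<omega>"
    by (rule norm_diff_le_oscillation[OF \<omega>_in_space times(2,1,3)])
  then have "norm (proj (X s \<omega>) - proj (X_grid h k \<omega>)) \<le> oscillation T h \<omega>"
    by (rule order_trans[OF norm_proj_diff_le])
  moreover have "norm (proj (X s \<omega>) - proj (X_grid h k \<omega>)) \<le> 2 * (R + 1)"
    using norm_triangle_ineq4 norm_proj_le by (smt (verit))
  ultimately have proj_diff_le: "norm (proj (X s \<omega>) - proj (X_grid h k \<omega>)) \<le> osc"
    by (simp add: osc_def)
  let ?D = "indicator (close k) \<omega> *\<^sub>R (proj (X s \<omega>) - proj (Y h k \<omega>))"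
  have "norm ?D \<le> osc + norm (stopped_deviation k \<omega>)"
  proof (cases "\<omega> \<in> close k")
    case True
    have "norm (proj (X s \<omega>) - proj (Y h k \<omega>)) \<le>
        norm (proj (X s \<omega>) - proj (X_grid h k \<omega>)) + norm (proj (X_grid h k \<omega>) - proj (Y h k \<omega>))"
      using norm_triangle_ineq[of "proj (X s \<omega>) - proj (X_grid h k \<omega>)" "proj (X_grid h k \<omega>) - proj (Y h k \<omega>)"]
      by simp
    also have "\<dots> \<le> osc + norm (deviation k \<omega>)"
      unfolding deviation_def by (intro add_mono proj_diff_le norm_proj_diff_le)
    finally show ?thesis using True by (simp add: stopped_deviation_def)
  next
    case False
    then show ?thesis using order_trans[OF norm_ge_zero proj_diff_le] by (simp add: stopped_deviation_def)
  qed
  then have "norm (coeff_diff f m i \<omega>) \<le> K * (osc + norm (stopped_deviation k \<omega>))"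
    unfolding s_def k_def by (rule order_trans[OF norm_coeff_diff_le mult_left_mono[OF _ K_nonneg]])
  then have "(norm (coeff_diff f m i \<omega>))\<^sup>2 \<le> K\<^sup>2 * (osc + norm (stopped_deviation k \<omega>))\<^sup>2"
    unfolding power_mult_distrib[symmetric] by (rule power_mono) simp
  also have "\<dots> \<le> K\<^sup>2 * (2 * osc\<^sup>2 + 2 * (norm (stopped_deviation k \<omega>))\<^sup>2)"
    using norm_add_square_le[of osc "norm (stopped_deviation k \<omega>)"] by (intro mult_left_mono) auto
  finally show ?thesis
    by (simp add: osc_def k_def algebra_simps)
qed

lemma mean_square_coeff_diff_le:
  assumes fine_time_le: "real i * (h / real m) \<le> T"
  shows "mean_square M (coeff_diff f m i) \<le>
    2 * K\<^sup>2 * (modulus T R h + mean_square M (stopped_deviation (i div m)))"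
proof -
  let ?osc = "\<lambda>\<omega>. min (oscillation T h \<omega>) (2 * (R + 1))"
  note [measurable] = random_variable_oscillation[OF T_nonneg less_imp_le[OF h_pos]]
  have "square_integrable M ?osc"
  proof (rule square_integrable_const_bound)
    show "norm (?osc \<omega>) \<le> 2 * (R + 1)" if "\<omega> \<in> space M" for \<omega>
      using oscillation_nonneg[OF that T_nonneg less_imp_le[OF h_pos]] R_nonneg by simp
  qed measurable
  note sq = square_integrableD[OF this]
    square_integrableD[OF square_integrable_stopped_deviation[of "i div m"]]
  have "mean_square M (coeff_diff f m i) \<le>
      (\<integral>\<omega>. 2 * K\<^sup>2 * ((norm (?osc \<omega>))\<^sup>2 + (norm (stopped_deviation (i div m) \<omega>))\<^sup>2) \<partial>M)"
    using sq
    by (intro mean_square_le_integral norm_coeff_diff_square_le fine_time_le square_integrable_measurable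
        square_integrable_coeff_diff integrable_mult_right Bochner_Integration.integrable_add)
  also have "\<dots> = 2 * K\<^sup>2 * (modulus T R h + mean_square M (stopped_deviation (i div m)))"
    using sq by (simp add: modulus_def mean_square_def)
  finally show ?thesis .
qed

lemma sum_mean_square_coeff_diff_le:
  assumes l_time_le: "real l * h \<le> T"
  shows "(h / real m) * (\<Sum>i<l * m. mean_square M (coeff_diff f m i)) \<le>
    2 * K\<^sup>2 * coeff_energy l"
proof -
  have fine_time_le: "real i * (h / real m) \<le> T" if "i < l * m" for i
  proof -
    have "real i * (h / real m) \<le> real (l * m) * (h / real m)"
      using that h_pos by (intro mult_right_mono) (auto simp del: of_nat_mult)
    then show ?thesis using l_time_le m_pos by simp
  qed
  have "(\<Sum>i<l * m. mean_square M (coeff_diff f m i)) \<le>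
      (\<Sum>i<l * m. 2 * K\<^sup>2 * (modulus T R h + mean_square M (stopped_deviation (i div m))))"
    using fine_time_le by (intro sum_mono mean_square_coeff_diff_le) auto
  also have "\<dots> = real m * (\<Sum>k<l. 2 * K\<^sup>2 * (modulus T R h + mean_square M (stopped_deviation k)))"
    by (rule sum_div_const)
  finally have "(h / real m) * (\<Sum>i<l * m. mean_square M (coeff_diff f m i)) \<le>
      (h / real m) * (real m * (\<Sum>k<l. 2 * K\<^sup>2 * (modulus T R h + mean_square M (stopped_deviation k))))"
    using h_pos by (intro mult_left_mono) auto
  also have "\<dots> = 2 * K\<^sup>2 * ((real l * h) * modulus T R h + h * (\<Sum>k<l. mean_square M (stopped_deviation k)))"
    using m_pos by (simp add: sum_distrib_left[symmetric] sum.distrib algebra_simps)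
  also have "\<dots> \<le> 2 * K\<^sup>2 * coeff_energy l"
    unfolding coeff_energy_def using l_time_le
    by (intro mult_left_mono add_right_mono mult_right_mono modulus_nonneg) auto
  finally show ?thesis .
qed

end

lemma
  shows square_integrable_perturbation: "square_integrable M (perturbation k)"
    and mean_square_perturbation_le: "mean_square M (perturbation k) \<le> perturbation_bound R h"
proof -
  let ?dW = "grid_increment h k"
  have time_nonneg: "0 \<le> real k * h"
    using h_pos by simp
  have [measurable]: "random_variable borel (\<lambda>\<omega>. \<eta> h (Y h k \<omega>) (?dW \<omega>))"
    using time_nonneg h_pos by (intro \<eta>_measurable random_variable_Y random_variable_increment) auto
  have perturbation_measurable: "random_variable borel (perturbation k)"
    unfolding perturbation_def[abs_def] by measurable
  have dW2_integrable: "integrable M (\<lambda>\<omega>. (norm (?dW \<omega>))\<^sup>2)"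
    by (intro square_integrableD square_integrable_increment time_nonneg h_pos)
  have norm_square_le: "(norm (perturbation k \<omega>))\<^sup>2 \<le>
    2 * K2\<^sup>2 * ((hpow h \<alpha> * (R + 1))\<^sup>2 + (norm (?dW \<omega>))\<^sup>2)" for \<omega>
  proof (cases "\<omega> \<in> close k")
    case True
    have "norm (perturbation k \<omega>) \<le> K2 * (hpow h \<alpha> * norm (Y h k \<omega>) + norm (?dW \<omega>))"
      using True \<eta>_bound h_pos by (simp add: perturbation_def)
    also have "\<dots> \<le> K2 * (hpow h \<alpha> * (R + 1) + norm (?dW \<omega>))"
      using norm_Y_le_if_close[OF True] hpow_nonneg K2_nonneg
      by (intro mult_left_mono add_right_mono) auto
    finally have "(norm (perturbation k \<omega>))\<^sup>2 \<le> K2\<^sup>2 * (hpow h \<alpha> * (R + 1) + norm (?dW \<omega>))\<^sup>2"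
      unfolding power_mult_distrib[symmetric] by (rule power_mono) simp
    also have "\<dots> \<le> K2\<^sup>2 * (2 * (hpow h \<alpha> * (R + 1))\<^sup>2 + 2 * (norm (?dW \<omega>))\<^sup>2)"
      using norm_add_square_le[of "hpow h \<alpha> * (R + 1)" "norm (?dW \<omega>)"] by (intro mult_left_mono) auto
    finally show ?thesis by (simp add: algebra_simps)
  qed (simp add: perturbation_def)
  have bound_integrable: "integrable M (\<lambda>\<omega>. 2 * K2\<^sup>2 * ((hpow h \<alpha> * (R + 1))\<^sup>2 + (norm (?dW \<omega>))\<^sup>2))"
    using dW2_integrable by (intro integrable_mult_right Bochner_Integration.integrable_add) auto
  show "square_integrable M (perturbation k)"
    by (rule square_integrable_boundI[OF perturbation_measurable bound_integrable norm_square_le])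
  have "(\<integral>\<omega>. 2 * K2\<^sup>2 * ((hpow h \<alpha> * (R + 1))\<^sup>2 + (norm (?dW \<omega>))\<^sup>2) \<partial>M) = perturbation_bound R h"
    using dW2_integrable mean_square_increment_eq[OF time_nonneg h_pos]
    by (simp add: perturbation_bound_def mean_square_def prob_space)
  then show "mean_square M (perturbation k) \<le> perturbation_bound R h"
    using mean_square_le_integral[OF perturbation_measurable bound_integrable norm_square_le] by simp
qed

lemma
  assumes m_pos: "m > 0" and l_time_le: "real l * h \<le> T"
  shows square_integrable_stopped_noise: "square_integrable M (stopped_noise m l)"
    and mean_square_stopped_noise_le:
      "mean_square M (stopped_noise m l) \<le> real CARD('d) * (2 * K\<^sup>2 * coeff_energy l)"
proof -
  have mesh_pos: "h / real m > 0"
    using h_pos m_pos by simp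
  note \<sigma> = lipschitz_\<sigma> \<sigma>_measurable m_pos
  note ito = mesh_pos coeff_diff_F[OF \<sigma>] norm_coeff_diff_le_const[OF \<sigma>]
  show "square_integrable M (stopped_noise m l)"
    unfolding stopped_noise_def[abs_def] by (rule square_integrable_ito_sum[OF ito])
  have "mean_square M (stopped_noise m l) \<le>
      real CARD('d) * ((h / real m) * (\<Sum>i<l * m. mean_square M (coeff_diff \<sigma> m i)))"
    unfolding stopped_noise_def[abs_def] mult.assoc[symmetric] by (rule mean_square_ito_sum_le[OF ito])
  also have "\<dots> \<le> real CARD('d) * (2 * K\<^sup>2 * coeff_energy l)"
    by (intro mult_left_mono sum_mean_square_coeff_diff_le[OF \<sigma> l_time_le]) simp
  finally show "mean_square M (stopped_noise m l) \<le> real CARD('d) * (2 * K\<^sup>2 * coeff_energy l)" .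
qed

lemma
  assumes m_pos: "m > 0" and l_time_le: "real l * h \<le> T"
  shows square_integrable_stopped_drift: "square_integrable M (stopped_drift m l)"
    and mean_square_stopped_drift_le: "mean_square M (stopped_drift m l) \<le> T * (2 * K\<^sup>2 * coeff_energy l)"
proof -
  have square_integrable_b: "square_integrable M (coeff_diff b m i)" for i
    by (rule square_integrable_coeff_diff[OF lipschitz_b b_measurable m_pos])
  show "square_integrable M (stopped_drift m l)"
    unfolding stopped_drift_def[abs_def]
    by (intro square_integrable_sumI square_integrable_scaleR square_integrable_b)
  have "mean_square M (stopped_drift m l) \<le> T * ((h / real m) * (\<Sum>i<l * m. mean_square M (coeff_diff b m i)))"
    unfolding stopped_drift_def[abs_def]
    using h_pos m_pos l_time_le by (intro mean_square_time_sum_le square_integrable_b) simp_all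
  also have "\<dots> \<le> T * (2 * K\<^sup>2 * coeff_energy l)"
    by (intro mult_left_mono T_nonneg sum_mean_square_coeff_diff_le lipschitz_b b_measurable m_pos l_time_le)
  finally show "mean_square M (stopped_drift m l) \<le> T * (2 * K\<^sup>2 * coeff_energy l)" .
qed

lemma square_integrable_stopped_perturbation: "square_integrable M (stopped_perturbation l)"
  unfolding stopped_perturbation_def[abs_def]
  by (intro square_integrable_sumI square_integrable_scaleR square_integrable_perturbation)

lemma mean_square_stopped_perturbation_le:
  assumes l_time_le: "real l * h \<le> T"
  shows "mean_square M (stopped_perturbation l) \<le> T\<^sup>2 * perturbation_bound R h"
proof -
  have "mean_square M (stopped_perturbation l) \<le> T * (h * (\<Sum>k<l. mean_square M (perturbation k)))"
    unfolding stopped_perturbation_def[abs_def]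
    using h_pos l_time_le by (intro mean_square_time_sum_le square_integrable_perturbation) auto
  also have "\<dots> \<le> T * (h * (\<Sum>k<l. perturbation_bound R h))"
    using T_nonneg h_pos by (intro mult_left_mono sum_mono mean_square_perturbation_le) auto
  also have "\<dots> = T * ((real l * h) * perturbation_bound R h)"
    by simp
  also have "\<dots> \<le> T * (T * perturbation_bound R h)"
    using T_nonneg h_pos l_time_le
    by (intro mult_left_mono mult_right_mono perturbation_bound_nonneg) auto
  finally show ?thesis
    by (simp add: power2_eq_square)
qed

lemma
  assumes m_pos: "m > 0" and l_time_le: "real l * h \<le> T"
  shows square_integrable_stopped_error: "square_integrable M (stopped_error m l)"
    and mean_square_stopped_error_le: "mean_square M (stopped_error m l) \<le>
      8 * K\<^sup>2 * (real CARD('d) + T) * coeff_energy l + 2 * T\<^sup>2 * perturbation_bound R h"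
proof -
  note noise = square_integrable_stopped_noise[OF m_pos l_time_le]
  note drift = square_integrable_stopped_drift[OF m_pos l_time_le]
  note sum = square_integrable_addI[OF noise drift]
  note perturbation = square_integrable_stopped_perturbation[of l]
  show "square_integrable M (stopped_error m l)"
    unfolding stopped_error_def[abs_def] by (rule square_integrable_diffI[OF sum perturbation])
  have "mean_square M (stopped_error m l) \<le>
      2 * (2 * mean_square M (stopped_noise m l) + 2 * mean_square M (stopped_drift m l))
      + 2 * mean_square M (stopped_perturbation l)"
    unfolding stopped_error_def[abs_def]
    by (rule order_trans[OF mean_square_diff_le[OF sum perturbation]
          add_right_mono[OF mult_left_mono[OF mean_square_add_le[OF noise drift]]]]) simp
  also have "\<dots> \<le> 2 * (2 * (real CARD('d) * (2 * K\<^sup>2 * coeff_energy l)) + 2 * (T * (2 * K\<^sup>2 * coeff_energy l)))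
      + 2 * (T\<^sup>2 * perturbation_bound R h)"
    by (intro add_mono mult_left_mono mean_square_stopped_noise_le mean_square_stopped_drift_le
        mean_square_stopped_perturbation_le m_pos l_time_le) simp_all
  finally show "mean_square M (stopped_error m l) \<le>
      8 * K\<^sup>2 * (real CARD('d) + T) * coeff_energy l + 2 * T\<^sup>2 * perturbation_bound R h"
    by (simp add: algebra_simps)
qed

subsection \<open>The exit estimate\<close>

lemma stopped_error_eq:
  assumes m_pos: "m > 0" and close: "\<And>k. k < l \<Longrightarrow> \<omega> \<in> close k"
    and \<omega>_in_space: "\<omega> \<in> space M" and running_max_le_R: "running_max (real l * h) \<omega> \<le> R"
  shows "stopped_error m l \<omega> = deviation l \<omega> - residual h l m \<omega>"
proof -
  let ?X = "\<lambda>i. X_grid (h / real m) i \<omega>" and ?dW = "\<lambda>i. grid_increment (h / real m) i \<omega>"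
  have coeff: "coeff_diff f m i \<omega> = f (?X i) - f (Y h (i div m) \<omega>)" if i_less: "i < l * m"
    for f :: "real^'m \<Rightarrow> 'v::real_normed_vector" and i
  proof -
    have block_less: "i div m < l"
      using i_less m_pos by (simp add: less_mult_imp_div_less)
    have "real i * (h / real m) \<le> real (l * m) * (h / real m)"
      using i_less h_pos by (intro mult_right_mono) (auto simp del: of_nat_mult)
    then have "real i * (h / real m) \<in> {0..real l * h}"
      using h_pos m_pos by simp
    then have "norm (?X i) \<le> R"
      using norm_le_running_max[OF \<omega>_in_space] running_max_le_R by (blast intro: order_trans)
    then show ?thesis
      using close[OF block_less] norm_Y_le_if_close[OF close[OF block_less]]
      by (simp add: coeff_diff_def proj_id)
  qed
  have noise: "stopped_noise m l \<omega> =
      (\<Sum>i<l * m. \<sigma> (?X i) *v ?dW i) - (\<Sum>i<l * m. \<sigma> (Y h (i div m) \<omega>) *v ?dW i)"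
    unfolding stopped_noise_def sum_subtractf[symmetric]
    by (intro sum.cong refl) (simp only: coeff lessThan_iff matrix_vector_mult_diff_rdistrib)
  have drift: "stopped_drift m l \<omega> =
      (\<Sum>i<l * m. (h / real m) *\<^sub>R b (?X i)) - (\<Sum>i<l * m. (h / real m) *\<^sub>R b (Y h (i div m) \<omega>))"
    unfolding stopped_drift_def sum_subtractf[symmetric]
    by (intro sum.cong refl) (simp only: coeff lessThan_iff scaleR_diff_right)
  have perturbation: "stopped_perturbation l \<omega> = (\<Sum>k<l. h *\<^sub>R \<eta> h (Y h k \<omega>) (grid_increment h k \<omega>))"
    unfolding stopped_perturbation_def by (intro sum.cong refl) (simp add: close perturbation_def)
  show ?thesis
    unfolding stopped_error_def noise drift perturbation deviation_def residual_def
    by (subst (3) Y_refine[OF m_pos]) (simp add: algebra_simps)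
qed

lemma stopped_error_frozen:
  assumes "m > 0" "l \<le> N" and not_close: "\<omega> \<notin> close l"
  shows "stopped_error m N \<omega> = stopped_error m l \<omega>"
proof -
  have not_close_after: "\<omega> \<notin> close k" if "l \<le> k" for k
    using close_antimono[OF that] not_close by blast
  have "l \<le> i div m" if "l * m \<le> i" for i
    using div_le_mono[OF that, of m] assms(1) by simp
  then have coeff: "coeff_diff f m i \<omega> = 0" if "i \<in> {..<N * m} - {..<l * m}"
    for i and f :: "real^'m \<Rightarrow> 'v::real_normed_vector"
    using that not_close_after by (simp add: coeff_diff_def)
  have perturbation: "perturbation k \<omega> = 0" if "k \<in> {..<N} - {..<l}" for k
    using that not_close_after by (simp add: perturbation_def)
  have "{..<l * m} \<subseteq> {..<N * m}" "{..<l} \<subseteq> {..<N}"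
    using assms(2) by (auto simp: less_le_trans)
  then show ?thesis
    unfolding stopped_error_def stopped_noise_def stopped_drift_def stopped_perturbation_def
    by (intro arg_cong2[where f="(-)"] arg_cong2[where f="(+)"] sum.mono_neutral_right)
      (auto simp: coeff perturbation)
qed

lemma norm_stopped_deviation_square_le:
  assumes m_pos: "m > 0" and \<omega>_in_space: "\<omega> \<in> space M"
  shows "(norm (stopped_deviation l \<omega>))\<^sup>2 \<le>
    2 * (norm (stopped_error m l \<omega>))\<^sup>2 + 2 * r\<^sup>2 + indicator {\<omega>\<in>space M. r < norm (residual h l m \<omega>)} \<omega>"
proof (cases "\<omega> \<in> close l \<and> norm (residual h l m \<omega>) \<le> r")
  case True
  then have "\<omega> \<in> close k" if "k < l" for k
    using close_antimono[of k l] that by auto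
  moreover have "running_max (real l * h) \<omega> \<le> R"
    using True by (simp add: close_def)
  ultimately have "stopped_error m l \<omega> = deviation l \<omega> - residual h l m \<omega>"
    by (intro stopped_error_eq m_pos \<omega>_in_space)
  then have "stopped_deviation l \<omega> = stopped_error m l \<omega> + residual h l m \<omega>"
    using True by (simp add: stopped_deviation_def)
  moreover have "(norm (residual h l m \<omega>))\<^sup>2 \<le> r\<^sup>2"
    using True by (intro power_mono) auto
  ultimately show ?thesis
    using norm_add_square_le[of "stopped_error m l \<omega>" "residual h l m \<omega>"] True by simp
next
  case False
  then have "(norm (stopped_deviation l \<omega>))\<^sup>2 \<le> indicator {\<omega>\<in>space M. r < norm (residual h l m \<omega>)} \<omega>"
    using norm_stopped_deviation_le[of l \<omega>] \<omega>_in_space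
    by (auto simp: power_le_one stopped_deviation_def not_le)
  then show ?thesis by (simp add: add_increasing)
qed

lemma mean_square_stopped_deviation_le:
  assumes square_integrable: "\<And>m. m > 0 \<Longrightarrow> square_integrable M (stopped_error m l)"
    and error_le: "\<And>m. m > 0 \<Longrightarrow> mean_square M (stopped_error m l) \<le> B"
  shows "mean_square M (stopped_deviation l) \<le> 2 * B"
proof -
  have le_add_square: "mean_square M (stopped_deviation l) \<le> 2 * B + 2 * r\<^sup>2" if r_pos: "r > 0" for r
  proof -
    let ?far = "\<lambda>m. {\<omega>\<in>space M. r < norm (residual h l m \<omega>)}"
    have "mean_square M (stopped_deviation l) \<le> 2 * B + 2 * r\<^sup>2 + prob (?far m)" if m_pos: "m > 0" for m
    proof -
      note [measurable] = random_variable_residual[OF h_pos]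
      note error_integrable = square_integrableD[OF square_integrable[OF m_pos]]
      have far_integrable: "integrable M (\<lambda>\<omega>. indicator (?far m) \<omega> :: real)"
        by (intro integrable_real_indicator) (auto simp: emeasure_eq_measure)
      have "mean_square M (stopped_deviation l) \<le>
          (\<integral>\<omega>. 2 * (norm (stopped_error m l \<omega>))\<^sup>2 + 2 * r\<^sup>2 + indicator (?far m) \<omega> \<partial>M)"
        using error_integrable far_integrable
        by (intro mean_square_le_integral[OF _ _ norm_stopped_deviation_square_le[OF m_pos]]
            square_integrable_measurable[OF square_integrable_stopped_deviation]) auto
      also have "\<dots> = 2 * mean_square M (stopped_error m l) + 2 * r\<^sup>2 + prob (?far m)"
        using error_integrable far_integrable by (simp add: mean_square_def prob_space)
      finally show ?thesis using error_le[OF m_pos] by simp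
    qed
    then show ?thesis
      using vanishes_in_probD[OF residual_vanishes[OF h_pos] r_pos] by (rule le_if_le_add_tendsto_0)
  qed
  show ?thesis
  proof (rule field_le_epsilon)
    fix e :: real assume "e > 0"
    then show "mean_square M (stopped_deviation l) \<le> 2 * B + e"
      using le_add_square[of "sqrt (e / 2)"] by simp
  qed
qed

lemma mean_square_stopped_error_le_error_bound:
  assumes m_pos: "m > 0" and N_time_le: "real N * h \<le> T"
  shows "mean_square M (stopped_error m N) \<le> error_bound T R K h / 2"
proof -
  let ?c = "gronwall_rate T K" and ?e = "\<lambda>k. mean_square M (stopped_deviation k)"
  define a where "a = ?c * T * modulus T R h + 4 * T\<^sup>2 * perturbation_bound R h"
  have c_nonneg: "?c \<ge> 0"
    using T_nonneg by (simp add: gronwall_rate_def)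
  have a_nonneg: "a \<ge> 0"
    using c_nonneg T_nonneg modulus_nonneg perturbation_bound_nonneg[OF less_imp_le[OF h_pos]]
    by (simp add: a_def)
  have error_le: "mean_square M (stopped_error m l) \<le> (a + ?c * h * (\<Sum>k<l. ?e k)) / 2"
    if "m > 0" "l \<le> N" for m l
    using mean_square_stopped_error_le[OF that(1) grid_times_le[OF that(2) N_time_le]]
    by (simp add: a_def gronwall_rate_def coeff_energy_def field_simps)
  have "?e l \<le> a + ?c * h * (\<Sum>k<l. ?e k)" if "l < N" for l
  proof -
    have "l \<le> N" using that by simp
    then have "?e l \<le> 2 * ((a + ?c * h * (\<Sum>k<l. ?e k)) / 2)"
      by (intro mean_square_stopped_deviation_le error_le square_integrable_stopped_error
        grid_times_le[OF _ N_time_le])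
    then show ?thesis by simp
  qed
  then have "a + ?c * h * (\<Sum>k<N. ?e k) \<le> a * (1 + ?c * h) ^ N"
    using c_nonneg h_pos by (intro discrete_gronwall) auto
  also have "\<dots> \<le> a * exp (?c * T)"
    using c_nonneg h_pos N_time_le by (intro mult_left_mono a_nonneg one_plus_power_le_exp) auto
  also have "\<dots> = error_bound T R K h"
    by (simp add: error_bound_def a_def)
  finally show ?thesis
    using error_le[OF m_pos order_refl] by simp
qed

text \<open>The stopped error is frozen at the first grid time at which the deviation exceeds \<open>\<epsilon>\<close>, so a
  bound at the final time alone controls the whole path.\<close>

lemma exit_imp_stopped_error_or_residual:
  assumes m_pos: "m > 0" and \<omega>_in_space: "\<omega> \<in> space M" and running_max_le_R: "running_max T \<omega> \<le> R"
    and N_time_le: "real N * h \<le> T" and exit: "\<exists>k\<le>N. \<epsilon> < norm (deviation k \<omega>)"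
  shows "\<epsilon> / 2 \<le> norm (stopped_error m N \<omega>) \<or> \<epsilon> / 2 < (\<Sum>l\<le>N. norm (residual h l m \<omega>))"
proof -
  define l where "l = (LEAST k. \<epsilon> < norm (deviation k \<omega>))"
  obtain k where k_exit: "k \<le> N" "\<epsilon> < norm (deviation k \<omega>)"
    using exit by blast
  have l_exit: "\<epsilon> < norm (deviation l \<omega>)"
    unfolding l_def using k_exit(2) by (rule LeastI)
  have "l \<le> k"
    unfolding l_def using k_exit(2) by (rule Least_le)
  then have l_le_N: "l \<le> N"
    using k_exit(1) by simp
  have before: "norm (deviation j \<omega>) \<le> \<epsilon>" if "j < l" for j
    using not_less_Least[OF that[unfolded l_def]] by simp
  have running_max_le_R_before: "running_max (real j * h) \<omega> \<le> R" if "j \<le> N" for j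
    using running_max_mono[OF \<omega>_in_space _ grid_times_le[OF that N_time_le]] running_max_le_R h_pos by simp
  have "\<omega> \<in> close j" if "j < l" for j
    using that \<omega>_in_space l_le_N running_max_le_R_before[of j] before by (auto simp: close_def)
  moreover have "\<omega> \<notin> close l"
    using l_exit norm_deviation_le[of \<omega> l] by auto
  ultimately have "stopped_error m N \<omega> = deviation l \<omega> - residual h l m \<omega>"
    using stopped_error_frozen[OF m_pos l_le_N]
      stopped_error_eq[OF m_pos _ \<omega>_in_space running_max_le_R_before[OF l_le_N]] by simp
  moreover have "norm (residual h l m \<omega>) \<le> (\<Sum>l\<le>N. norm (residual h l m \<omega>))"
    using l_le_N by (intro member_le_sum) auto
  ultimately show ?thesis
    using l_exit norm_triangle_ineq2[of "deviation l \<omega>" "residual h l m \<omega>"] by auto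
qed

lemma exit_prob_le:
  assumes N_time_le: "real N * h \<le> T"
  shows "prob {\<omega>\<in>space M. running_max T \<omega> \<le> R \<and> (\<exists>k\<le>N. \<epsilon> < norm (deviation k \<omega>))} \<le>
    2 * error_bound T R K h / \<epsilon>\<^sup>2"
    (is "prob ?exit \<le> _")
proof -
  let ?res = "\<lambda>m. {\<omega>\<in>space M. \<epsilon> / 2 < (\<Sum>l\<le>N. norm (residual h l m \<omega>))}"
  have "prob ?exit \<le> 2 * error_bound T R K h / \<epsilon>\<^sup>2 + prob (?res m)" if m_pos: "m > 0" for m
  proof -
    let ?S = "{\<omega>\<in>space M. \<epsilon> / 2 \<le> norm (stopped_error m N \<omega>)}"
    note error_integrable = square_integrable_stopped_error[OF m_pos N_time_le]
    note [measurable] = square_integrable_measurable[OF error_integrable] random_variable_residual[OF h_pos]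
    have "prob ?S \<le> mean_square M (stopped_error m N) / (\<epsilon> / 2)\<^sup>2"
      using \<epsilon>_pos by (intro prob_norm_ge_le_mean_square error_integrable) simp
    also have "\<dots> \<le> (error_bound T R K h / 2) / (\<epsilon> / 2)\<^sup>2"
      by (intro divide_right_mono mean_square_stopped_error_le_error_bound m_pos N_time_le) simp
    finally have prob_S_le: "prob ?S \<le> 2 * error_bound T R K h / \<epsilon>\<^sup>2"
      by (simp add: power_divide)
    have "prob ?exit \<le> prob ?S + prob (?res m)"
      using exit_imp_stopped_error_or_residual[OF m_pos _ _ N_time_le] by (intro prob_subset_Un_le) auto
    then show ?thesis using prob_S_le by simp
  qed
  moreover have "(\<lambda>m. prob (?res m)) \<longlonglongrightarrow> 0"
    using \<epsilon>_pos by (intro vanishes_in_probD[OF vanishes_in_prob_sum] residual_vanishes h_pos) auto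
  ultimately show ?thesis
    by (rule le_if_le_add_tendsto_0)
qed

lemma prob_grid_error_exceeds_le:
  "prob {\<omega>\<in>space M. \<epsilon> < grid_error T h \<omega>} \<le>
    2 * error_bound T R K h / \<epsilon>\<^sup>2 + prob {\<omega>\<in>space M. R < running_max T \<omega>}"
proof -
  define N where "N = nat \<lfloor>T / h\<rfloor>"
  let ?exit = "{\<omega>\<in>space M. running_max T \<omega> \<le> R \<and> (\<exists>k\<le>N. \<epsilon> < norm (deviation k \<omega>))}"
  note [measurable] = random_variable_running_max[OF T_nonneg] random_variable_deviation
  have "prob {\<omega>\<in>space M. \<epsilon> < grid_error T h \<omega>} \<le> prob ?exit + prob {\<omega>\<in>space M. R < running_max T \<omega>}"
    unfolding less_grid_error_iff deviation_def[symmetric] N_def[symmetric]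
    by (intro prob_subset_Un_le) (auto simp: not_le)
  also have "prob ?exit \<le> 2 * error_bound T R K h / \<epsilon>\<^sup>2"
    unfolding N_def by (intro exit_prob_le nat_floor_grid T_nonneg h_pos)
  finally show ?thesis by simp
qed

end

subsection \<open>Convergence of the grid error\<close>

lemma (in sde_euler) grid_error_vanishes:
  assumes T_nonneg: "T \<ge> 0"
  shows "vanishes_in_prob (at_right 0) (grid_error T)"
  unfolding vanishes_in_prob_def
proof (intro conjI allI impI)
  show "\<forall>\<^sub>F h in at_right 0. random_variable borel (grid_error T h)"
    using eventually_at_right_less[of 0] by eventually_elim (rule random_variable_grid_error)
  fix \<epsilon>0 :: real assume "\<epsilon>0 > 0"
  define \<epsilon> where "\<epsilon> = min \<epsilon>0 1"
  have \<epsilon>_bounds: "0 < \<epsilon>" "\<epsilon> \<le> 1" "\<epsilon> \<le> \<epsilon>0"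
    using \<open>\<epsilon>0 > 0\<close> by (auto simp: \<epsilon>_def)
  show "((\<lambda>h. prob {\<omega>\<in>space M. \<epsilon>0 < grid_error T h \<omega>}) \<longlongrightarrow> 0) (at_right 0)"
  proof (rule order_tendstoI)
    fix e :: real assume e_pos: "0 < e"
    obtain R where R_nonneg: "R \<ge> 0" and prob_R: "prob {\<omega>\<in>space M. R < running_max T \<omega>} < e / 2"
      using exists_prob_greater_less[OF random_variable_running_max[OF T_nonneg], of "e / 2"] e_pos by auto
    obtain K where K_lipschitz: "K-lipschitz_on (cball 0 (R + 1)) b" "K-lipschitz_on (cball 0 (R + 1)) \<sigma>"
      using lipschitz_on_cball[of "R + 1"] R_nonneg by auto
    have "0 < \<epsilon>\<^sup>2 * e / 4"
      using \<epsilon>_bounds e_pos by simp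
    from order_tendstoD(2)[OF error_bound_tendsto_0[OF T_nonneg R_nonneg, of K] this]
      eventually_at_right_less[of 0]
    show "\<forall>\<^sub>F h in at_right 0. prob {\<omega>\<in>space M. \<epsilon>0 < grid_error T h \<omega>} < e"
    proof eventually_elim
      case (elim h)
      interpret coupling M F W b \<sigma> \<eta> x0 K1 K2 \<alpha> X h T R \<epsilon> K
        by unfold_locales (use elim T_nonneg R_nonneg \<epsilon>_bounds K_lipschitz in auto)
      note [measurable] = random_variable_grid_error[OF h_pos]
      have "prob {\<omega>\<in>space M. \<epsilon>0 < grid_error T h \<omega>} \<le> prob {\<omega>\<in>space M. \<epsilon> < grid_error T h \<omega>}"
        using \<epsilon>_bounds(3) by (intro finite_measure_mono) auto
      also note prob_grid_error_exceeds_le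
      also have "2 * error_bound T R K h / \<epsilon>\<^sup>2 + prob {\<omega>\<in>space M. R < running_max T \<omega>} < e / 2 + e / 2"
        using elim(1) \<epsilon>_bounds prob_R by (intro add_strict_mono) (simp_all add: divide_less_eq mult_ac)
      finally show ?case by simp
    qed
  qed (rule always_eventually, simp add: less_le_trans[OF _ measure_nonneg])
qed

section \<open>Convergence of moments\<close>

context sde_euler
begin

definition Y_interp :: "real \<Rightarrow> real \<Rightarrow> 'a \<Rightarrow> real ^ 'm" where
  "Y_interp h t \<omega> = linear_interp h (\<lambda>n. Y h n \<omega>) t"

definition sup_error :: "real \<Rightarrow> real \<Rightarrow> 'a \<Rightarrow> real" where
  "sup_error \<tau> h \<omega> = (SUP t\<in>{0..\<tau>}. norm (X t \<omega> - Y_interp h t \<omega>))"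

lemma Y_interp_eq_euler_interp: "Y_interp = euler_interp W b \<sigma> \<eta> x0"
  by (simp add: fun_eq_iff Y_interp_def linear_interp_def euler_interp_def)

lemma random_variable_Y_interp:
  assumes "h > 0"
  shows "random_variable borel (Y_interp h t)"
proof -
  note [measurable] = random_variable_Y[OF assms]
  show ?thesis
    unfolding Y_interp_def[abs_def] linear_interp_def Let_def by measurable
qed

lemma continuous_on_error:
  assumes "h > 0" "\<omega> \<in> space M"
  shows "continuous_on {0..\<tau>} (\<lambda>t. norm (X t \<omega> - Y_interp h t \<omega>))"
  unfolding Y_interp_def
  using assms by (intro continuous_intros process_continuous_on continuous_on_linear_interp) auto

lemma random_variable_sup_error:
  assumes "h > 0" "\<tau> \<ge> 0"
  shows "random_variable borel (sup_error \<tau> h)"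
  unfolding sup_error_def[abs_def]
proof (rule borel_measurable_SUP_continuous)
  fix t assume "t \<in> {0..\<tau>}"
  then have [measurable]: "random_variable borel (X t)" "random_variable borel (Y_interp h t)"
    using assms by (auto intro: random_variable_X random_variable_Y_interp)
  show "random_variable borel (\<lambda>\<omega>. norm (X t \<omega> - Y_interp h t \<omega>))"
    by measurable
qed (use assms continuous_on_error in auto)

lemma norm_le_sup_error:
  assumes "h > 0" "\<omega> \<in> space M" "t \<in> {0..\<tau>}"
  shows "norm (X t \<omega> - Y_interp h t \<omega>) \<le> sup_error \<tau> h \<omega>"
  unfolding sup_error_def using assms(3)
  by (intro continuous_on_le_SUP continuous_on_error assms(1,2)) auto

lemma sup_error_nonneg: "h > 0 \<Longrightarrow> \<tau> \<ge> 0 \<Longrightarrow> \<omega> \<in> space M \<Longrightarrow> sup_error \<tau> h \<omega> \<ge> 0"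
  by (rule order_trans[OF norm_ge_zero norm_le_sup_error[of h \<omega> 0 \<tau>]]) auto

text \<open>The node to the right of \<open>t\<close> may lie beyond \<open>\<tau>\<close>, hence the bounds on \<open>[0, \<tau> + 1]\<close>.\<close>

lemma Y_interp_in_cball:
  assumes h_bounds: "0 < h" "h \<le> 1" and t_in: "t \<in> {0..\<tau>}"
    and nodes: "\<And>k. k \<le> nat \<lfloor>(\<tau> + 1) / h\<rfloor> \<Longrightarrow> real k * h \<in> {0..\<tau> + 1} \<Longrightarrow>
      \<bar>t - real k * h\<bar> \<le> h \<Longrightarrow> Y h k \<omega> \<in> cball z B"
  shows "Y_interp h t \<omega> \<in> cball z B"
proof -
  define n where "n = nat \<lfloor>t / h\<rfloor>"
  have node_bounds: "real n * h \<le> t" "t < real n * h + h"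
    using nat_floor_grid[of t h] t_in h_bounds unfolding n_def real_Suc_mult by auto
  have node_index_le: "k \<le> nat \<lfloor>(\<tau> + 1) / h\<rfloor>" if "real k * h \<le> \<tau> + 1" for k
    using that h_bounds by (simp add: le_nat_floor pos_le_divide_eq)
  have "Y h n \<omega> \<in> cball z B" "Y h (Suc n) \<omega> \<in> cball z B"
    using node_bounds t_in h_bounds
    by (auto intro!: nodes node_index_le simp: real_Suc_mult simp del: of_nat_Suc mem_cball)
  then have "closed_segment (Y h n \<omega>) (Y h (Suc n) \<omega>) \<subseteq> cball z B"
    by (intro closed_segment_subset convex_cball)
  then show ?thesis
    using linear_interp_in_closed_segment[of t h "\<lambda>k. Y h k \<omega>"] t_in h_bounds
    by (auto simp: Y_interp_def n_def)
qed

lemma sup_error_le_grid_error_plus_oscillation: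
  assumes h_bounds: "0 < h" "h \<le> 1" and \<tau>_nonneg: "\<tau> \<ge> 0" and \<omega>_in_space: "\<omega> \<in> space M"
  shows "sup_error \<tau> h \<omega> \<le> grid_error (\<tau> + 1) h \<omega> + oscillation (\<tau> + 1) h \<omega>"
  unfolding sup_error_def
proof (rule cSUP_least)
  fix t assume t_in: "t \<in> {0..\<tau>}"
  have "Y_interp h t \<omega> \<in> cball (X t \<omega>) (grid_error (\<tau> + 1) h \<omega> + oscillation (\<tau> + 1) h \<omega>)"
  proof (rule Y_interp_in_cball[OF h_bounds t_in])
    fix k assume k_near: "k \<le> nat \<lfloor>(\<tau> + 1) / h\<rfloor>" "real k * h \<in> {0..\<tau> + 1}" "\<bar>t - real k * h\<bar> \<le> h"
    have "norm (X t \<omega> - Y h k \<omega>) \<le> norm (X t \<omega> - X (real k * h) \<omega>) + norm (X (real k * h) \<omega> - Y h k \<omega>)"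
      using norm_triangle_ineq[of "X t \<omega> - X (real k * h) \<omega>" "X (real k * h) \<omega> - Y h k \<omega>"] by simp
    also have "\<dots> \<le> oscillation (\<tau> + 1) h \<omega> + grid_error (\<tau> + 1) h \<omega>"
      using t_in k_near by (intro add_mono norm_diff_le_oscillation norm_le_grid_error \<omega>_in_space) auto
    finally show "Y h k \<omega> \<in> cball (X t \<omega>) (grid_error (\<tau> + 1) h \<omega> + oscillation (\<tau> + 1) h \<omega>)"
      by (simp add: dist_norm)
  qed
  then show "norm (X t \<omega> - Y_interp h t \<omega>) \<le> grid_error (\<tau> + 1) h \<omega> + oscillation (\<tau> + 1) h \<omega>"
    by (simp add: dist_norm)
qed (use \<tau>_nonneg in auto)

lemma eventually_small_step: "\<forall>\<^sub>F h::real in at_right 0. 0 < h \<and> h \<le> 1"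
  by (auto simp: eventually_at_right_field intro!: exI[of _ 1])

lemma sup_error_vanishes:
  assumes \<tau>_nonneg: "\<tau> \<ge> 0"
  shows "vanishes_in_prob (at_right 0) (sup_error \<tau>)"
proof (rule vanishes_in_prob_le_add)
  show "vanishes_in_prob (at_right 0) (grid_error (\<tau> + 1))"
    "vanishes_in_prob (at_right 0) (oscillation (\<tau> + 1))"
    using \<tau>_nonneg by (intro grid_error_vanishes oscillation_vanishes_in_prob; simp)+
  show "\<forall>\<^sub>F h in at_right 0. random_variable borel (sup_error \<tau> h)"
    using eventually_small_step by eventually_elim (use \<tau>_nonneg in \<open>simp add: random_variable_sup_error\<close>)
  show "\<forall>\<^sub>F h in at_right 0. \<forall>\<omega>\<in>space M. sup_error \<tau> h \<omega> \<le> grid_error (\<tau> + 1) h \<omega> + oscillation (\<tau> + 1) h \<omega>"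
    using eventually_small_step
    by eventually_elim (use \<tau>_nonneg in \<open>simp add: sup_error_le_grid_error_plus_oscillation\<close>)
qed

definition grid_exceeds :: "real \<Rightarrow> real \<Rightarrow> real \<Rightarrow> 'a set" where
  "grid_exceeds \<tau> h c = {\<omega>\<in>space M. \<exists>k\<le>nat \<lfloor>(\<tau> + 1) / h\<rfloor>. c < norm (Y h k \<omega>)}"

lemma grid_exceeds_event:
  assumes "h > 0"
  shows "grid_exceeds \<tau> h c \<in> events"
proof -
  note [measurable] = random_variable_Y[OF assms]
  show ?thesis
    unfolding grid_exceeds_def by measurable
qed

lemma norm_Y_interp_le:
  assumes h_bounds: "0 < h" "h \<le> 1" and t_in: "t \<in> {0..\<tau>}" and \<omega>_in: "\<omega> \<in> space M" "\<omega> \<notin> grid_exceeds \<tau> h c"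
  shows "norm (Y_interp h t \<omega>) \<le> c"
  using Y_interp_in_cball[OF h_bounds t_in, of \<omega> 0 c] \<omega>_in by (auto simp: grid_exceeds_def not_less)

lemma running_max_tail:
  assumes k_ge_1: "1 \<le> k" and \<tau>_nonneg: "\<tau> \<ge> 0"
    and tail: "\<And>h c. \<lbrakk>0 < h; h \<le> 1; c > 0\<rbrakk> \<Longrightarrow> prob (grid_exceeds \<tau> h c) \<le> C / c ^ (2 * k)" and c_pos: "c > 0"
  shows "prob {\<omega>\<in>space M. c < running_max \<tau> \<omega>} \<le> C / (c / 2) ^ (2 * k)"
proof -
  have bound_tendsto: "((\<lambda>h. prob {\<omega>\<in>space M. c / 2 < sup_error \<tau> h \<omega>} + C / (c / 2) ^ (2 * k)) \<longlongrightarrow>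
    0 + C / (c / 2) ^ (2 * k)) (at_right 0)"
    using c_pos by (intro tendsto_intros vanishes_in_probD[OF sup_error_vanishes[OF \<tau>_nonneg]]) auto
  have "\<forall>\<^sub>F h in at_right 0. prob {\<omega>\<in>space M. c < running_max \<tau> \<omega>} \<le>
      prob {\<omega>\<in>space M. c / 2 < sup_error \<tau> h \<omega>} + C / (c / 2) ^ (2 * k)"
    using eventually_small_step
  proof eventually_elim
    case (elim h)
    then have h_bounds: "0 < h" "h \<le> 1" by auto
    note [measurable] = random_variable_sup_error[OF h_bounds(1) \<tau>_nonneg] grid_exceeds_event[OF h_bounds(1)]
    have "running_max \<tau> \<omega> \<le> c"
      if \<omega>_bounds: "\<omega> \<in> space M" "\<omega> \<notin> grid_exceeds \<tau> h (c / 2)" "sup_error \<tau> h \<omega> \<le> c / 2" for \<omega>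
    proof (rule running_max_le[OF \<tau>_nonneg])
      fix t assume t_in: "t \<in> {0..\<tau>}"
      have "norm (X t \<omega>) \<le> norm (X t \<omega> - Y_interp h t \<omega>) + norm (Y_interp h t \<omega>)"
        using norm_triangle_ineq[of "X t \<omega> - Y_interp h t \<omega>" "Y_interp h t \<omega>"] by simp
      also have "\<dots> \<le> c / 2 + c / 2"
        using norm_le_sup_error[OF h_bounds(1) \<omega>_bounds(1) t_in]
          norm_Y_interp_le[OF h_bounds t_in \<omega>_bounds(1,2)] \<omega>_bounds(3) by linarith
      finally show "norm (X t \<omega>) \<le> c" by simp
    qed
    then have "prob {\<omega>\<in>space M. c < running_max \<tau> \<omega>} \<le>
        prob {\<omega>\<in>space M. c / 2 < sup_error \<tau> h \<omega>} + prob (grid_exceeds \<tau> h (c / 2))"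
      by (intro prob_subset_Un_le) (auto simp: not_le[symmetric])
    also have "\<dots> \<le> prob {\<omega>\<in>space M. c / 2 < sup_error \<tau> h \<omega>} + C / (c / 2) ^ (2 * k)"
      using c_pos by (intro add_left_mono tail h_bounds) simp
    finally show ?case .
  qed
  from tendsto_lowerbound[OF bound_tendsto this] show ?thesis by simp
qed

lemma sup_error_tail:
  assumes k_ge_1: "1 \<le> k" and \<tau>_nonneg: "\<tau> \<ge> 0"
  obtains D where "D \<ge> 0" "\<And>h c. \<lbrakk>0 < h; h \<le> 1; c > 0\<rbrakk> \<Longrightarrow>
    prob {\<omega>\<in>space M. c < sup_error \<tau> h \<omega>} \<le> D / c ^ (2 * k)"
proof -
  obtain C where C_nonneg: "C \<ge> 0" and grid: "\<And>h n c. \<lbrakk>0 < h; h \<le> 1; real n * h \<le> \<tau> + 1; c > 0\<rbrakk> \<Longrightarrow>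
      prob {\<omega>\<in>space M. \<exists>i\<le>n. c < norm (Y h i \<omega>)} \<le> C / c ^ (2 * k)"
    by (rule grid_tail[OF k_ge_1]) blast
  have tail: "prob (grid_exceeds \<tau> h c) \<le> C / c ^ (2 * k)" if "0 < h" "h \<le> 1" "c > 0" for h c
    unfolding grid_exceeds_def using that \<tau>_nonneg by (intro grid nat_floor_grid) auto
  have "prob {\<omega>\<in>space M. c < sup_error \<tau> h \<omega>} \<le> C * (4 ^ (2 * k) + 2 ^ (2 * k)) / c ^ (2 * k)"
    if h_bounds: "0 < h" "h \<le> 1" and c_pos: "c > 0" for h c
  proof -
    note [measurable] = random_variable_running_max[OF \<tau>_nonneg] grid_exceeds_event[OF h_bounds(1)]
    have "sup_error \<tau> h \<omega> \<le> c"
      if \<omega>_bounds: "\<omega> \<in> space M" "\<omega> \<notin> grid_exceeds \<tau> h (c / 2)" "running_max \<tau> \<omega> \<le> c / 2" for \<omega>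
      unfolding sup_error_def
    proof (rule cSUP_least)
      fix t assume t_in: "t \<in> {0..\<tau>}"
      have "norm (X t \<omega> - Y_interp h t \<omega>) \<le> norm (X t \<omega>) + norm (Y_interp h t \<omega>)"
        by (rule norm_triangle_ineq4)
      also have "\<dots> \<le> c / 2 + c / 2"
        using norm_le_running_max[OF \<omega>_bounds(1) t_in]
          norm_Y_interp_le[OF h_bounds t_in \<omega>_bounds(1,2)] \<omega>_bounds(3) by linarith
      finally show "norm (X t \<omega> - Y_interp h t \<omega>) \<le> c" by simp
    qed (use \<tau>_nonneg in auto)
    then have "prob {\<omega>\<in>space M. c < sup_error \<tau> h \<omega>} \<le>
        prob {\<omega>\<in>space M. c / 2 < running_max \<tau> \<omega>} + prob (grid_exceeds \<tau> h (c / 2))"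
      by (intro prob_subset_Un_le) (auto simp: not_le[symmetric])
    also have "\<dots> \<le> C / (c / 2 / 2) ^ (2 * k) + C / (c / 2) ^ (2 * k)"
      using c_pos by (intro add_mono running_max_tail[OF k_ge_1 \<tau>_nonneg tail] tail h_bounds) auto
    also have "\<dots> = C * (4 ^ (2 * k) + 2 ^ (2 * k)) / c ^ (2 * k)"
      by (simp add: power_divide distrib_left add_divide_distrib)
    finally show ?thesis .
  qed
  then show ?thesis
    using C_nonneg by (intro that[of "C * (4 ^ (2 * k) + 2 ^ (2 * k))"]) auto
qed

theorem euler_interp_converges:
  assumes \<tau>_nonneg: "\<tau> \<ge> 0" and p_pos: "p > 0"
  shows "((\<lambda>h. \<integral>\<^sup>+ \<omega>. ennreal (sup_error \<tau> h \<omega> powr p) \<partial>M) \<longlongrightarrow> 0) (at_right 0)"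
proof -
  define P where "P = nat \<lceil>p\<rceil>"
  have p_le_P: "p \<le> real P"
    unfolding P_def by linarith
  obtain D where D_nonneg: "D \<ge> 0" and tail: "\<And>h c. \<lbrakk>0 < h; h \<le> 1; c > 0\<rbrakk> \<Longrightarrow>
      prob {\<omega>\<in>space M. c < sup_error \<tau> h \<omega>} \<le> D / c ^ (2 * Suc P)"
    by (rule sup_error_tail[of "Suc P" \<tau>]) (use \<tau>_nonneg in auto)
  show ?thesis
  proof (rule powr_moment_tendsto_0[OF sup_error_vanishes[OF \<tau>_nonneg] p_pos p_le_P D_nonneg])
    show "\<forall>\<^sub>F h in at_right 0. \<forall>\<omega>\<in>space M. sup_error \<tau> h \<omega> \<ge> 0"
      using eventually_small_step by eventually_elim (use \<tau>_nonneg in \<open>simp add: sup_error_nonneg\<close>)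
    show "\<forall>\<^sub>F h in at_right 0. \<forall>c>0. prob {\<omega>\<in>space M. c < sup_error \<tau> h \<omega>} \<le> D / c ^ (2 * Suc P)"
      using eventually_small_step by eventually_elim (use tail in blast)
  qed
qed

end

theorem theorem5p4:
  fixes M :: "'a measure" and F :: "real \<Rightarrow> 'a measure"
    and W :: "real \<Rightarrow> 'a \<Rightarrow> real ^ 'd"
    and b :: "real ^ 'm \<Rightarrow> real ^ 'm" and \<sigma> :: "real ^ 'm \<Rightarrow> real ^ 'd ^ 'm"
    and \<eta> :: "real \<Rightarrow> real ^ 'm \<Rightarrow> real ^ 'd \<Rightarrow> real ^ 'm"
    and x0 :: "real ^ 'm" and X :: "real \<Rightarrow> 'a \<Rightarrow> real ^ 'm"
    and K1 K2 :: real and \<alpha> :: ereal and \<tau> p :: real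
  assumes "prob_space M"
    and "brownian_motion M F W"
    and loclip: "\<forall>N>0. \<exists>K. \<forall>x y. norm x \<le> N \<longrightarrow> norm y \<le> N \<longrightarrow>
               norm (b x - b y) \<le> K * norm (x - y) \<and> norm (\<sigma> x - \<sigma> y) \<le> K * norm (x - y)"
    and lingrowth: "\<forall>x. norm (b x) \<le> K1 * (1 + norm x) \<and> norm (\<sigma> x) \<le> K1 * (1 + norm x)"
    and eta_meas: "\<forall>h>0. (\<lambda>(x, y). \<eta> h x y) \<in> borel_measurable borel"
    and "\<alpha> > 0"
    and eta_bound: "\<forall>h>0. \<forall>x y. norm (\<eta> h x y) \<le> K2 * (hpow h \<alpha> * norm x + norm y)"
    and "sde_solution M F W b \<sigma> x0 X"
    and "\<tau> > 0" and "p > 2"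
  shows "((\<lambda>h. \<integral>\<^sup>+ \<omega>. ennreal ((SUP t\<in>{0..\<tau>}. norm (X t \<omega> - euler_interp W b \<sigma> \<eta> x0 h t \<omega>)) powr p) \<partial>M)
          \<longlongrightarrow> 0) (at_right 0)"
proof -
  interpret prob_space M by fact
  have "filtration_on M F"
    using \<open>brownian_motion M F W\<close> by (simp add: brownian_motion_def)
  interpret sde_euler M F W b \<sigma> \<eta> x0 K1 K2 \<alpha> X
    by unfold_locales fact+
  have "((\<lambda>h. \<integral>\<^sup>+ \<omega>. ennreal (sup_error \<tau> h \<omega> powr p) \<partial>M) \<longlongrightarrow> 0) (at_right 0)"
    using \<open>\<tau> > 0\<close> \<open>p > 2\<close> by (intro euler_interp_converges) auto
  then show ?thesis
    by (simp only: sup_error_def Y_interp_eq_euler_interp)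
qed

end
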